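(* Let $(M,\nabla,\langle\cdot,\cdot\rangle)$ be an affine-Riemann manifold with Koszul forms $\alpha$ and $\xi$, and let $(TM,J_1,g_1)$ be its canonical Hermitian structure. The Lee form $\theta_1$ of $(TM,J_1,g_1)$ is given by $$\theta_1=\pi_1^*(\alpha-\xi).$$ In particular, $(TM,J_1,g_1)$ is balanced if and only if $\alpha=\xi$, which is also equivalent to $\mathrm{tr}_{\langle,\rangle}(\gamma^*-\gamma)=0$. Moreover, $(TM,J_1,g_1)$ is locally conformally balanced if and only if $d\xi=0$.
   Context: An affine-Riemann manifold $(M,\nabla,\langle\cdot,\cdot\rangle)$ is a manifold $M$ of dimension $n$ with a flat torsionless connection $\nabla$ and a Riemannian metric $\langle\cdot,\cdot\rangle$. $D$ is the Levi-Civita connection of the metric; the difference tensor is $\gamma_XY=D_XY-\nabla_XY$, and $\gamma^*$ is defined by $\langle\gamma^*_XY,Z\rangle=\langle Y,\gamma_XZ\rangle$. For a local orthonormal frame $(E_i)$, $\mathrm{tr}_{\langle,\rangle}(\gamma)=\sum_i\gamma_{E_i}E_i$ and $\mathrm{tr}_{\langle,\rangle}(\gamma^* )=\sum_i\gamma^*_{E_i}E_i$. The Koszul forms are $\alpha(X)=\langle\mathrm{tr}_{\langle,\rangle}(\gamma^* ),X\rangle$ and $\xi(X)=\langle\mathrm{tr}_{\langle,\rangle}(\gamma),X\rangle$. Canonical Hermitian structure: $\pi_1:TM\to M$ is the projection; for a vector field $X$ on $M$, $X^h$ is the horizontal lift with respect to $\nabla$ and $X^v$ the vertical lift; $J_1X^h=X^v$,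 $J_1X^v=-X^h$; $g_1(X^h,Y^h)=g_1(X^v,Y^v)=\langle X,Y\rangle\circ\pi_1$, $g_1(X^h,Y^v)=0$. For a Hermitian manifold $(N,J,g)$: fundamental form $\omega=g(J\cdot,\cdot)$; $d^*\eta(X_1,\dots,X_{p-1})=-\sum_i(\nabla^{LC}_{E_i}\eta)(E_i,X_1,\dots,X_{p-1})$ with $\nabla^{LC}$ the Levi-Civita connection of $g$ and $(E_i)$ a local $g$-orthonormal frame; Lee form $\theta=-d^*\omega\circ J$. $(N,J,g)$ is balanced if $\theta=0$ and locally conformally balanced if $d\theta=0$. *)

theory Defs
  imports "HOL-Analysis.Analysis"
begin

section \<open>Smooth manifolds\<close>

text \<open>The set \<open>S\<close> is meant to be open.\<close>

primrec Ck_on :: "nat \<Rightarrow> 'e::euclidean_space set \<Rightarrow> ('e \<Rightarrow> 'f::real_normed_vector) \<Rightarrow> bool" where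
  "Ck_on 0 S f \<longleftrightarrow> continuous_on S f"
| "Ck_on (Suc k) S f \<longleftrightarrow>
     f differentiable_on S \<and> (\<forall>v. Ck_on k S (\<lambda>x. frechet_derivative f (at x) v))"

definition smooth_on :: "'e::euclidean_space set \<Rightarrow> ('e \<Rightarrow> 'f::real_normed_vector) \<Rightarrow> bool" where
  "smooth_on S f \<longleftrightarrow> (\<forall>k. Ck_on k S f)"

text \<open>A manifold of dimension \<open>DIM('e)\<close> is given by a (not necessarily maximal) smooth atlas. Its
  points are those covered by the charts, and its topology is the one that makes the charts
  homeomorphisms onto open subsets of the model space.\<close>

type_synonym ('a, 'e) chart = "'a set \<times> ('a \<Rightarrow> 'e)"

definition pts :: "('a, 'e) chart set \<Rightarrow> 'a set" where
  "pts A = (\<Union>(U, \<phi>)\<in>A. U)"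

definition mtop :: "('a, 'e::euclidean_space) chart set \<Rightarrow> 'a topology" where
  "mtop A = topology (\<lambda>V. V \<subseteq> pts A \<and> (\<forall>(U, \<phi>)\<in>A. open (\<phi> ` (V \<inter> U))))"

definition smooth_atlas :: "('a, 'e::euclidean_space) chart set \<Rightarrow> bool" where
  "smooth_atlas A \<longleftrightarrow>
     (\<forall>(U, \<phi>)\<in>A. inj_on \<phi> U \<and> open (\<phi> ` U)) \<and>
     (\<forall>(U, \<phi>)\<in>A. \<forall>(V, \<psi>)\<in>A.
        open (\<phi> ` (U \<inter> V)) \<and> smooth_on (\<phi> ` (U \<inter> V)) (\<psi> \<circ> inv_into U \<phi>))"

definition manifold :: "('a, 'e::euclidean_space) chart set \<Rightarrow> bool" where
  "manifold A \<longleftrightarrow>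
     smooth_atlas A \<and> Hausdorff_space (mtop A) \<and> second_countable (mtop A)"

definition smooth_fun_on :: "('a, 'e::euclidean_space) chart set \<Rightarrow> 'a set \<Rightarrow> ('a \<Rightarrow> real) \<Rightarrow> bool" where
  "smooth_fun_on A U f \<longleftrightarrow>
     openin (mtop A) U \<and> (\<forall>(V, \<phi>)\<in>A. smooth_on (\<phi> ` (U \<inter> V)) (f \<circ> inv_into V \<phi>))"

definition smooth_near :: "('a, 'e::euclidean_space) chart set \<Rightarrow> 'a \<Rightarrow> ('a \<Rightarrow> real) \<Rightarrow> bool" where
  "smooth_near A p f \<longleftrightarrow> (\<exists>U. p \<in> U \<and> smooth_fun_on A U f)"


section \<open>Tangent vectors and vector fields\<close>

text \<open>A tangent vector at \<open>p\<close> is a derivation at \<open>p\<close> on the functions that are smooth near \<open>p\<close>,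
  extended by zero to all other functions. Dependence on the germ of the function only is a
  consequence: if \<open>f\<close> vanishes on a neighbourhood \<open>U\<close> of \<open>p\<close>, then \<open>f = h * f\<close> for the indicator
  function \<open>h\<close> of the complement of \<open>U\<close>, which is smooth near \<open>p\<close>, and the Leibniz rule gives
  \<open>v f = 0\<close>.\<close>

type_synonym 'a tvec = "('a \<Rightarrow> real) \<Rightarrow> real"
type_synonym 'a vfield = "'a \<Rightarrow> 'a tvec"

definition tangent_space :: "('a, 'e::euclidean_space) chart set \<Rightarrow> 'a \<Rightarrow> 'a tvec set" where
  "tangent_space A p = {v.
     (\<forall>f. \<not> smooth_near A p f \<longrightarrow> v f = 0) \<and>
     (\<forall>f h. smooth_near A p f \<and> smooth_near A p h \<longrightarrow>
        v (\<lambda>q. f q + h q) = v f + v h \<and>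
        v (\<lambda>q. f q * h q) = f p * v h + h p * v f) \<and>
     (\<forall>f c. smooth_near A p f \<longrightarrow> v (\<lambda>q. c * f q) = c * v f)}"

definition tzero :: "'a tvec" where
  "tzero = (\<lambda>f. 0)"

definition tadd :: "'a tvec \<Rightarrow> 'a tvec \<Rightarrow> 'a tvec" where
  "tadd v w = (\<lambda>f. v f + w f)"

definition tdiff :: "'a tvec \<Rightarrow> 'a tvec \<Rightarrow> 'a tvec" where
  "tdiff v w = (\<lambda>f. v f - w f)"

definition tscale :: "real \<Rightarrow> 'a tvec \<Rightarrow> 'a tvec" where
  "tscale c v = (\<lambda>f. c * v f)"

definition tsum :: "('i \<Rightarrow> 'a tvec) \<Rightarrow> 'i set \<Rightarrow> 'a tvec" where
  "tsum v I = (\<lambda>f. \<Sum>i\<in>I. v i f)"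

text \<open>Vector fields are total functions; being a smooth vector field on an open set \<open>U\<close> constrains
  the values on \<open>U\<close> only.\<close>

definition vfield_on :: "('a, 'e::euclidean_space) chart set \<Rightarrow> 'a set \<Rightarrow> 'a vfield \<Rightarrow> bool" where
  "vfield_on A U X \<longleftrightarrow>
     openin (mtop A) U \<and> (\<forall>p\<in>U. X p \<in> tangent_space A p) \<and>
     (\<forall>V f. V \<subseteq> U \<and> smooth_fun_on A V f \<longrightarrow> smooth_fun_on A V (\<lambda>p. X p f))"

text \<open>The guards here and in the next definition keep the values zero on functions that are not
  smooth near the point in question.\<close>

definition lie_bracket :: "('a, 'e::euclidean_space) chart set \<Rightarrow> 'a vfield \<Rightarrow> 'a vfield \<Rightarrow> 'a vfield" where
  "lie_bracket A X Y p f =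
     (if smooth_near A p f then X p (\<lambda>q. Y q f) - Y p (\<lambda>q. X q f) else 0)"

definition differential ::
    "('b, 'f::euclidean_space) chart set \<Rightarrow> ('a \<Rightarrow> 'b) \<Rightarrow> 'a \<Rightarrow> 'a tvec \<Rightarrow> 'b tvec" where
  "differential B \<Phi> p v = (\<lambda>f. if smooth_near B (\<Phi> p) f then v (f \<circ> \<Phi>) else 0)"


section \<open>Connections and Riemannian metrics\<close>

text \<open>A connection acts on vector fields defined on open subsets. That \<open>D X Y\<close> on \<open>U\<close> depends only
  on the restrictions of \<open>X\<close> and \<open>Y\<close> to \<open>U\<close> follows from the axioms, by the argument given for
  tangent vectors.\<close>

definition connection ::
    "('a, 'e::euclidean_space) chart set \<Rightarrow> ('a vfield \<Rightarrow> 'a vfield \<Rightarrow> 'a vfield) \<Rightarrow> bool" where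
  "connection A D \<longleftrightarrow>
     (\<forall>U X Y. vfield_on A U X \<and> vfield_on A U Y \<longrightarrow> vfield_on A U (D X Y)) \<and>
     (\<forall>U X X' Y. vfield_on A U X \<and> vfield_on A U X' \<and> vfield_on A U Y \<longrightarrow>
        (\<forall>p\<in>U. D (\<lambda>q. tadd (X q) (X' q)) Y p = tadd (D X Y p) (D X' Y p))) \<and>
     (\<forall>U f X Y. smooth_fun_on A U f \<and> vfield_on A U X \<and> vfield_on A U Y \<longrightarrow>
        (\<forall>p\<in>U. D (\<lambda>q. tscale (f q) (X q)) Y p = tscale (f p) (D X Y p))) \<and>
     (\<forall>U X Y Y'. vfield_on A U X \<and> vfield_on A U Y \<and> vfield_on A U Y' \<longrightarrow>
        (\<forall>p\<in>U. D X (\<lambda>q. tadd (Y q) (Y' q)) p = tadd (D X Y p) (D X Y' p))) \<and>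
     (\<forall>U f X Y. smooth_fun_on A U f \<and> vfield_on A U X \<and> vfield_on A U Y \<longrightarrow>
        (\<forall>p\<in>U. D X (\<lambda>q. tscale (f q) (Y q)) p
                = tadd (tscale (X p f) (Y p)) (tscale (f p) (D X Y p))))"

definition torsion_free ::
    "('a, 'e::euclidean_space) chart set \<Rightarrow> ('a vfield \<Rightarrow> 'a vfield \<Rightarrow> 'a vfield) \<Rightarrow> bool" where
  "torsion_free A D \<longleftrightarrow>
     (\<forall>U X Y. vfield_on A U X \<and> vfield_on A U Y \<longrightarrow>
        (\<forall>p\<in>U. tdiff (D X Y p) (D Y X p) = lie_bracket A X Y p))"

definition flat ::
    "('a, 'e::euclidean_space) chart set \<Rightarrow> ('a vfield \<Rightarrow> 'a vfield \<Rightarrow> 'a vfield) \<Rightarrow> bool" where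
  "flat A D \<longleftrightarrow>
     (\<forall>U X Y Z. vfield_on A U X \<and> vfield_on A U Y \<and> vfield_on A U Z \<longrightarrow>
        (\<forall>p\<in>U. tdiff (tdiff (D X (D Y Z) p) (D Y (D X Z) p)) (D (lie_bracket A X Y) Z p) = tzero))"

definition riemannian_metric ::
    "('a, 'e::euclidean_space) chart set \<Rightarrow> ('a \<Rightarrow> 'a tvec \<Rightarrow> 'a tvec \<Rightarrow> real) \<Rightarrow> bool" where
  "riemannian_metric A g \<longleftrightarrow>
     (\<forall>p\<in>pts A. \<forall>x\<in>tangent_space A p. \<forall>y\<in>tangent_space A p.
        g p x y = g p y x \<and>
        (\<forall>z\<in>tangent_space A p. g p (tadd x y) z = g p x z + g p y z) \<and>
        (\<forall>c. g p (tscale c x) y = c * g p x y) \<and>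
        (x \<noteq> tzero \<longrightarrow> g p x x > 0)) \<and>
     (\<forall>U X Y. vfield_on A U X \<and> vfield_on A U Y \<longrightarrow> smooth_fun_on A U (\<lambda>p. g p (X p) (Y p)))"

definition metric_connection ::
    "('a, 'e::euclidean_space) chart set \<Rightarrow> ('a \<Rightarrow> 'a tvec \<Rightarrow> 'a tvec \<Rightarrow> real) \<Rightarrow>
      ('a vfield \<Rightarrow> 'a vfield \<Rightarrow> 'a vfield) \<Rightarrow> bool" where
  "metric_connection A g D \<longleftrightarrow>
     (\<forall>U X Y Z. vfield_on A U X \<and> vfield_on A U Y \<and> vfield_on A U Z \<longrightarrow>
        (\<forall>p\<in>U. X p (\<lambda>q. g q (Y q) (Z q)) = g p (D X Y p) (Z p) + g p (Y p) (D X Z p)))"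

text \<open>The choice below is unique as far as the values on \<open>U\<close> for vector fields smooth on \<open>U\<close> are
  concerned.\<close>

definition levi_civita ::
    "('a, 'e::euclidean_space) chart set \<Rightarrow> ('a \<Rightarrow> 'a tvec \<Rightarrow> 'a tvec \<Rightarrow> real) \<Rightarrow>
      'a vfield \<Rightarrow> 'a vfield \<Rightarrow> 'a vfield" where
  "levi_civita A g = (SOME D. connection A D \<and> torsion_free A D \<and> metric_connection A g D)"

definition orthonormal_frame_on ::
    "('a, 'e::euclidean_space) chart set \<Rightarrow> ('a \<Rightarrow> 'a tvec \<Rightarrow> 'a tvec \<Rightarrow> real) \<Rightarrow> 'a set \<Rightarrow>
      (nat \<Rightarrow> 'a vfield) \<Rightarrow> bool" where
  "orthonormal_frame_on (A :: ('a, 'e) chart set) g U E \<longleftrightarrow>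
     (\<forall>i<DIM('e). vfield_on A U (E i)) \<and>
     (\<forall>i<DIM('e). \<forall>j<DIM('e). \<forall>p\<in>U. g p (E i p) (E j p) = (if i = j then 1 else 0))"


section \<open>Differential forms of degree one\<close>

definition form_eq ::
    "('a, 'e::euclidean_space) chart set \<Rightarrow> ('a \<Rightarrow> 'a tvec \<Rightarrow> real) \<Rightarrow> ('a \<Rightarrow> 'a tvec \<Rightarrow> real) \<Rightarrow> bool" where
  "form_eq A \<eta> \<eta>' \<longleftrightarrow> (\<forall>p\<in>pts A. \<forall>x\<in>tangent_space A p. \<eta> p x = \<eta>' p x)"

definition ext_deriv ::
    "('a, 'e::euclidean_space) chart set \<Rightarrow> ('a \<Rightarrow> 'a tvec \<Rightarrow> real) \<Rightarrow> 'a vfield \<Rightarrow> 'a vfield \<Rightarrow> 'a \<Rightarrow> real" where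
  "ext_deriv A \<eta> X Y p =
     X p (\<lambda>q. \<eta> q (Y q)) - Y p (\<lambda>q. \<eta> q (X q)) - \<eta> p (lie_bracket A X Y p)"

definition closed_form :: "('a, 'e::euclidean_space) chart set \<Rightarrow> ('a \<Rightarrow> 'a tvec \<Rightarrow> real) \<Rightarrow> bool" where
  "closed_form A \<eta> \<longleftrightarrow>
     (\<forall>U X Y. vfield_on A U X \<and> vfield_on A U Y \<longrightarrow> (\<forall>p\<in>U. ext_deriv A \<eta> X Y p = 0))"

definition pullback_form ::
    "('b, 'f::euclidean_space) chart set \<Rightarrow> ('a \<Rightarrow> 'b) \<Rightarrow> ('b \<Rightarrow> 'b tvec \<Rightarrow> real) \<Rightarrow> 'a \<Rightarrow> 'a tvec \<Rightarrow> real" where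
  "pullback_form B \<Phi> \<eta> p x = \<eta> (\<Phi> p) (differential B \<Phi> p x)"


section \<open>Lee form of a Hermitian manifold\<close>

definition fundamental_form ::
    "('a \<Rightarrow> 'a tvec \<Rightarrow> 'a tvec) \<Rightarrow> ('a \<Rightarrow> 'a tvec \<Rightarrow> 'a tvec \<Rightarrow> real) \<Rightarrow> 'a \<Rightarrow> 'a tvec \<Rightarrow> 'a tvec \<Rightarrow> real" where
  "fundamental_form J g p x y = g p (J p x) y"

definition cov_deriv_form2 ::
    "('a vfield \<Rightarrow> 'a vfield \<Rightarrow> 'a vfield) \<Rightarrow> ('a \<Rightarrow> 'a tvec \<Rightarrow> 'a tvec \<Rightarrow> real) \<Rightarrow>
      'a vfield \<Rightarrow> 'a vfield \<Rightarrow> 'a vfield \<Rightarrow> 'a \<Rightarrow> real" where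
  "cov_deriv_form2 D \<omega> Z X Y p =
     Z p (\<lambda>q. \<omega> q (X q) (Y q)) - \<omega> p (D Z X p) (Y p) - \<omega> p (X p) (D Z Y p)"

text \<open>The codifferential of a 2-form, evaluated at a tangent vector \<open>x\<close>. The value does not depend on
  the local orthonormal frame \<open>E\<close> nor on the local extension \<open>X\<close> of \<open>x\<close>.\<close>

definition codiff2 ::
    "('a, 'e::euclidean_space) chart set \<Rightarrow> ('a \<Rightarrow> 'a tvec \<Rightarrow> 'a tvec \<Rightarrow> real) \<Rightarrow>
      ('a \<Rightarrow> 'a tvec \<Rightarrow> 'a tvec \<Rightarrow> real) \<Rightarrow> 'a \<Rightarrow> 'a tvec \<Rightarrow> real" where
  "codiff2 (A :: ('a, 'e) chart set) g \<omega> p x = (THE c. \<forall>U E X.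
     p \<in> U \<and> orthonormal_frame_on A g U E \<and> vfield_on A U X \<and> X p = x \<longrightarrow>
     c = - (\<Sum>i<DIM('e). cov_deriv_form2 (levi_civita A g) \<omega> (E i) (E i) X p))"

definition lee_form ::
    "('a, 'e::euclidean_space) chart set \<Rightarrow> ('a \<Rightarrow> 'a tvec \<Rightarrow> 'a tvec) \<Rightarrow>
      ('a \<Rightarrow> 'a tvec \<Rightarrow> 'a tvec \<Rightarrow> real) \<Rightarrow> 'a \<Rightarrow> 'a tvec \<Rightarrow> real" where
  "lee_form A J g p x = - codiff2 A g (fundamental_form J g) p (J p x)"

definition balanced ::
    "('a, 'e::euclidean_space) chart set \<Rightarrow> ('a \<Rightarrow> 'a tvec \<Rightarrow> 'a tvec) \<Rightarrow>
      ('a \<Rightarrow> 'a tvec \<Rightarrow> 'a tvec \<Rightarrow> real) \<Rightarrow> bool" where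
  "balanced A J g \<longleftrightarrow> form_eq A (lee_form A J g) (\<lambda>p x. 0)"

definition locally_conformally_balanced ::
    "('a, 'e::euclidean_space) chart set \<Rightarrow> ('a \<Rightarrow> 'a tvec \<Rightarrow> 'a tvec) \<Rightarrow>
      ('a \<Rightarrow> 'a tvec \<Rightarrow> 'a tvec \<Rightarrow> real) \<Rightarrow> bool" where
  "locally_conformally_balanced A J g \<longleftrightarrow> closed_form A (lee_form A J g)"


section \<open>Affine-Riemann manifolds and Koszul forms\<close>

definition affine_riemann_manifold ::
    "('a, 'e::euclidean_space) chart set \<Rightarrow> ('a vfield \<Rightarrow> 'a vfield \<Rightarrow> 'a vfield) \<Rightarrow>
      ('a \<Rightarrow> 'a tvec \<Rightarrow> 'a tvec \<Rightarrow> real) \<Rightarrow> bool" where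
  "affine_riemann_manifold A nab g \<longleftrightarrow>
     manifold A \<and> connection A nab \<and> torsion_free A nab \<and> flat A nab \<and> riemannian_metric A g"

definition diff_tensor ::
    "('a, 'e::euclidean_space) chart set \<Rightarrow> ('a vfield \<Rightarrow> 'a vfield \<Rightarrow> 'a vfield) \<Rightarrow>
      ('a \<Rightarrow> 'a tvec \<Rightarrow> 'a tvec \<Rightarrow> real) \<Rightarrow> 'a vfield \<Rightarrow> 'a vfield \<Rightarrow> 'a vfield" where
  "diff_tensor A nab g X Y p = tdiff (levi_civita A g X Y p) (nab X Y p)"

definition adjoint_tensor ::
    "('a, 'e::euclidean_space) chart set \<Rightarrow> ('a \<Rightarrow> 'a tvec \<Rightarrow> 'a tvec \<Rightarrow> real) \<Rightarrow>
      ('a vfield \<Rightarrow> 'a vfield \<Rightarrow> 'a vfield) \<Rightarrow> 'a vfield \<Rightarrow> 'a vfield \<Rightarrow> 'a vfield" where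
  "adjoint_tensor A g \<gamma> X Y p = (THE w. w \<in> tangent_space A p \<and>
     (\<forall>U Z. p \<in> U \<and> vfield_on A U Z \<longrightarrow> g p w (Z p) = g p (Y p) (\<gamma> X Z p)))"

text \<open>The value does not depend on the local orthonormal frame \<open>E\<close> if \<open>B\<close> is tensorial.\<close>

definition metric_trace ::
    "('a, 'e::euclidean_space) chart set \<Rightarrow> ('a \<Rightarrow> 'a tvec \<Rightarrow> 'a tvec \<Rightarrow> real) \<Rightarrow>
      ('a vfield \<Rightarrow> 'a vfield \<Rightarrow> 'a vfield) \<Rightarrow> 'a vfield" where
  "metric_trace (A :: ('a, 'e) chart set) g B p = (THE v. \<forall>U E.
     p \<in> U \<and> orthonormal_frame_on A g U E \<longrightarrow> v = tsum (\<lambda>i. B (E i) (E i) p) {..<DIM('e)})"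

definition koszul_alpha ::
    "('a, 'e::euclidean_space) chart set \<Rightarrow> ('a vfield \<Rightarrow> 'a vfield \<Rightarrow> 'a vfield) \<Rightarrow>
      ('a \<Rightarrow> 'a tvec \<Rightarrow> 'a tvec \<Rightarrow> real) \<Rightarrow> 'a \<Rightarrow> 'a tvec \<Rightarrow> real" where
  "koszul_alpha A nab g p x =
     g p (metric_trace A g (adjoint_tensor A g (diff_tensor A nab g)) p) x"

definition koszul_xi ::
    "('a, 'e::euclidean_space) chart set \<Rightarrow> ('a vfield \<Rightarrow> 'a vfield \<Rightarrow> 'a vfield) \<Rightarrow>
      ('a \<Rightarrow> 'a tvec \<Rightarrow> 'a tvec \<Rightarrow> real) \<Rightarrow> 'a \<Rightarrow> 'a tvec \<Rightarrow> real" where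
  "koszul_xi A nab g p x = g p (metric_trace A g (diff_tensor A nab g) p) x"


section \<open>Tangent bundle and its canonical Hermitian structure\<close>

text \<open>A point of the tangent bundle is a pair \<open>(p, v)\<close> with \<open>v\<close> tangent at \<open>p\<close>; the projection is
  \<open>fst\<close>. In the chart induced by \<open>\<phi>\<close> its coordinates are \<open>\<phi> p\<close> and the components of \<open>v\<close>, which
  are the values of \<open>v\<close> on the coordinate functions of \<open>\<phi>\<close>.\<close>

type_synonym 'a tpoint = "'a \<times> 'a tvec"

definition tangent_chart ::
    "('a, 'e::euclidean_space) chart set \<Rightarrow> ('a, 'e) chart \<Rightarrow> ('a tpoint, 'e \<times> 'e) chart" where
  "tangent_chart A = (\<lambda>(U, \<phi>).
     ({(p, v). p \<in> U \<and> v \<in> tangent_space A p},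
      \<lambda>(p, v). (\<phi> p, \<Sum>b\<in>Basis. v (\<lambda>q. \<phi> q \<bullet> b) *\<^sub>R b)))"

definition tangent_bundle ::
    "('a, 'e::euclidean_space) chart set \<Rightarrow> ('a tpoint, 'e \<times> 'e) chart set" where
  "tangent_bundle A = tangent_chart A ` A"

definition vertical_lift ::
    "('a, 'e::euclidean_space) chart set \<Rightarrow> 'a tpoint \<Rightarrow> 'a tvec \<Rightarrow> 'a tpoint tvec" where
  "vertical_lift A u x = (\<lambda>F.
     if smooth_near (tangent_bundle A) u F
     then deriv (\<lambda>t::real. F (fst u, tadd (snd u) (tscale t x))) 0 else 0)"

text \<open>The horizontal space at \<open>u\<close> consists of the velocities \<open>dY(x)\<close> of the local sections \<open>Y\<close> of the
  tangent bundle through \<open>u\<close> whose covariant derivative in the direction \<open>x\<close> vanishes at the base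
  point.\<close>

definition horizontal_space ::
    "('a, 'e::euclidean_space) chart set \<Rightarrow> ('a vfield \<Rightarrow> 'a vfield \<Rightarrow> 'a vfield) \<Rightarrow>
      'a tpoint \<Rightarrow> 'a tpoint tvec set" where
  "horizontal_space A nab u = {w. \<exists>U X Y.
     fst u \<in> U \<and> vfield_on A U X \<and> vfield_on A U Y \<and>
     Y (fst u) = snd u \<and> nab X Y (fst u) = tzero \<and>
     w = differential (tangent_bundle A) (\<lambda>q. (q, Y q)) (fst u) (X (fst u))}"

definition horizontal_lift ::
    "('a, 'e::euclidean_space) chart set \<Rightarrow> ('a vfield \<Rightarrow> 'a vfield \<Rightarrow> 'a vfield) \<Rightarrow>
      'a tpoint \<Rightarrow> 'a tvec \<Rightarrow> 'a tpoint tvec" where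
  "horizontal_lift A nab u x =
     (THE w. w \<in> horizontal_space A nab u \<and> differential A fst u w = x)"

definition canonical_J ::
    "('a, 'e::euclidean_space) chart set \<Rightarrow> ('a vfield \<Rightarrow> 'a vfield \<Rightarrow> 'a vfield) \<Rightarrow>
      'a tpoint \<Rightarrow> 'a tpoint tvec \<Rightarrow> 'a tpoint tvec" where
  "canonical_J A nab u w = (THE w'.
     \<exists>x\<in>tangent_space A (fst u). \<exists>y\<in>tangent_space A (fst u).
       w = tadd (horizontal_lift A nab u x) (vertical_lift A u y) \<and>
       w' = tdiff (vertical_lift A u x) (horizontal_lift A nab u y))"

definition canonical_g ::
    "('a, 'e::euclidean_space) chart set \<Rightarrow> ('a vfield \<Rightarrow> 'a vfield \<Rightarrow> 'a vfield) \<Rightarrow>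
      ('a \<Rightarrow> 'a tvec \<Rightarrow> 'a tvec \<Rightarrow> real) \<Rightarrow>
      'a tpoint \<Rightarrow> 'a tpoint tvec \<Rightarrow> 'a tpoint tvec \<Rightarrow> real" where
  "canonical_g A nab g u w w' = (THE r.
     \<exists>x\<in>tangent_space A (fst u). \<exists>y\<in>tangent_space A (fst u).
     \<exists>x'\<in>tangent_space A (fst u). \<exists>y'\<in>tangent_space A (fst u).
       w = tadd (horizontal_lift A nab u x) (vertical_lift A u y) \<and>
       w' = tadd (horizontal_lift A nab u x') (vertical_lift A u y') \<and>
       r = g (fst u) x x' + g (fst u) y y')"

end

theory Submission
  imports Defs
begin

text \<open>
  On the tangent bundle the horizontal and vertical lifts of vector fields satisfy
  \<open>[X\<^sup>h, Y\<^sup>v] = (nab X Y)\<^sup>v\<close> and \<open>[X\<^sup>v, Y\<^sup>v] = 0\<close>, while \<open>[X\<^sup>h, Y\<^sup>h]\<close> projects to \<open>[X, Y]\<close>. If \<open>(E\<^sub>i)\<close> is a local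
  orthonormal frame, then so is \<open>(E\<^sub>i\<^sup>h, E\<^sub>i\<^sup>v)\<close>. Writing \<open>D\<close> for both Levi-Civita connections and \<open>x\<close> for the
  projection of \<open>w\<close> to the base, these brackets and the Koszul formula give
  \<open>\<theta>\<^sub>1(w) = \<Sum>\<^sub>i \<langle>nab E\<^sub>i E\<^sub>i - D E\<^sub>i E\<^sub>i, x\<rangle> - \<langle>nab x E\<^sub>i, E\<^sub>i\<rangle> = (\<alpha> - \<xi>)(x)\<close>.
  The form \<open>\<alpha>\<close> is minus the trace of the connection matrix of \<open>nab\<close> in the frame, so it is closed by
  flatness, and \<open>\<pi>\<^sub>1\<^sup>*(\<alpha> - \<xi>)\<close> is closed if and only if \<open>\<xi>\<close> is.
\<close>

section \<open>Calculus of smooth functions\<close>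

lemma sum_lessThan_add:
  fixes f :: "nat \<Rightarrow> 'a::comm_monoid_add"
  shows "(\<Sum>i<m + n. f i) = (\<Sum>i<m. f i) + (\<Sum>i<n. f (m + i))"
  by (induction n) (simp_all add: add.assoc)

lemma linear_eq_sum_Basis:
  fixes f :: "'e::euclidean_space \<Rightarrow> 'f::real_vector"
  assumes "linear f"
  shows "f x = (\<Sum>b\<in>Basis. (x \<bullet> b) *\<^sub>R f b)"
proof -
  have "f x = f (\<Sum>b\<in>Basis. (x \<bullet> b) *\<^sub>R b)" by (simp add: euclidean_representation)
  also have "\<dots> = (\<Sum>b\<in>Basis. (x \<bullet> b) *\<^sub>R f b)"
    by (simp add: linear_sum[OF assms] linear_cmul[OF assms])
  finally show ?thesis .
qed

lemma Ck_on_has_derivative: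
  assumes "open S" "Ck_on (Suc k) S f" "x \<in> S"
  shows "(f has_derivative frechet_derivative f (at x)) (at x)"
proof -
  have "f differentiable (at x within S)" using assms(2,3) by (simp add: differentiable_on_def)
  then have "f differentiable (at x)" by (simp only: at_within_open[OF assms(3,1)])
  then show ?thesis by (simp only: frechet_derivative_works)
qed

lemma Ck_on_cong:
  assumes "open S" "Ck_on k S f" "\<And>x. x \<in> S \<Longrightarrow> f x = h x"
  shows "Ck_on k S h"
  using assms(2,3)
proof (induction k arbitrary: f h)
  case 0
  then show ?case using continuous_on_cong by fastforce
next
  case (Suc k)
  have derivative: "(h has_derivative frechet_derivative f (at x)) (at x)" if "x \<in> S" for x
    by (rule has_derivative_transform_within_open[OF Ck_on_has_derivative[OF \<open>open S\<close> Suc.prems(1) that]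
          \<open>open S\<close> that Suc.prems(2)])
  then have "h differentiable_on S"
    by (meson differentiable_at_imp_differentiable_on differentiable_def)
  moreover have "Ck_on k S (\<lambda>x. frechet_derivative h (at x) v)" for v
    by (rule Suc.IH[of "\<lambda>x. frechet_derivative f (at x) v"])
      (use Suc.prems(1) frechet_derivative_at[OF derivative] in auto)
  ultimately show ?case by simp
qed

lemma Ck_on_SucI:
  assumes "open S" "\<And>x. x \<in> S \<Longrightarrow> (f has_derivative f' x) (at x)" "\<And>v. Ck_on k S (\<lambda>x. f' x v)"
  shows "Ck_on (Suc k) S f"
proof -
  have "f differentiable_on S"
    using assms(2) by (meson differentiable_at_imp_differentiable_on differentiable_def)
  moreover have "Ck_on k S (\<lambda>x. frechet_derivative f (at x) v)" for v
    by (rule Ck_on_cong[OF assms(1) assms(3)[of v]]) (use frechet_derivative_at[OF assms(2)] in metis)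
  ultimately show ?thesis by simp
qed

lemma Ck_on_SucD: "Ck_on (Suc k) S f \<Longrightarrow> Ck_on k S f"
proof (induction k arbitrary: f)
  case 0
  then show ?case by (simp add: differentiable_imp_continuous_on)
next
  case (Suc k)
  then show ?case by (metis Ck_on.simps(2))
qed

lemma Ck_on_imp_continuous_on: "Ck_on k S f \<Longrightarrow> continuous_on S f"
proof (induction k)
  case (Suc k)
  then show ?case using Ck_on_SucD by blast
qed simp

lemma Ck_on_subset: "Ck_on k S f \<Longrightarrow> T \<subseteq> S \<Longrightarrow> Ck_on k T f"
  by (induction k arbitrary: f) (auto intro: continuous_on_subset differentiable_on_subset)

lemma Ck_on_local:
  assumes "open S" "\<And>x. x \<in> S \<Longrightarrow> \<exists>T. open T \<and> x \<in> T \<and> Ck_on k T f"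
  shows "Ck_on k S f"
  using assms(2)
proof (induction k arbitrary: f)
  case 0
  then show ?case
    using assms(1) by (auto simp: continuous_on_eq_continuous_at) (meson continuous_on_eq_continuous_at)
next
  case (Suc k)
  have "f differentiable_on S"
    using Suc.prems unfolding differentiable_on_def Ck_on.simps
    by (metis at_within_open differentiable_at_withinI)
  moreover have "Ck_on k S (\<lambda>x. frechet_derivative f (at x) v)" for v
    by (rule Suc.IH) (use Suc.prems in force)
  ultimately show ?case by simp
qed

lemma Ck_on_const: "open S \<Longrightarrow> Ck_on k S (\<lambda>x. c)"
proof (induction k arbitrary: c)
  case (Suc k)
  show ?case by (rule Ck_on_SucI[where f' = "\<lambda>x v. 0"]) (use Suc in auto)
qed auto

lemma Ck_on_linear: "open S \<Longrightarrow> bounded_linear f \<Longrightarrow> Ck_on k S f"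
proof (cases k)
  case (Suc k)
  assume "open S" "bounded_linear f"
  then show ?thesis unfolding Suc
    by (intro Ck_on_SucI[where f' = "\<lambda>x v. f v"])
      (auto intro: bounded_linear_imp_has_derivative Ck_on_const)
qed (simp add: linear_continuous_on)

lemma Ck_on_add:
  assumes "open S" "Ck_on k S f" "Ck_on k S h"
  shows "Ck_on k S (\<lambda>x. f x + h x)"
  using assms(2,3)
proof (induction k arbitrary: f h)
  case 0
  then show ?case by (auto intro: continuous_on_add)
next
  case (Suc k)
  show ?case
  proof (rule Ck_on_SucI[OF assms(1)])
    fix x assume "x \<in> S"
    then show "((\<lambda>x. f x + h x) has_derivative
        (\<lambda>v. frechet_derivative f (at x) v + frechet_derivative h (at x) v)) (at x)"
      by (intro has_derivative_add Ck_on_has_derivative[OF assms(1), of k] Suc.prems)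
  qed (use Suc in auto)
qed

lemma Ck_on_bilinear:
  assumes "bounded_bilinear mul" "open S" "Ck_on k S f" "Ck_on k S h"
  shows "Ck_on k S (\<lambda>x. mul (f x) (h x))"
  using assms(3,4)
proof (induction k arbitrary: f h)
  case 0
  then show ?case by (auto intro: bounded_bilinear.continuous_on[OF assms(1)])
next
  case (Suc k)
  show ?case
  proof (rule Ck_on_SucI[OF assms(2)])
    fix x assume "x \<in> S"
    then show "((\<lambda>x. mul (f x) (h x)) has_derivative
        (\<lambda>v. mul (f x) (frechet_derivative h (at x) v) + mul (frechet_derivative f (at x) v) (h x)))
        (at x)"
      by (intro bounded_bilinear.FDERIV[OF assms(1)] Ck_on_has_derivative[OF assms(2), of k] Suc.prems)
  next
    fix v
    show "Ck_on k S (\<lambda>x. mul (f x) (frechet_derivative h (at x) v) +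
        mul (frechet_derivative f (at x) v) (h x))"
      using Suc.prems Suc.prems[THEN Ck_on_SucD] by (auto intro!: Ck_on_add assms(2) Suc.IH)
  qed
qed

lemma Ck_on_sum:
  assumes "open S" "\<And>i. i \<in> I \<Longrightarrow> Ck_on k S (f i)"
  shows "Ck_on k S (\<lambda>x. \<Sum>i\<in>I. f i x)"
  using assms(2)
  by (induction I rule: infinite_finite_induct) (auto intro: Ck_on_const Ck_on_add assms(1))

lemma Ck_on_compose:
  fixes f :: "'d::euclidean_space \<Rightarrow> 'e::euclidean_space" and h :: "'e \<Rightarrow> 'f::real_normed_vector"
  assumes "open S" "open T" "f ` S \<subseteq> T" "Ck_on k S f" "Ck_on k T h"
  shows "Ck_on k S (\<lambda>x. h (f x))"
  using assms(4,5)
proof (induction k arbitrary: h)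
  case 0
  then show ?case using assms(3) continuous_on_compose2 by (metis Ck_on.simps(1))
next
  case (Suc k)
  let ?D = "\<lambda>x v. \<Sum>b\<in>Basis. (frechet_derivative f (at x) v \<bullet> b) *\<^sub>R frechet_derivative h (at (f x)) b"
  show ?case
  proof (rule Ck_on_SucI[OF assms(1), where f' = ?D])
    fix x assume x: "x \<in> S"
    then have "f x \<in> T" using assms(3) by auto
    note dh = Ck_on_has_derivative[OF assms(2) Suc.prems(2) this]
    have "((\<lambda>x. h (f x)) has_derivative
        (\<lambda>v. frechet_derivative h (at (f x)) (frechet_derivative f (at x) v))) (at x)"
      using diff_chain_at[OF Ck_on_has_derivative[OF assms(1) Suc.prems(1) x] dh]
      by (simp add: o_def)
    moreover have "(\<lambda>v. frechet_derivative h (at (f x)) (frechet_derivative f (at x) v)) = ?D x"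
      by (rule ext, rule linear_eq_sum_Basis) (use dh has_derivative_linear in blast)
    ultimately show "((\<lambda>x. h (f x)) has_derivative ?D x) (at x)" by simp
  next
    fix v
    have "Ck_on k S (\<lambda>x. frechet_derivative f (at x) v \<bullet> b)" for b
      by (rule Ck_on_bilinear[OF bounded_bilinear_inner assms(1)])
        (use Suc.prems in \<open>auto intro: Ck_on_const assms(1)\<close>)
    moreover have "Ck_on k S (\<lambda>x. frechet_derivative h (at (f x)) b)" for b
      by (rule Suc.IH[OF Ck_on_SucD[OF Suc.prems(1)]]) (use Suc.prems(2) in simp)
    ultimately show "Ck_on k S (\<lambda>x. ?D x v)"
      by (intro Ck_on_sum Ck_on_bilinear[OF bounded_bilinear_scaleR] assms(1)) auto
  qed
qed

lemma Ck_on_inverse: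
  fixes f :: "'e::euclidean_space \<Rightarrow> real"
  assumes "open S" "Ck_on k S f" "\<And>x. x \<in> S \<Longrightarrow> f x \<noteq> 0"
  shows "Ck_on k S (\<lambda>x. inverse (f x))"
  using assms(2)
proof (induction k)
  case 0
  then show ?case using assms(3) by (auto intro: continuous_on_inverse)
next
  case (Suc k)
  have IH: "Ck_on k S (\<lambda>x. inverse (f x))" using Suc Ck_on_SucD by blast
  show ?case
  proof (rule Ck_on_SucI[OF assms(1)])
    fix x assume "x \<in> S"
    then show "((\<lambda>x. inverse (f x)) has_derivative
      (\<lambda>v. - 1 * (inverse (f x) * frechet_derivative f (at x) v * inverse (f x)))) (at x)"
      using Deriv.has_derivative_inverse[OF assms(3) Ck_on_has_derivative[OF assms(1) Suc.prems]]
      by auto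
  next
    fix v
    show "Ck_on k S (\<lambda>x. - 1 * (inverse (f x) * frechet_derivative f (at x) v * inverse (f x)))"
      using Suc.prems by (intro Ck_on_bilinear[OF bounded_bilinear_mult] IH assms(1) Ck_on_const) auto
  qed
qed

lemma Ck_on_sqrt:
  assumes "open S" "Ck_on k S f" "\<And>x. x \<in> S \<Longrightarrow> f x > 0"
  shows "Ck_on k S (\<lambda>x. sqrt (f x))"
  using assms(2)
proof (induction k)
  case 0
  then show ?case by (auto intro: continuous_on_real_sqrt)
next
  case (Suc k)
  have "Ck_on k S (\<lambda>x. sqrt (f x))" using Suc Ck_on_SucD by blast
  then have inverse_sqrt: "Ck_on k S (\<lambda>x. inverse (sqrt (f x)))"
    by (rule Ck_on_inverse[OF assms(1)]) (use assms(3) in force)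
  show ?case
  proof (rule Ck_on_SucI[OF assms(1)])
    fix x assume x: "x \<in> S"
    show "((\<lambda>x. sqrt (f x)) has_derivative
      (\<lambda>v. (1/2) * (inverse (sqrt (f x)) * frechet_derivative f (at x) v))) (at x)"
      using has_derivative_real_sqrt[OF assms(3) Ck_on_has_derivative[OF assms(1) Suc.prems], OF x x]
      by (simp add: field_simps)
  next
    fix v
    show "Ck_on k S (\<lambda>x. (1/2) * (inverse (sqrt (f x)) * frechet_derivative f (at x) v))"
      using Suc.prems
      by (intro Ck_on_bilinear[OF bounded_bilinear_mult] inverse_sqrt assms(1) Ck_on_const) auto
  qed
qed

lemma smooth_on_cong:
  "open S \<Longrightarrow> smooth_on S f \<Longrightarrow> (\<And>x. x \<in> S \<Longrightarrow> f x = h x) \<Longrightarrow> smooth_on S h"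
  unfolding smooth_on_def by (meson Ck_on_cong)

lemma smooth_on_subset: "smooth_on S f \<Longrightarrow> T \<subseteq> S \<Longrightarrow> smooth_on T f"
  unfolding smooth_on_def by (meson Ck_on_subset)

lemma smooth_on_local:
  assumes "open S" "\<And>x. x \<in> S \<Longrightarrow> \<exists>T. open T \<and> x \<in> T \<and> smooth_on T f"
  shows "smooth_on S f"
  unfolding smooth_on_def by (intro allI Ck_on_local[OF assms(1)]) (meson assms(2) smooth_on_def)

lemma smooth_on_const: "open S \<Longrightarrow> smooth_on S (\<lambda>x. c)"
  by (simp add: smooth_on_def Ck_on_const)

lemma smooth_on_linear: "open S \<Longrightarrow> bounded_linear f \<Longrightarrow> smooth_on S f"
  by (simp add: smooth_on_def Ck_on_linear)

lemma smooth_on_add: "open S \<Longrightarrow> smooth_on S f \<Longrightarrow> smooth_on S h \<Longrightarrow> smooth_on S (\<lambda>x. f x + h x)"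
  by (simp add: smooth_on_def Ck_on_add)

lemma smooth_on_bilinear:
  "bounded_bilinear mul \<Longrightarrow> open S \<Longrightarrow> smooth_on S f \<Longrightarrow> smooth_on S h \<Longrightarrow>
    smooth_on S (\<lambda>x. mul (f x) (h x))"
  by (simp add: smooth_on_def Ck_on_bilinear)

lemma smooth_on_sum:
  "open S \<Longrightarrow> (\<And>i. i \<in> I \<Longrightarrow> smooth_on S (f i)) \<Longrightarrow> smooth_on S (\<lambda>x. \<Sum>i\<in>I. f i x)"
  by (simp add: smooth_on_def Ck_on_sum)

lemma smooth_on_compose:
  fixes f :: "'d::euclidean_space \<Rightarrow> 'e::euclidean_space"
  shows "open S \<Longrightarrow> open T \<Longrightarrow> f ` S \<subseteq> T \<Longrightarrow> smooth_on S f \<Longrightarrow> smooth_on T h \<Longrightarrow>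
    smooth_on S (\<lambda>x. h (f x))"
  by (simp add: smooth_on_def Ck_on_compose)

lemma smooth_on_inverse:
  fixes f :: "'e::euclidean_space \<Rightarrow> real"
  shows "open S \<Longrightarrow> smooth_on S f \<Longrightarrow> (\<And>x. x \<in> S \<Longrightarrow> f x \<noteq> 0) \<Longrightarrow> smooth_on S (\<lambda>x. inverse (f x))"
  by (simp add: smooth_on_def Ck_on_inverse)

lemma smooth_on_sqrt:
  "open S \<Longrightarrow> smooth_on S f \<Longrightarrow> (\<And>x. x \<in> S \<Longrightarrow> f x > 0) \<Longrightarrow> smooth_on S (\<lambda>x. sqrt (f x))"
  by (simp add: smooth_on_def Ck_on_sqrt)

lemma smooth_on_frechet_derivative:
  "smooth_on S f \<Longrightarrow> smooth_on S (\<lambda>x. frechet_derivative f (at x) v)"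
  unfolding smooth_on_def by (metis Ck_on.simps(2))

lemma smooth_on_has_derivative:
  "open S \<Longrightarrow> smooth_on S f \<Longrightarrow> x \<in> S \<Longrightarrow> (f has_derivative frechet_derivative f (at x)) (at x)"
  by (auto simp: smooth_on_def intro: Ck_on_has_derivative)

lemma smooth_on_imp_continuous_on: "smooth_on S f \<Longrightarrow> continuous_on S f"
  by (auto simp: smooth_on_def intro: Ck_on_imp_continuous_on)

lemma smooth_on_componentwise:
  fixes f :: "'d::euclidean_space \<Rightarrow> 'e::euclidean_space"
  assumes "open S" "\<And>b. b \<in> Basis \<Longrightarrow> smooth_on S (\<lambda>x. f x \<bullet> b)"
  shows "smooth_on S f"
proof -
  have "smooth_on S (\<lambda>x. \<Sum>b\<in>Basis. (f x \<bullet> b) *\<^sub>R b)"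
    by (intro smooth_on_sum smooth_on_bilinear[OF bounded_bilinear_scaleR] smooth_on_const assms)
  then show ?thesis by (simp add: euclidean_representation)
qed

lemma smooth_on_Pair:
  fixes f :: "'d::euclidean_space \<Rightarrow> 'e::euclidean_space" and h :: "'d \<Rightarrow> 'f::euclidean_space"
  assumes "open S" "smooth_on S f" "smooth_on S h"
  shows "smooth_on S (\<lambda>x. (f x, h x))"
proof (rule smooth_on_componentwise[OF assms(1)])
  fix b :: "'e \<times> 'f"
  have "smooth_on S (\<lambda>x. f x \<bullet> fst b + h x \<bullet> snd b)"
    by (intro smooth_on_add smooth_on_bilinear[OF bounded_bilinear_inner] assms smooth_on_const)
  then show "smooth_on S (\<lambda>x. (f x, h x) \<bullet> b)" by (simp add: inner_prod_def)
qed

lemma deriv_along_line: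
  fixes f :: "'a::real_normed_vector \<Rightarrow> real"
  assumes "(f has_derivative f') (at a)"
  shows "deriv (\<lambda>t. f (a + t *\<^sub>R v)) 0 = f' v"
proof (rule DERIV_imp_deriv)
  have "((\<lambda>t. a + t *\<^sub>R v) has_derivative (\<lambda>t. t *\<^sub>R v)) (at 0)"
    by (auto intro!: derivative_eq_intros)
  from has_derivative_compose[OF this, of f f'] assms
  have "((\<lambda>t. f (a + t *\<^sub>R v)) has_derivative (\<lambda>t. f' (t *\<^sub>R v))) (at 0)" by simp
  then show "((\<lambda>t. f (a + t *\<^sub>R v)) has_real_derivative f' v) (at 0)"
    by (simp add: has_field_derivative_def linear_cmul[OF has_derivative_linear[OF assms]]
        mult_commute_abs)
qed

section \<open>Hadamard's lemma\<close>

lemma segment_in_ball: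
  fixes a x :: "'a::real_normed_vector"
  assumes "x \<in> ball a r" "t \<in> {0..1}"
  shows "a + t *\<^sub>R (x - a) \<in> ball a r"
proof -
  have "a \<in> ball a r" using assms(1) by (metis centre_in_ball mem_ball order_le_less_trans zero_le_dist)
  then have "(1 - t) *\<^sub>R a + t *\<^sub>R x \<in> ball a r"
    using convexD_alt[OF convex_ball _ assms(1), of a t] assms(2) by simp
  then show ?thesis by (simp add: algebra_simps)
qed

lemma continuous_on_segment_integrand:
  fixes F :: "'e::real_normed_vector \<Rightarrow> real"
  assumes "continuous_on (ball a r) F"
  shows "continuous_on (ball a r \<times> {0..1}) (\<lambda>(x, t). t ^ j * F (a + t *\<^sub>R (x - a)))"
  unfolding split_beta
  by (intro continuous_intros continuous_on_compose2[OF assms])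
    (auto simp del: mem_ball atLeastAtMost_iff intro!: segment_in_ball)

lemma continuous_on_section:
  assumes "continuous_on (S \<times> T) (\<lambda>(x, t). F x t)" "x \<in> S"
  shows "continuous_on T (F x)"
proof -
  have "continuous_on T (Pair x)" by (intro continuous_intros)
  then show ?thesis using continuous_on_compose2[OF assms(1), of T "Pair x"] assms(2) by auto
qed

text \<open>In finite dimension, continuity of the derivative in each direction is enough for the Leibniz rule.\<close>

lemma has_derivative_integral_directions:
  fixes f :: "'e::euclidean_space \<Rightarrow> real \<Rightarrow> real"
  assumes S: "open S" "convex S" and x: "x \<in> S"
    and f: "\<And>x t. x \<in> S \<Longrightarrow> t \<in> {a..b} \<Longrightarrow> ((\<lambda>x. f x t) has_derivative f' x t) (at x)"
    and f': "\<And>v. continuous_on (S \<times> {a..b}) (\<lambda>(x, t). f' x t v)"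
    and integrable: "\<And>x. x \<in> S \<Longrightarrow> f x integrable_on {a..b}"
  shows "((\<lambda>x. integral {a..b} (f x)) has_derivative (\<lambda>v. integral {a..b} (\<lambda>t. f' x t v))) (at x)"
proof -
  define D where "D x t = Blinfun (f' x t)" for x t
  have D_apply: "blinfun_apply (D x t) = f' x t" if "x \<in> S" "t \<in> {a..b}" for x t
    unfolding D_def by (rule bounded_linear_Blinfun_apply[OF has_derivative_bounded_linear[OF f[OF that]]])
  have D_continuous: "continuous_on (S \<times> {a..b}) (\<lambda>(x, t). D x t)"
    unfolding split_beta
  proof (rule continuous_on_blinfun_componentwise)
    fix v
    show "continuous_on (S \<times> {a..b}) (\<lambda>z. blinfun_apply (D (fst z) (snd z)) v)"
      using f'[of v] by (rule continuous_on_eq) (use D_apply in auto)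
  qed
  have "((\<lambda>x. integral (cbox a b) (f x)) has_derivative integral (cbox a b) (D x)) (at x within S)"
  proof (rule leibniz_rule[OF _ _ _ x S(2)])
    fix x t assume "x \<in> S" "t \<in> cbox a b"
    then show "((\<lambda>x. f x t) has_derivative blinfun_apply (D x t)) (at x within S)"
      using f D_apply by (simp add: has_derivative_at_withinI)
  qed (use integrable D_continuous in simp_all)
  moreover have "blinfun_apply (integral {a..b} (D x)) = (\<lambda>v. integral {a..b} (\<lambda>t. f' x t v))"
  proof
    fix v
    have "D x integrable_on {a..b}"
      by (rule integrable_continuous_interval[OF continuous_on_section[OF D_continuous x]])
    from blinfun_apply_integral[OF this]
    have "blinfun_apply (integral {a..b} (D x)) v = integral {a..b} (\<lambda>t. blinfun_apply (D x t) v)" .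
    also have "\<dots> = integral {a..b} (\<lambda>t. f' x t v)" by (rule integral_cong) (simp only: D_apply[OF x])
    finally show "blinfun_apply (integral {a..b} (D x)) v = \<dots>" .
  qed
  ultimately show ?thesis by (simp add: at_within_open[OF x S(1)])
qed

lemma has_derivative_segment_integral:
  fixes F :: "'e::euclidean_space \<Rightarrow> real"
  assumes F: "\<And>y. y \<in> ball a r \<Longrightarrow> (F has_derivative F' y) (at y)"
    and F': "\<And>v. continuous_on (ball a r) (\<lambda>y. F' y v)" and x: "x \<in> ball a r"
  shows "((\<lambda>x. integral {0..1} (\<lambda>t. t ^ j * F (a + t *\<^sub>R (x - a)))) has_derivative
    (\<lambda>v. integral {0..1} (\<lambda>t. t ^ Suc j * F' (a + t *\<^sub>R (x - a)) v))) (at x)"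
proof (rule has_derivative_integral_directions[OF open_ball convex_ball x])
  show "((\<lambda>x. t ^ j * F (a + t *\<^sub>R (x - a))) has_derivative (\<lambda>v. t ^ Suc j * F' (a + t *\<^sub>R (x - a)) v)) (at x)"
    if "x \<in> ball a r" "t \<in> {0..1}" for x t
  proof -
    note dF = F[OF segment_in_ball[OF that]]
    have "((\<lambda>x. a + t *\<^sub>R (x - a)) has_derivative (\<lambda>v. t *\<^sub>R v)) (at x)"
      by (auto intro!: derivative_eq_intros)
    from has_derivative_mult_right[OF has_derivative_compose[OF this dF], of "t ^ j"]
    show ?thesis by (simp add: linear_cmul[OF has_derivative_linear[OF dF]] mult_ac)
  qed
  show "continuous_on (ball a r \<times> {0..1}) (\<lambda>(x, t). t ^ Suc j * F' (a + t *\<^sub>R (x - a)) v)" for v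
    by (rule continuous_on_segment_integrand[OF F'])
  have "continuous_on (ball a r) F"
    using F has_derivative_continuous continuous_at_imp_continuous_on by blast
  then show "(\<lambda>t. t ^ j * F (a + t *\<^sub>R (x - a))) integrable_on {0..1}" if "x \<in> ball a r" for x
    by (rule integrable_continuous_interval[OF continuous_on_section[OF continuous_on_segment_integrand that]])
qed

lemma Ck_on_segment_integral:
  fixes F :: "'e::euclidean_space \<Rightarrow> real"
  assumes "Ck_on k (ball a r) F"
  shows "Ck_on k (ball a r) (\<lambda>x. integral {0..1} (\<lambda>t. t ^ j * F (a + t *\<^sub>R (x - a))))"
  using assms
proof (induction k arbitrary: F j)
  case 0
  then show ?case
    using integral_continuous_on_param[of "ball a r" 0 1 "\<lambda>x t. t ^ j * F (a + t *\<^sub>R (x - a))"]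
      continuous_on_segment_integrand[of a r F j] by auto
next
  case (Suc k)
  have F': "Ck_on k (ball a r) (\<lambda>y. frechet_derivative F (at y) v)" for v using Suc.prems by simp
  show ?case
  proof (rule Ck_on_SucI[OF open_ball has_derivative_segment_integral])
    show "(F has_derivative frechet_derivative F (at y)) (at y)" if "y \<in> ball a r" for y
      by (rule Ck_on_has_derivative[OF open_ball Suc.prems that])
    show "continuous_on (ball a r) (\<lambda>y. frechet_derivative F (at y) v)" for v
      by (rule Ck_on_imp_continuous_on[OF F'])
  qed (assumption | rule Suc.IH[OF F'])+
qed

lemma has_vector_derivative_along_segment:
  fixes f :: "'e::euclidean_space \<Rightarrow> real"
  assumes "(f has_derivative f') (at (a + t *\<^sub>R v))"
  shows "((\<lambda>t. f (a + t *\<^sub>R v)) has_vector_derivative (\<Sum>b\<in>Basis. (v \<bullet> b) * f' b)) (at t within T)"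
proof -
  have "((\<lambda>t. a + t *\<^sub>R v) has_derivative (\<lambda>s. s *\<^sub>R v)) (at t)"
    by (auto intro!: derivative_eq_intros)
  from has_derivative_compose[OF this assms]
  have "((\<lambda>t. f (a + t *\<^sub>R v)) has_derivative (\<lambda>s. f' (s *\<^sub>R v))) (at t)" .
  moreover have "f' (s *\<^sub>R v) = s *\<^sub>R (\<Sum>b\<in>Basis. (v \<bullet> b) * f' b)" for s
    using linear_eq_sum_Basis[OF has_derivative_linear[OF assms], of v]
    by (simp add: linear_cmul[OF has_derivative_linear[OF assms]])
  ultimately show ?thesis
    unfolding has_vector_derivative_def by (simp add: has_derivative_at_withinI)
qed

lemma smooth_on_Hadamard:
  fixes f :: "'e::euclidean_space \<Rightarrow> real"
  assumes f: "smooth_on (ball a r) f"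
  obtains h where "\<And>b. smooth_on (ball a r) (h b)"
    and "\<And>x. x \<in> ball a r \<Longrightarrow> f x = f a + (\<Sum>b\<in>Basis. ((x - a) \<bullet> b) * h b x)"
proof
  define h where "h b x = integral {0..1} (\<lambda>t. t ^ 0 * frechet_derivative f (at (a + t *\<^sub>R (x - a))) b)" for b x
  show "smooth_on (ball a r) (h b)" for b
    using smooth_on_frechet_derivative[OF f, of b] unfolding h_def[abs_def] smooth_on_def
    by (intro allI Ck_on_segment_integral) blast
  fix x assume x: "x \<in> ball a r"
  let ?f' = "\<lambda>t b. frechet_derivative f (at (a + t *\<^sub>R (x - a))) b"
  have "((\<lambda>t. \<Sum>b\<in>Basis. ((x - a) \<bullet> b) * ?f' t b) has_integral f (a + 1 *\<^sub>R (x - a)) - f (a + 0 *\<^sub>R (x - a))) {0..1}"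
    by (intro fundamental_theorem_of_calculus has_vector_derivative_along_segment
        smooth_on_has_derivative[OF open_ball f] segment_in_ball[OF x]) auto
  then have increment: "((\<lambda>t. \<Sum>b\<in>Basis. ((x - a) \<bullet> b) * ?f' t b) has_integral f x - f a) {0..1}" by simp
  have "continuous_on {0..1} (\<lambda>t. ?f' t b)" for b
    by (rule continuous_on_compose2[OF smooth_on_imp_continuous_on[OF smooth_on_frechet_derivative[OF f, of b]]])
      (auto simp del: mem_ball atLeastAtMost_iff intro!: continuous_intros segment_in_ball[OF x])
  then have "((\<lambda>t. \<Sum>b\<in>Basis. ((x - a) \<bullet> b) * ?f' t b) has_integral (\<Sum>b\<in>Basis. ((x - a) \<bullet> b) * h b x)) {0..1}"
    unfolding h_def
    by (intro has_integral_sum has_integral_mult_right)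
      (auto intro!: integrable_integral integrable_continuous_interval)
  from has_integral_unique[OF increment this]
  show "f x = f a + (\<Sum>b\<in>Basis. ((x - a) \<bullet> b) * h b x)" by simp
qed

section \<open>Charts and smooth functions\<close>

locale atlas =
  fixes A :: "('a, 'e::euclidean_space) chart set"
  assumes smooth_atlas: "smooth_atlas A"
begin

lemma chart_inj_on: "(U, \<phi>) \<in> A \<Longrightarrow> inj_on \<phi> U"
  using smooth_atlas by (auto simp: smooth_atlas_def)

lemma open_chart_image: "(U, \<phi>) \<in> A \<Longrightarrow> open (\<phi> ` U)"
  using smooth_atlas by (auto simp: smooth_atlas_def)

lemma open_overlap_image: "(U, \<phi>) \<in> A \<Longrightarrow> (V, \<psi>) \<in> A \<Longrightarrow> open (\<phi> ` (U \<inter> V))"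
  using smooth_atlas by (fastforce simp: smooth_atlas_def)

lemma smooth_on_transition:
  "(U, \<phi>) \<in> A \<Longrightarrow> (V, \<psi>) \<in> A \<Longrightarrow> smooth_on (\<phi> ` (U \<inter> V)) (\<psi> \<circ> inv_into U \<phi>)"
  using smooth_atlas by (fastforce simp: smooth_atlas_def)

lemma chart_inverse: "(U, \<phi>) \<in> A \<Longrightarrow> p \<in> U \<Longrightarrow> inv_into U \<phi> (\<phi> p) = p"
  using chart_inj_on by (simp add: inv_into_f_f)

lemma pts_iff: "p \<in> pts A \<longleftrightarrow> (\<exists>U \<phi>. (U, \<phi>) \<in> A \<and> p \<in> U)"
  by (auto simp: pts_def)

lemma pts_chartE:
  assumes "p \<in> pts A" obtains U \<phi> where "(U, \<phi>) \<in> A" "p \<in> U"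
  using assms pts_iff by blast

lemma chart_pts: "(U, \<phi>) \<in> A \<Longrightarrow> p \<in> U \<Longrightarrow> p \<in> pts A"
  using pts_iff by blast

subsection \<open>The manifold topology\<close>

lemma openin_mtop_iff:
  "openin (mtop A) V \<longleftrightarrow> V \<subseteq> pts A \<and> (\<forall>U \<phi>. (U, \<phi>) \<in> A \<longrightarrow> open (\<phi> ` (V \<inter> U)))"
proof -
  let ?is_open = "\<lambda>V. V \<subseteq> pts A \<and> (\<forall>(U, \<phi>)\<in>A. open (\<phi> ` (V \<inter> U)))"
  have "istopology ?is_open"
    unfolding istopology_def
  proof (intro conjI allI impI)
    fix S T assume S: "?is_open S" and T: "?is_open T"
    have "\<phi> ` (S \<inter> T \<inter> U) = \<phi> ` (S \<inter> U) \<inter> \<phi> ` (T \<inter> U)" if "(U, \<phi>) \<in> A" for U \<phi>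
      using inj_on_image_Int[OF chart_inj_on[OF that], of "S \<inter> U" "T \<inter> U"] by (simp add: Int_ac)
    with S T show "S \<inter> T \<subseteq> pts A" "\<forall>(U, \<phi>)\<in>A. open (\<phi> ` (S \<inter> T \<inter> U))" by fastforce+
  next
    fix K assume K: "\<forall>S\<in>K. ?is_open S"
    have "\<phi> ` (\<Union> K \<inter> U) = (\<Union>S\<in>K. \<phi> ` (S \<inter> U))" for U and \<phi> :: "'a \<Rightarrow> 'e" by auto
    with K show "\<Union> K \<subseteq> pts A" "\<forall>(U, \<phi>)\<in>A. open (\<phi> ` (\<Union> K \<inter> U))" by (auto intro!: open_UN)
  qed
  then show ?thesis by (auto simp: mtop_def topology_inverse')
qed

lemma openin_pts: "openin (mtop A) W \<Longrightarrow> p \<in> W \<Longrightarrow> p \<in> pts A"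
  by (auto simp: openin_mtop_iff)

lemma openin_chart_preimage:
  assumes chart: "(U, \<phi>) \<in> A" and S: "open S"
  shows "openin (mtop A) {p \<in> U. \<phi> p \<in> S}"
  unfolding openin_mtop_iff
proof (intro conjI allI impI)
  show "{p \<in> U. \<phi> p \<in> S} \<subseteq> pts A" using chart_pts[OF chart] by auto
  fix V \<psi> assume chart': "(V, \<psi>) \<in> A"
  have "\<psi> ` ({p \<in> U. \<phi> p \<in> S} \<inter> V) = \<psi> ` (V \<inter> U) \<inter> (\<phi> \<circ> inv_into V \<psi>) -` S"
    using chart_inverse[OF chart'] by (auto simp: image_iff)
  moreover have "open \<dots>"
    using smooth_on_imp_continuous_on[OF smooth_on_transition[OF chart' chart]]
      open_overlap_image[OF chart' chart] S
    by (rule continuous_open_preimage)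
  ultimately show "open (\<psi> ` ({p \<in> U. \<phi> p \<in> S} \<inter> V))" by simp
qed

lemma openin_chart: "(U, \<phi>) \<in> A \<Longrightarrow> openin (mtop A) U"
  using openin_chart_preimage[of U \<phi> UNIV] by auto

lemma topspace_mtop: "topspace (mtop A) = pts A"
proof -
  have "openin (mtop A) (\<Union>(U, \<phi>)\<in>A. U)" using openin_chart by (intro openin_Union) auto
  then show ?thesis by (metis openin_mtop_iff openin_subset openin_topspace pts_def subset_antisym)
qed

abbreviation near :: "'a \<Rightarrow> 'a filter" where
  "near p \<equiv> nhdsin (mtop A) p"

lemma eventually_near:
  "p \<in> pts A \<Longrightarrow> eventually P (near p) \<longleftrightarrow> (\<exists>W. openin (mtop A) W \<and> p \<in> W \<and> (\<forall>q\<in>W. P q))"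
  by (auto simp: eventually_nhdsin topspace_mtop)

lemma eventually_nearE:
  assumes "p \<in> pts A" "eventually P (near p)"
  obtains W where "openin (mtop A) W" "p \<in> W" "\<forall>q\<in>W. P q"
  using assms eventually_near by blast

lemma eventually_near_in_open:
  "openin (mtop A) W \<Longrightarrow> p \<in> W \<Longrightarrow> eventually (\<lambda>q. q \<in> W) (near p)"
  by (auto simp: eventually_nhdsin)

lemma eventually_near_pts: "eventually (\<lambda>q. q \<in> pts A) (near p)"
  using eventually_near_in_open[of "pts A" p] openin_topspace[of "mtop A"]
  by (cases "p \<in> pts A") (auto simp: topspace_mtop eventually_nhdsin)

lemma eventually_near_imp: "p \<in> pts A \<Longrightarrow> eventually P (near p) \<Longrightarrow> P p"
  by (auto simp: eventually_near)

lemma eventually_near_eventually: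
  assumes "eventually P (near p)"
  shows "eventually (\<lambda>q. eventually P (near q)) (near p)"
proof (cases "p \<in> pts A")
  case True
  then obtain W where W: "openin (mtop A) W" "p \<in> W" "\<forall>q\<in>W. P q"
    using assms by (rule eventually_nearE)
  show ?thesis
    using eventually_near_in_open[OF W(1,2)]
  proof eventually_elim
    case (elim q)
    show ?case using eventually_near_in_open[OF W(1) elim] by (rule eventually_mono) (use W(3) in blast)
  qed
qed (auto simp: eventually_nhdsin topspace_mtop)

subsection \<open>Germs of smooth functions\<close>

lemma smooth_near_pts: "smooth_near A p f \<Longrightarrow> p \<in> pts A"
  by (auto simp: smooth_near_def smooth_fun_on_def openin_mtop_iff)

lemma smooth_near_chartE:
  assumes "(U, \<phi>) \<in> A" "p \<in> U" "smooth_near A p f"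
  obtains S where "open S" "\<phi> p \<in> S" "S \<subseteq> \<phi> ` U" "smooth_on S (f \<circ> inv_into U \<phi>)"
proof -
  obtain W where W: "p \<in> W" "smooth_fun_on A W f" using assms(3) by (auto simp: smooth_near_def)
  show ?thesis
    by (rule that[of "\<phi> ` (W \<inter> U)"]) (use W assms in \<open>auto simp: smooth_fun_on_def openin_mtop_iff\<close>)
qed

lemma smooth_near_chartE_finite:
  assumes chart: "(U, \<phi>) \<in> A" "p \<in> U" and F: "finite F" "\<And>f. f \<in> F \<Longrightarrow> smooth_near A p f"
  obtains S where "open S" "\<phi> p \<in> S" "\<forall>f\<in>F. smooth_on S (f \<circ> inv_into U \<phi>)"
proof -
  have "\<exists>S. open S \<and> \<phi> p \<in> S \<and> smooth_on S (f \<circ> inv_into U \<phi>)" if "f \<in> F" for f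
    by (rule smooth_near_chartE[OF chart F(2)[OF that]]) blast
  then have "\<forall>f\<in>F. \<exists>S. open S \<and> \<phi> p \<in> S \<and> smooth_on S (f \<circ> inv_into U \<phi>)" ..
  from bchoice[OF this] obtain S where
    S: "\<forall>f\<in>F. open (S f) \<and> \<phi> p \<in> S f \<and> smooth_on (S f) (f \<circ> inv_into U \<phi>)" ..
  show ?thesis
  proof (rule that[of "\<Inter>f\<in>F. S f"])
    show "open (\<Inter>f\<in>F. S f)" using S F(1) by (intro open_INT) auto
    show "\<phi> p \<in> (\<Inter>f\<in>F. S f)" using S by blast
    show "\<forall>f\<in>F. smooth_on (\<Inter>f\<in>F. S f) (f \<circ> inv_into U \<phi>)"
    proof
      fix f assume "f \<in> F"
      with S have "smooth_on (S f) (f \<circ> inv_into U \<phi>)" by blast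
      then show "smooth_on (\<Inter>f\<in>F. S f) (f \<circ> inv_into U \<phi>)"
        by (rule smooth_on_subset) (use \<open>f \<in> F\<close> in blast)
    qed
  qed
qed

lemma smooth_fun_on_chartI:
  assumes chart: "(U, \<phi>) \<in> A" and S: "open S" "smooth_on S (f \<circ> inv_into U \<phi>)"
  shows "smooth_fun_on A {p \<in> U. \<phi> p \<in> S} f"
  unfolding smooth_fun_on_def
proof (intro conjI ballI openin_chart_preimage[OF chart S(1)], clarify)
  fix V \<psi> assume chart': "(V, \<psi>) \<in> A"
  let ?W = "{p \<in> U. \<phi> p \<in> S}"
  have image_open: "open (\<psi> ` (?W \<inter> V))"
    using openin_chart_preimage[OF chart S(1)] chart' by (auto simp: openin_mtop_iff)
  have "smooth_on (\<psi> ` (?W \<inter> V)) (\<phi> \<circ> inv_into V \<psi>)"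
    by (rule smooth_on_subset[OF smooth_on_transition[OF chart' chart]]) auto
  then have "smooth_on (\<psi> ` (?W \<inter> V)) (\<lambda>x. (f \<circ> inv_into U \<phi>) ((\<phi> \<circ> inv_into V \<psi>) x))"
    by (intro smooth_on_compose[OF image_open S(1) _ _ S(2)]) (auto simp: chart_inverse[OF chart'] o_def)
  then show "smooth_on (\<psi> ` (?W \<inter> V)) (f \<circ> inv_into V \<psi>)"
    by (rule smooth_on_cong[OF image_open]) (auto simp: chart_inverse[OF chart'] chart_inverse[OF chart])
qed

lemma smooth_near_chartI:
  assumes "(U, \<phi>) \<in> A" "p \<in> U" "open S" "\<phi> p \<in> S" "smooth_on S (f \<circ> inv_into U \<phi>)"
  shows "smooth_near A p f"
  unfolding smooth_near_def
proof (intro exI conjI)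
  show "smooth_fun_on A {p \<in> U. \<phi> p \<in> S} f" by (rule smooth_fun_on_chartI[OF assms(1,3,5)])
qed (use assms(2,4) in simp)

lemma smooth_fun_on_iff:
  "smooth_fun_on A U f \<longleftrightarrow> openin (mtop A) U \<and> (\<forall>p\<in>U. smooth_near A p f)"
proof
  assume near: "openin (mtop A) U \<and> (\<forall>p\<in>U. smooth_near A p f)"
  show "smooth_fun_on A U f"
    unfolding smooth_fun_on_def
  proof (intro conjI ballI, use near in blast, clarify)
    fix V \<psi> assume chart: "(V, \<psi>) \<in> A"
    show "smooth_on (\<psi> ` (U \<inter> V)) (f \<circ> inv_into V \<psi>)"
    proof (rule smooth_on_local)
      show "open (\<psi> ` (U \<inter> V))" using near chart by (auto simp: openin_mtop_iff)
      fix x assume "x \<in> \<psi> ` (U \<inter> V)"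
      then obtain p where p: "p \<in> U" "p \<in> V" "x = \<psi> p" by auto
      with near have "smooth_near A p f" by blast
      from smooth_near_chartE[OF chart p(2) this] obtain T where
        "open T" "\<psi> p \<in> T" "T \<subseteq> \<psi> ` V" "smooth_on T (f \<circ> inv_into V \<psi>)" .
      then show "\<exists>T. open T \<and> x \<in> T \<and> smooth_on T (f \<circ> inv_into V \<psi>)" using p(3) by blast
    qed
  qed
qed (auto simp: smooth_near_def smooth_fun_on_def)

lemma smooth_near_eventually:
  assumes "smooth_near A p f" shows "eventually (\<lambda>q. smooth_near A q f) (near p)"
proof -
  obtain W where "p \<in> W" "smooth_fun_on A W f" using assms by (auto simp: smooth_near_def)
  then show ?thesis
    using smooth_near_pts[OF assms] by (auto simp: eventually_near smooth_fun_on_iff)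
qed

lemma smooth_near_cong:
  assumes f: "smooth_near A p f" and eq: "eventually (\<lambda>q. f q = h q) (near p)"
  shows "smooth_near A p h"
proof -
  have p: "p \<in> pts A" using smooth_near_pts[OF f] .
  obtain W where W: "openin (mtop A) W" "p \<in> W" "\<forall>q\<in>W. f q = h q"
    using p eq by (rule eventually_nearE)
  obtain U \<phi> where chart: "(U, \<phi>) \<in> A" "p \<in> U" using p by (rule pts_chartE)
  obtain S where S: "open S" "\<phi> p \<in> S" "smooth_on S (f \<circ> inv_into U \<phi>)"
    using smooth_near_chartE[OF chart f] by metis
  have open_image: "open (S \<inter> \<phi> ` (W \<inter> U))" using S W chart by (auto simp: openin_mtop_iff)
  have "smooth_on (S \<inter> \<phi> ` (W \<inter> U)) (f \<circ> inv_into U \<phi>)" using S(3) by (rule smooth_on_subset) auto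
  then have "smooth_on (S \<inter> \<phi> ` (W \<inter> U)) (h \<circ> inv_into U \<phi>)"
    by (rule smooth_on_cong[OF open_image]) (use W(3) chart_inverse[OF chart(1)] in auto)
  then show ?thesis by (intro smooth_near_chartI[OF chart open_image]) (use S W chart in auto)
qed

lemma smooth_near_cong_iff:
  assumes "eventually (\<lambda>q. f q = h q) (near p)"
  shows "smooth_near A p f \<longleftrightarrow> smooth_near A p h"
  using smooth_near_cong[of p f h] smooth_near_cong[of p h f] assms by (auto simp: eq_commute)

lemma smooth_near_of_chart:
  assumes chart: "(U, \<phi>) \<in> A" "p \<in> U" and S: "open S" "\<phi> p \<in> S" "smooth_on S k"
  shows "smooth_near A p (\<lambda>q. k (\<phi> q))"
proof -
  have open_inter: "open (S \<inter> \<phi> ` U)" using S chart open_chart_image by auto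
  have "smooth_on (S \<inter> \<phi> ` U) k" using S(3) by (rule smooth_on_subset) auto
  then have "smooth_on (S \<inter> \<phi> ` U) ((\<lambda>q. k (\<phi> q)) \<circ> inv_into U \<phi>)"
    by (rule smooth_on_cong[OF open_inter]) (auto simp: chart_inverse[OF chart(1)])
  then show ?thesis by (rule smooth_near_chartI[OF chart open_inter, rotated]) (use S chart in auto)
qed

lemma smooth_near_coord: "(U, \<phi>) \<in> A \<Longrightarrow> p \<in> U \<Longrightarrow> smooth_near A p (\<lambda>q. \<phi> q \<bullet> b)"
  by (rule smooth_near_of_chart[of U \<phi> p UNIV "\<lambda>x. x \<bullet> b"])
    (auto intro: smooth_on_linear bounded_linear_inner_left)

lemma smooth_near_const: "p \<in> pts A \<Longrightarrow> smooth_near A p (\<lambda>q. c)"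
  using smooth_near_of_chart[where S = UNIV and k = "\<lambda>x. c"] smooth_on_const[OF open_UNIV]
  by (metis UNIV_I open_UNIV pts_iff)

lemma smooth_near_indicator:
  assumes "openin (mtop A) W" "p \<in> W"
  shows "smooth_near A p (indicat_real W)"
proof (rule smooth_near_cong[OF smooth_near_const[OF openin_pts[OF assms], of 1]])
  show "eventually (\<lambda>q. 1 = indicat_real W q) (near p)"
    using eventually_near_in_open[OF assms] by eventually_elim simp
qed

lemma smooth_near_binary:
  assumes opr: "\<And>S f h. open S \<Longrightarrow> smooth_on S f \<Longrightarrow> smooth_on S h \<Longrightarrow> smooth_on S (\<lambda>x::'e. opr (f x) (h x))"
    and f: "smooth_near A p f" and h: "smooth_near A p h"
  shows "smooth_near A p (\<lambda>q. opr (f q) (h q))"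
proof -
  obtain U \<phi> where chart: "(U, \<phi>) \<in> A" "p \<in> U" using smooth_near_pts[OF f] by (rule pts_chartE)
  obtain S where S: "open S" "\<phi> p \<in> S" "\<forall>k\<in>{f, h}. smooth_on S (k \<circ> inv_into U \<phi>)"
    by (rule smooth_near_chartE_finite[OF chart, of "{f, h}"]) (use f h in auto)
  then have "smooth_on S (f \<circ> inv_into U \<phi>)" "smooth_on S (h \<circ> inv_into U \<phi>)" by simp_all
  from opr[OF S(1) this] have "smooth_on S ((\<lambda>q. opr (f q) (h q)) \<circ> inv_into U \<phi>)"
    by (simp only: o_def)
  then show ?thesis by (rule smooth_near_chartI[OF chart S(1,2)])
qed

lemma smooth_near_add: "smooth_near A p f \<Longrightarrow> smooth_near A p h \<Longrightarrow> smooth_near A p (\<lambda>q. f q + h q)"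
  by (rule smooth_near_binary) (auto intro: smooth_on_add)

lemma smooth_near_mult: "smooth_near A p f \<Longrightarrow> smooth_near A p h \<Longrightarrow> smooth_near A p (\<lambda>q. f q * h q)"
  by (rule smooth_near_binary) (auto intro: smooth_on_bilinear[OF bounded_bilinear_mult])

lemma smooth_near_cmult: "smooth_near A p f \<Longrightarrow> smooth_near A p (\<lambda>q. c * f q)"
  using smooth_near_mult[OF smooth_near_const[OF smooth_near_pts]] .

lemma smooth_near_uminus: "smooth_near A p f \<Longrightarrow> smooth_near A p (\<lambda>q. - f q)"
  using smooth_near_cmult[of p f "- 1"] by simp

lemma smooth_near_diff: "smooth_near A p f \<Longrightarrow> smooth_near A p h \<Longrightarrow> smooth_near A p (\<lambda>q. f q - h q)"
  using smooth_near_add[OF _ smooth_near_uminus, of p f h] by simp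

lemma smooth_near_sum:
  "p \<in> pts A \<Longrightarrow> (\<And>i. i \<in> I \<Longrightarrow> smooth_near A p (f i)) \<Longrightarrow> smooth_near A p (\<lambda>q. \<Sum>i\<in>I. f i q)"
  by (induction I rule: infinite_finite_induct) (auto intro: smooth_near_const smooth_near_add)

lemma smooth_near_unary:
  fixes opr :: "real \<Rightarrow> real"
  assumes opr: "\<And>S f. open S \<Longrightarrow> smooth_on S f \<Longrightarrow> (\<And>x. x \<in> S \<Longrightarrow> f x \<in> T) \<Longrightarrow> smooth_on S (\<lambda>x::'e. opr (f x))"
    and T: "open T" "f p \<in> T" and f: "smooth_near A p f"
  shows "smooth_near A p (\<lambda>q. opr (f q))"
proof -
  obtain U \<phi> where chart: "(U, \<phi>) \<in> A" "p \<in> U" using smooth_near_pts[OF f] by (rule pts_chartE)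
  obtain S where S: "open S" "\<phi> p \<in> S" "smooth_on S (f \<circ> inv_into U \<phi>)"
    using smooth_near_chartE[OF chart f] by metis
  let ?S = "S \<inter> (f \<circ> inv_into U \<phi>) -` T"
  have open_preimage: "open ?S"
    using smooth_on_imp_continuous_on[OF S(3)] S(1) T(1) by (rule continuous_open_preimage)
  have "smooth_on ?S (\<lambda>x. opr ((f \<circ> inv_into U \<phi>) x))"
    by (rule opr[OF open_preimage smooth_on_subset[OF S(3)]]) auto
  then show ?thesis
    by (intro smooth_near_chartI[OF chart open_preimage])
      (use S T chart_inverse[OF chart] in \<open>auto simp: o_def\<close>)
qed

lemma smooth_near_inverse_sqrt:
  assumes "smooth_near A p f" "f p > 0"
  shows "smooth_near A p (\<lambda>q. inverse (sqrt (f q)))"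
  by (rule smooth_near_unary[where T = "{0<..}"])
    (use assms in \<open>force intro: smooth_on_inverse smooth_on_sqrt\<close>)+

lemma smooth_near_continuous:
  assumes f: "smooth_near A p f" and T: "open T" "f p \<in> T"
  shows "eventually (\<lambda>q. f q \<in> T) (near p)"
proof -
  have p: "p \<in> pts A" using smooth_near_pts[OF f] .
  obtain U \<phi> where chart: "(U, \<phi>) \<in> A" "p \<in> U" using p by (rule pts_chartE)
  obtain S where S: "open S" "\<phi> p \<in> S" "smooth_on S (f \<circ> inv_into U \<phi>)"
    using smooth_near_chartE[OF chart f] by metis
  let ?S = "S \<inter> (f \<circ> inv_into U \<phi>) -` T"
  have "open ?S"
    using smooth_on_imp_continuous_on[OF S(3)] S(1) T(1) by (rule continuous_open_preimage)
  from eventually_near_in_open[OF openin_chart_preimage[OF chart(1) this], of p]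
  have "eventually (\<lambda>q. q \<in> U \<and> \<phi> q \<in> ?S) (near p)" using chart S T chart_inverse[OF chart(1)] by simp
  then show ?thesis by eventually_elim (use chart_inverse[OF chart(1)] in auto)
qed

end

subsection \<open>Smooth maps\<close>

text \<open>Smoothness of \<open>\<Phi>\<close> at \<open>p\<close> is tested on real-valued functions. Continuity of \<open>\<Phi>\<close> at \<open>p\<close> follows, since
  the indicator function of a neighbourhood of \<open>\<Phi> p\<close> is smooth near \<open>\<Phi> p\<close>.\<close>

definition smooth_map_at ::
    "('a, 'e::euclidean_space) chart set \<Rightarrow> ('b, 'f::euclidean_space) chart set \<Rightarrow> ('a \<Rightarrow> 'b) \<Rightarrow> 'a \<Rightarrow> bool" where
  "smooth_map_at A B \<Phi> p \<longleftrightarrow> (\<forall>f. smooth_near B (\<Phi> p) f \<longrightarrow> smooth_near A p (\<lambda>q. f (\<Phi> q)))"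

context atlas
begin

lemma smooth_map_atD: "smooth_map_at A B \<Phi> p \<Longrightarrow> smooth_near B (\<Phi> p) f \<Longrightarrow> smooth_near A p (\<lambda>q. f (\<Phi> q))"
  by (simp add: smooth_map_at_def)

lemma smooth_map_at_eventually:
  assumes B: "atlas B" and \<Phi>: "smooth_map_at A B \<Phi> p" "\<Phi> p \<in> pts B"
    and ev: "eventually P (nhdsin (mtop B) (\<Phi> p))"
  shows "eventually (\<lambda>q. P (\<Phi> q)) (near p)"
proof -
  interpret B: atlas B by (rule B)
  obtain W where W: "openin (mtop B) W" "\<Phi> p \<in> W" "\<forall>q\<in>W. P q"
    using \<Phi>(2) ev by (rule B.eventually_nearE)
  have "smooth_near A p (\<lambda>q. indicat_real W (\<Phi> q))"
    by (rule smooth_map_atD[OF \<Phi>(1) B.smooth_near_indicator[OF W(1,2)]])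
  from smooth_near_continuous[OF this, of "{0<..}"]
  have "eventually (\<lambda>q. indicat_real W (\<Phi> q) \<in> {0<..}) (near p)" using W(2) by simp
  then show ?thesis
  proof eventually_elim
    case (elim q)
    then have "\<Phi> q \<in> W" by (cases "\<Phi> q \<in> W") simp_all
    with W(3) show ?case by blast
  qed
qed

lemma smooth_map_at_chartI:
  assumes B: "atlas B" and chart: "(V, \<psi>) \<in> B" "\<Phi> p \<in> V" and p: "p \<in> pts A"
    and in_chart: "eventually (\<lambda>q. \<Phi> q \<in> V) (near p)"
    and coords: "\<And>b. b \<in> Basis \<Longrightarrow> smooth_near A p (\<lambda>q. \<psi> (\<Phi> q) \<bullet> b)"
  shows "smooth_map_at A B \<Phi> p"
  unfolding smooth_map_at_def
proof (intro allI impI)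
  interpret B: atlas B by (rule B)
  fix f assume f: "smooth_near B (\<Phi> p) f"
  obtain T where T: "open T" "\<psi> (\<Phi> p) \<in> T" "T \<subseteq> \<psi> ` V" "smooth_on T (f \<circ> inv_into V \<psi>)"
    using B.smooth_near_chartE[OF chart f] .
  obtain U \<phi> where chartA: "(U, \<phi>) \<in> A" "p \<in> U" using p by (rule pts_chartE)
  let ?s = "\<lambda>x. \<psi> (\<Phi> (inv_into U \<phi> x))"
  let ?F = "(\<lambda>b q. \<psi> (\<Phi> q) \<bullet> b) ` Basis"
  have "smooth_near A p k" if "k \<in> ?F" for k using that by (elim imageE) (simp only: coords)
  from smooth_near_chartE_finite[OF chartA finite_imageI[OF finite_Basis] this]
  obtain S where S: "open S" "\<phi> p \<in> S" "\<forall>k\<in>?F. smooth_on S (k \<circ> inv_into U \<phi>)" .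
  have s: "smooth_on S ?s"
    by (rule smooth_on_componentwise[OF S(1)]) (use S(3) in \<open>simp add: o_def\<close>)
  have open_preimage: "open (S \<inter> ?s -` T)"
    using smooth_on_imp_continuous_on[OF s] S(1) T(1) by (rule continuous_open_preimage)
  have "smooth_on (S \<inter> ?s -` T) (\<lambda>x. (f \<circ> inv_into V \<psi>) (?s x))"
    by (rule smooth_on_compose[OF open_preimage T(1) _ smooth_on_subset[OF s] T(4)]) auto
  then have "smooth_near A p (\<lambda>q. (f \<circ> inv_into V \<psi>) (?s (\<phi> q)))"
    using S T chart_inverse[OF chartA] by (intro smooth_near_of_chart[OF chartA open_preimage]) auto
  moreover have "eventually (\<lambda>q. (f \<circ> inv_into V \<psi>) (?s (\<phi> q)) = f (\<Phi> q)) (near p)"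
    using in_chart eventually_near_in_open[OF openin_chart[OF chartA(1)] chartA(2)]
    by eventually_elim (simp add: chart_inverse[OF chartA(1)] B.chart_inverse[OF chart(1)])
  ultimately show "smooth_near A p (\<lambda>q. f (\<Phi> q))" by (rule smooth_near_cong)
qed

end

section \<open>Tangent vectors\<close>

lemma tzero_apply: "tzero f = 0"
  by (simp add: tzero_def)

lemma tadd_apply: "tadd v w f = v f + w f"
  by (simp add: tadd_def)

lemma tscale_apply: "tscale c v f = c * v f"
  by (simp add: tscale_def)

lemma tdiff_apply: "tdiff v w f = v f - w f"
  by (simp add: tdiff_def)

lemma tsum_apply: "tsum v I f = (\<Sum>i\<in>I. v i f)"
  by (simp add: tsum_def)

lemmas tvec_apply = tzero_apply tadd_apply tscale_apply tdiff_apply tsum_apply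

lemma tdiff_eq_tadd: "tdiff v w = tadd v (tscale (- 1) w)"
  by (rule ext) (simp add: tvec_apply)

lemma tdiff_eq_tzero_iff: "tdiff v w = tzero \<longleftrightarrow> v = w"
  by (simp add: fun_eq_iff tvec_apply)

lemma tscale_0: "tscale 0 v = tzero"
  by (rule ext) (simp add: tvec_apply)

lemma tsum_insert: "finite I \<Longrightarrow> i \<notin> I \<Longrightarrow> tsum v (insert i I) = tadd (v i) (tsum v I)"
  by (rule ext) (simp add: tvec_apply)

context atlas
begin

lemma tangentI:
  assumes "\<And>f. \<not> smooth_near A p f \<Longrightarrow> v f = 0"
    and "\<And>f h. smooth_near A p f \<Longrightarrow> smooth_near A p h \<Longrightarrow> v (\<lambda>q. f q + h q) = v f + v h"
    and "\<And>f h. smooth_near A p f \<Longrightarrow> smooth_near A p h \<Longrightarrow> v (\<lambda>q. f q * h q) = f p * v h + h p * v f"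
    and "\<And>f c. smooth_near A p f \<Longrightarrow> v (\<lambda>q. c * f q) = c * v f"
  shows "v \<in> tangent_space A p"
  using assms by (simp add: tangent_space_def)

lemma tangent_add:
  "v \<in> tangent_space A p \<Longrightarrow> smooth_near A p f \<Longrightarrow> smooth_near A p h \<Longrightarrow> v (\<lambda>q. f q + h q) = v f + v h"
  by (auto simp: tangent_space_def)

lemma tangent_mult:
  "v \<in> tangent_space A p \<Longrightarrow> smooth_near A p f \<Longrightarrow> smooth_near A p h \<Longrightarrow>
    v (\<lambda>q. f q * h q) = f p * v h + h p * v f"
  by (auto simp: tangent_space_def)

lemma tangent_scale:
  "v \<in> tangent_space A p \<Longrightarrow> smooth_near A p f \<Longrightarrow> v (\<lambda>q. c * f q) = c * v f"
  by (auto simp: tangent_space_def)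

lemma tangent_not_smooth: "v \<in> tangent_space A p \<Longrightarrow> \<not> smooth_near A p f \<Longrightarrow> v f = 0"
  by (auto simp: tangent_space_def)

lemma tangent_ext:
  assumes "v \<in> tangent_space A p" "w \<in> tangent_space A p" "\<And>f. smooth_near A p f \<Longrightarrow> v f = w f"
  shows "v = w"
proof
  fix f show "v f = w f"
    using assms tangent_not_smooth[of v p f] tangent_not_smooth[of w p f] by (cases "smooth_near A p f") auto
qed

lemma tangent_cong:
  assumes v: "v \<in> tangent_space A p" and p: "p \<in> pts A"
    and eq: "eventually (\<lambda>q. f q = h q) (near p)"
  shows "v f = v h"
proof (cases "smooth_near A p f")
  case False
  then show ?thesis using smooth_near_cong_iff[OF eq] tangent_not_smooth[OF v] by metis
next
  case f: True
  then have h: "smooth_near A p h" using eq by (rule smooth_near_cong)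
  obtain W where W: "openin (mtop A) W" "p \<in> W" "\<forall>q\<in>W. f q = h q"
    using p eq by (rule eventually_nearE)
  let ?c = "indicat_real W"
  have indicator: "smooth_near A p ?c" "?c p = 1" using smooth_near_indicator[OF W(1,2)] W(2) by simp_all
  have "(\<lambda>q. ?c q * ?c q) = ?c" by (auto simp: indicator_def)
  then have "v ?c = 0" using tangent_mult[OF v indicator(1) indicator(1)] indicator(2) by simp
  moreover have "(\<lambda>q. ?c q * f q) = (\<lambda>q. ?c q * h q)" using W(3) by (auto simp: indicator_def)
  ultimately show ?thesis
    using tangent_mult[OF v indicator(1) f] tangent_mult[OF v indicator(1) h] indicator(2) by simp
qed

lemma tangent_const:
  assumes "v \<in> tangent_space A p" "p \<in> pts A" shows "v (\<lambda>q. c) = 0"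
  using tangent_mult[OF assms(1) smooth_near_const[OF assms(2)] smooth_near_const[OF assms(2)], of 1 1]
    tangent_scale[OF assms(1) smooth_near_const[OF assms(2)], of c 1]
  by simp

lemma tangent_diff:
  assumes "v \<in> tangent_space A p" "smooth_near A p f" "smooth_near A p h"
  shows "v (\<lambda>q. f q - h q) = v f - v h"
  using tangent_add[OF assms(1,2) smooth_near_uminus[OF assms(3)]] tangent_scale[OF assms(1,3), of "-1"]
  by simp

lemma tangent_sum:
  assumes "v \<in> tangent_space A p" "p \<in> pts A" "\<And>i. i \<in> I \<Longrightarrow> smooth_near A p (f i)"
  shows "v (\<lambda>q. \<Sum>i\<in>I. f i q) = (\<Sum>i\<in>I. v (f i))"
  using assms(3)
proof (induction I rule: infinite_finite_induct)
  case (insert i I)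
  have "v (\<lambda>q. f i q + (\<Sum>i\<in>I. f i q)) = v (f i) + v (\<lambda>q. \<Sum>i\<in>I. f i q)"
    using insert.prems by (intro tangent_add[OF assms(1)] smooth_near_sum assms(2)) auto
  then show ?case using insert by simp
qed (use tangent_const[OF assms(1,2)] in auto)

lemma tzero_tangent: "tzero \<in> tangent_space A p"
  by (simp add: tangent_space_def tzero_def)

lemma tadd_tangent: "v \<in> tangent_space A p \<Longrightarrow> w \<in> tangent_space A p \<Longrightarrow> tadd v w \<in> tangent_space A p"
  by (simp add: tangent_space_def tadd_def algebra_simps)

lemma tscale_tangent: "v \<in> tangent_space A p \<Longrightarrow> tscale c v \<in> tangent_space A p"
  by (simp add: tangent_space_def tscale_def algebra_simps)

lemma tdiff_tangent: "v \<in> tangent_space A p \<Longrightarrow> w \<in> tangent_space A p \<Longrightarrow> tdiff v w \<in> tangent_space A p"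
  by (simp add: tdiff_eq_tadd tadd_tangent tscale_tangent)

lemma tsum_tangent: "(\<And>i. i \<in> I \<Longrightarrow> v i \<in> tangent_space A p) \<Longrightarrow> tsum v I \<in> tangent_space A p"
proof (induction I rule: infinite_finite_induct)
  case (insert i I)
  then show ?case by (simp add: tsum_insert tadd_tangent)
qed (simp_all add: tsum_def tzero_tangent[unfolded tzero_def])

lemma differential_apply: "smooth_near B (\<Phi> p) f \<Longrightarrow> differential B \<Phi> p v f = v (\<lambda>q. f (\<Phi> q))"
  by (simp add: differential_def o_def)

lemma differential_tangent:
  assumes B: "atlas B" and \<Phi>: "smooth_map_at A B \<Phi> p" and v: "v \<in> tangent_space A p"
  shows "differential B \<Phi> p v \<in> tangent_space B (\<Phi> p)"
proof -
  interpret B: atlas B by (rule B)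
  note pullback = smooth_map_atD[OF \<Phi>]
  show ?thesis
  proof (rule B.tangentI)
    show "differential B \<Phi> p v f = 0" if "\<not> smooth_near B (\<Phi> p) f" for f
      using that by (simp add: differential_def)
    show "differential B \<Phi> p v (\<lambda>q. f q + h q) = differential B \<Phi> p v f + differential B \<Phi> p v h"
      if "smooth_near B (\<Phi> p) f" "smooth_near B (\<Phi> p) h" for f h
      using tangent_add[OF v that[THEN pullback]] that by (simp add: differential_apply B.smooth_near_add)
    show "differential B \<Phi> p v (\<lambda>q. f q * h q) = f (\<Phi> p) * differential B \<Phi> p v h
        + h (\<Phi> p) * differential B \<Phi> p v f"
      if "smooth_near B (\<Phi> p) f" "smooth_near B (\<Phi> p) h" for f h
      using tangent_mult[OF v that[THEN pullback]] that by (simp add: differential_apply B.smooth_near_mult)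
    show "differential B \<Phi> p v (\<lambda>q. c * f q) = c * differential B \<Phi> p v f" if "smooth_near B (\<Phi> p) f" for f c
      using tangent_scale[OF v pullback[OF that]] that by (simp add: differential_apply B.smooth_near_cmult)
  qed
qed

subsection \<open>Coordinates of tangent vectors\<close>

lemma Hadamard_in_chart:
  assumes chart: "(U, \<phi>) \<in> A" "p \<in> U" and f: "smooth_near A p f"
  obtains h where "\<forall>b. smooth_near A p (h b)"
    and "eventually (\<lambda>q. f q = f p + (\<Sum>b\<in>Basis. (\<phi> q \<bullet> b - \<phi> p \<bullet> b) * h b q)) (near p)"
proof -
  obtain S where S: "open S" "\<phi> p \<in> S" "S \<subseteq> \<phi> ` U" "smooth_on S (f \<circ> inv_into U \<phi>)"
    using smooth_near_chartE[OF chart f] .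
  obtain r where r: "r > 0" "ball (\<phi> p) r \<subseteq> S" using S(1,2) open_contains_ball by blast
  obtain k where k: "\<And>b. smooth_on (ball (\<phi> p) r) (k b)"
    and expand: "\<And>x. x \<in> ball (\<phi> p) r \<Longrightarrow> (f \<circ> inv_into U \<phi>) x =
      (f \<circ> inv_into U \<phi>) (\<phi> p) + (\<Sum>b\<in>Basis. ((x - \<phi> p) \<bullet> b) * k b x)"
    using smooth_on_Hadamard[OF smooth_on_subset[OF S(4) r(2)]] by metis
  show ?thesis
  proof (rule that[of "\<lambda>b q. k b (\<phi> q)"])
    show "\<forall>b. smooth_near A p (\<lambda>q. k b (\<phi> q))"
      by (intro allI smooth_near_of_chart[OF chart open_ball _ k]) (use r(1) in simp)
    have "eventually (\<lambda>q. q \<in> {q \<in> U. \<phi> q \<in> ball (\<phi> p) r}) (near p)"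
      by (rule eventually_near_in_open[OF openin_chart_preimage[OF chart(1) open_ball]]) (use chart r(1) in simp)
    then show "eventually (\<lambda>q. f q = f p + (\<Sum>b\<in>Basis. (\<phi> q \<bullet> b - \<phi> p \<bullet> b) * k b (\<phi> q))) (near p)"
    proof eventually_elim
      case (elim q)
      then show ?case
        using expand[of "\<phi> q"] by (simp add: chart_inverse[OF chart(1)] chart(2) inner_diff_left)
    qed
  qed
qed

text \<open>By Hadamard's lemma, \<open>f - f p\<close> is a combination of coordinate functions vanishing at \<open>p\<close>, which the
  Leibniz rule evaluates.\<close>

lemma tangent_eqI_coords:
  assumes v: "v \<in> tangent_space A p" and w: "w \<in> tangent_space A p"
    and chart: "(U, \<phi>) \<in> A" "p \<in> U" and eq: "\<And>b. b \<in> Basis \<Longrightarrow> v (\<lambda>q. \<phi> q \<bullet> b) = w (\<lambda>q. \<phi> q \<bullet> b)"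
  shows "v = w"
proof (rule tangent_ext[OF v w])
  fix f assume f: "smooth_near A p f"
  have p: "p \<in> pts A" using chart_pts[OF chart] .
  obtain h where smooth: "\<forall>b. smooth_near A p (h b)"
    and expand: "eventually (\<lambda>q. f q = f p + (\<Sum>b\<in>Basis. (\<phi> q \<bullet> b - \<phi> p \<bullet> b) * h b q)) (near p)"
    using Hadamard_in_chart[OF chart f] .
  note h = smooth[rule_format]
  note coord = smooth_near_coord[OF chart] and const = smooth_near_const[OF p]
  note factor = smooth_near_diff[OF coord const]
  have "u f = (\<Sum>b\<in>Basis. h b p * u (\<lambda>q. \<phi> q \<bullet> b))" if u: "u \<in> tangent_space A p" for u
  proof -
    have summand: "u (\<lambda>q. (\<phi> q \<bullet> b - \<phi> p \<bullet> b) * h b q) = h b p * u (\<lambda>q. \<phi> q \<bullet> b)" for b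
      using tangent_mult[OF u factor h, of b "\<phi> p \<bullet> b" b] tangent_diff[OF u coord const, of b] tangent_const[OF u p]
      by simp
    have "u f = u (\<lambda>q. f p + (\<Sum>b\<in>Basis. (\<phi> q \<bullet> b - \<phi> p \<bullet> b) * h b q))"
      by (rule tangent_cong[OF u p expand])
    also have "\<dots> = u (\<lambda>q. \<Sum>b\<in>Basis. (\<phi> q \<bullet> b - \<phi> p \<bullet> b) * h b q)"
      using tangent_add[OF u const smooth_near_sum[OF p smooth_near_mult[OF factor h]]] tangent_const[OF u p]
      by simp
    also have "\<dots> = (\<Sum>b\<in>Basis. u (\<lambda>q. (\<phi> q \<bullet> b - \<phi> p \<bullet> b) * h b q))"
      by (rule tangent_sum[OF u p smooth_near_mult[OF factor h]])
    finally show ?thesis by (simp only: summand)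
  qed
  from this[OF v] this[OF w] show "v f = w f" using eq by simp
qed

definition coords :: "('a \<Rightarrow> 'e) \<Rightarrow> 'a tvec \<Rightarrow> 'e" where
  "coords \<phi> v = (\<Sum>b\<in>Basis. v (\<lambda>q. \<phi> q \<bullet> b) *\<^sub>R b)"

lemma coords_inner: "b \<in> Basis \<Longrightarrow> coords \<phi> v \<bullet> b = v (\<lambda>q. \<phi> q \<bullet> b)"
  by (simp add: coords_def inner_sum_left_Basis)

lemma coords_add: "coords \<phi> (tadd v w) = coords \<phi> v + coords \<phi> w"
  by (simp add: coords_def tvec_apply scaleR_add_left sum.distrib)

lemma coords_scale: "coords \<phi> (tscale c v) = c *\<^sub>R coords \<phi> v"
  by (simp add: coords_def tvec_apply scaleR_sum_right)

lemma coords_sum: "coords \<phi> (tsum v I) = (\<Sum>i\<in>I. coords \<phi> (v i))"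
  by (simp add: coords_def tvec_apply scaleR_sum_left sum.swap[of _ Basis])

lemma coords_inject:
  assumes "(U, \<phi>) \<in> A" "p \<in> U" "v \<in> tangent_space A p" "w \<in> tangent_space A p" "coords \<phi> v = coords \<phi> w"
  shows "v = w"
  using assms by (intro tangent_eqI_coords) (auto simp: coords_inner[symmetric])

definition coord_vec :: "'a set \<Rightarrow> ('a \<Rightarrow> 'e) \<Rightarrow> 'a \<Rightarrow> 'e \<Rightarrow> 'a tvec" where
  "coord_vec U \<phi> p x =
     (\<lambda>f. if smooth_near A p f then frechet_derivative (f \<circ> inv_into U \<phi>) (at (\<phi> p)) x else 0)"

lemma chart_has_derivative:
  assumes "(U, \<phi>) \<in> A" "p \<in> U" "smooth_near A p f"
  shows "((f \<circ> inv_into U \<phi>) has_derivative frechet_derivative (f \<circ> inv_into U \<phi>) (at (\<phi> p))) (at (\<phi> p))"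
  using smooth_near_chartE[OF assms] smooth_on_has_derivative by metis

lemma coord_vec_eqI:
  assumes f: "smooth_near A p f" and "((f \<circ> inv_into U \<phi>) has_derivative f') (at (\<phi> p))"
  shows "coord_vec U \<phi> p x f = f' x"
  using assms frechet_derivative_at[OF assms(2)] by (simp add: coord_vec_def)

lemma coord_vec_tangent:
  assumes chart: "(U, \<phi>) \<in> A" "p \<in> U"
  shows "coord_vec U \<phi> p x \<in> tangent_space A p"
proof (rule tangentI)
  note D = chart_has_derivative[OF chart]
  show "coord_vec U \<phi> p x f = 0" if "\<not> smooth_near A p f" for f using that by (simp add: coord_vec_def)
  show "coord_vec U \<phi> p x (\<lambda>q. f q + h q) = coord_vec U \<phi> p x f + coord_vec U \<phi> p x h"
    if f: "smooth_near A p f" and h: "smooth_near A p h" for f h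
    using coord_vec_eqI[OF smooth_near_add[OF f h]] has_derivative_add[OF D[OF f] D[OF h]] f h
    by (simp add: coord_vec_def o_def)
  show "coord_vec U \<phi> p x (\<lambda>q. f q * h q) = f p * coord_vec U \<phi> p x h + h p * coord_vec U \<phi> p x f"
    if f: "smooth_near A p f" and h: "smooth_near A p h" for f h
    using coord_vec_eqI[OF smooth_near_mult[OF f h]] has_derivative_mult[OF D[OF f] D[OF h]] f h
    by (simp add: coord_vec_def o_def chart_inverse[OF chart] mult.commute)
  show "coord_vec U \<phi> p x (\<lambda>q. c * f q) = c * coord_vec U \<phi> p x f" if f: "smooth_near A p f" for f c
    using coord_vec_eqI[OF smooth_near_cmult[OF f]] has_derivative_mult_right[OF D[OF f], of c] f
    by (simp add: coord_vec_def o_def)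
qed

lemma coord_vec_coord:
  assumes chart: "(U, \<phi>) \<in> A" "p \<in> U"
  shows "coord_vec U \<phi> p x (\<lambda>q. \<phi> q \<bullet> b) = x \<bullet> b"
proof (rule coord_vec_eqI[OF smooth_near_coord[OF chart]])
  have "((\<lambda>y. y \<bullet> b) has_derivative (\<lambda>y. y \<bullet> b)) (at (\<phi> p))"
    by (rule bounded_linear_imp_has_derivative) (rule bounded_linear_inner_left)
  then show "((\<lambda>q. \<phi> q \<bullet> b) \<circ> inv_into U \<phi> has_derivative (\<lambda>y. y \<bullet> b)) (at (\<phi> p))"
    by (rule has_derivative_transform_within_open[OF _ open_chart_image[OF chart(1)]])
      (use chart chart_inverse[OF chart(1)] in auto)
qed

lemma coords_coord_vec: "(U, \<phi>) \<in> A \<Longrightarrow> p \<in> U \<Longrightarrow> coords \<phi> (coord_vec U \<phi> p x) = x"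
  by (rule euclidean_eqI) (simp add: coords_inner coord_vec_coord)

lemma coord_vec_coords:
  assumes "(U, \<phi>) \<in> A" "p \<in> U" "v \<in> tangent_space A p"
  shows "coord_vec U \<phi> p (coords \<phi> v) = v"
  by (rule coords_inject[OF assms(1,2) coord_vec_tangent[OF assms(1,2)] assms(3)])
    (rule coords_coord_vec[OF assms(1,2)])

lemma coord_vec_eq_sum:
  assumes "(U, \<phi>) \<in> A" "p \<in> U"
  shows "coord_vec U \<phi> p x f = (\<Sum>b\<in>Basis. (x \<bullet> b) * coord_vec U \<phi> p b f)"
proof (cases "smooth_near A p f")
  case True
  then show ?thesis
    using linear_eq_sum_Basis[OF has_derivative_linear[OF chart_has_derivative[OF assms True]], of x]
    by (simp add: coord_vec_def)
qed (simp add: coord_vec_def)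

lemma tangent_expand:
  assumes "(U, \<phi>) \<in> A" "p \<in> U" "v \<in> tangent_space A p"
  shows "v = tsum (\<lambda>b. tscale (v (\<lambda>q. \<phi> q \<bullet> b)) (coord_vec U \<phi> p b)) Basis"
proof
  fix f
  have "v f = coord_vec U \<phi> p (coords \<phi> v) f" using coord_vec_coords[OF assms] by simp
  also have "\<dots> = (\<Sum>b\<in>Basis. v (\<lambda>q. \<phi> q \<bullet> b) * coord_vec U \<phi> p b f)"
    by (subst coord_vec_eq_sum[OF assms(1,2)]) (simp add: coords_inner)
  finally show "v f = tsum (\<lambda>b. tscale (v (\<lambda>q. \<phi> q \<bullet> b)) (coord_vec U \<phi> p b)) Basis f"
    by (simp add: tvec_apply)
qed

lemma coord_vec_smooth:
  assumes chart: "(U, \<phi>) \<in> A" "p \<in> U" and f: "smooth_near A p f"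
  shows "smooth_near A p (\<lambda>q. coord_vec U \<phi> q x f)"
proof -
  obtain S where S: "open S" "\<phi> p \<in> S" "S \<subseteq> \<phi> ` U" "smooth_on S (f \<circ> inv_into U \<phi>)"
    using smooth_near_chartE[OF chart f] .
  have "smooth_near A p (\<lambda>q. frechet_derivative (f \<circ> inv_into U \<phi>) (at (\<phi> q)) x)"
    by (rule smooth_near_of_chart[OF chart S(1,2) smooth_on_frechet_derivative[OF S(4)]])
  moreover have "eventually (\<lambda>q. frechet_derivative (f \<circ> inv_into U \<phi>) (at (\<phi> q)) x = coord_vec U \<phi> q x f) (near p)"
    using smooth_near_eventually[OF f] by eventually_elim (simp add: coord_vec_def)
  ultimately show ?thesis by (rule smooth_near_cong)
qed

subsection \<open>Covectors\<close>

definition covector_at :: "'a \<Rightarrow> ('a tvec \<Rightarrow> real) \<Rightarrow> bool" where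
  "covector_at p F \<longleftrightarrow>
     (\<forall>x\<in>tangent_space A p. \<forall>y\<in>tangent_space A p. F (tadd x y) = F x + F y) \<and>
     (\<forall>x\<in>tangent_space A p. \<forall>c. F (tscale c x) = c * F x)"

lemma covector_atI:
  assumes "\<And>x y. x \<in> tangent_space A p \<Longrightarrow> y \<in> tangent_space A p \<Longrightarrow> F (tadd x y) = F x + F y"
    and "\<And>x c. x \<in> tangent_space A p \<Longrightarrow> F (tscale c x) = c * F x"
  shows "covector_at p F"
  using assms by (simp add: covector_at_def)

lemma covector_at_diff: "covector_at p F \<Longrightarrow> covector_at p G \<Longrightarrow> covector_at p (\<lambda>x. F x - G x)"
  by (simp add: covector_at_def algebra_simps)

context
  fixes p F assumes F: "covector_at p F"
begin

lemma covector_add: "x \<in> tangent_space A p \<Longrightarrow> y \<in> tangent_space A p \<Longrightarrow> F (tadd x y) = F x + F y"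
  using F by (simp add: covector_at_def)

lemma covector_scale: "x \<in> tangent_space A p \<Longrightarrow> F (tscale c x) = c * F x"
  using F by (simp add: covector_at_def)

lemma covector_zero: "F tzero = 0"
  using covector_scale[OF tzero_tangent, of 0] by (simp add: tscale_0)

lemma covector_diff: "x \<in> tangent_space A p \<Longrightarrow> y \<in> tangent_space A p \<Longrightarrow> F (tdiff x y) = F x - F y"
  by (simp add: tdiff_eq_tadd covector_add covector_scale tscale_tangent)

lemma covector_sum:
  assumes "finite I" "\<And>i. i \<in> I \<Longrightarrow> x i \<in> tangent_space A p"
  shows "F (tsum x I) = (\<Sum>i\<in>I. F (x i))"
  using assms
proof (induction I)
  case empty
  then show ?case using covector_zero by (simp add: tsum_def tzero_def)
next
  case (insert i I)
  then show ?case by (simp add: tsum_insert covector_add tsum_tangent)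
qed

lemma covector_combination:
  assumes "finite I" "\<And>i. i \<in> I \<Longrightarrow> x i \<in> tangent_space A p"
  shows "F (tsum (\<lambda>i. tscale (c i) (x i)) I) = (\<Sum>i\<in>I. c i * F (x i))"
  using assms by (simp add: covector_sum covector_scale tscale_tangent)

end

end

section \<open>Germs of vector fields\<close>

context atlas
begin

definition vfield_near :: "'a \<Rightarrow> 'a vfield \<Rightarrow> bool" where
  "vfield_near p X \<longleftrightarrow> (\<exists>U. p \<in> U \<and> vfield_on A U X)"

lemma vfield_on_imp_near: "vfield_on A U X \<Longrightarrow> p \<in> U \<Longrightarrow> vfield_near p X"
  by (auto simp: vfield_near_def)

lemma vfield_near_pts: "vfield_near p X \<Longrightarrow> p \<in> pts A"
  by (auto simp: vfield_near_def vfield_on_def intro: openin_pts)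

lemma vfield_near_tangent: "vfield_near p X \<Longrightarrow> X p \<in> tangent_space A p"
  by (auto simp: vfield_near_def vfield_on_def)

lemma vfield_near_smooth:
  assumes X: "vfield_near p X" and f: "smooth_near A p f"
  shows "smooth_near A p (\<lambda>q. X q f)"
proof -
  obtain U where U: "p \<in> U" "openin (mtop A) U"
    and X': "\<And>V f. V \<subseteq> U \<Longrightarrow> smooth_fun_on A V f \<Longrightarrow> smooth_fun_on A V (\<lambda>q. X q f)"
    using X unfolding vfield_near_def vfield_on_def by metis
  obtain W where W: "p \<in> W" "smooth_fun_on A W f" using f by (auto simp: smooth_near_def)
  have "smooth_fun_on A (U \<inter> W) f" using W U(2) by (auto simp: smooth_fun_on_iff)
  then have "smooth_fun_on A (U \<inter> W) (\<lambda>q. X q f)" by (rule X'[rotated]) simp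
  then show ?thesis using W(1) U(1) by (simp add: smooth_fun_on_iff)
qed

lemma vfield_on_iff: "vfield_on A U X \<longleftrightarrow> openin (mtop A) U \<and> (\<forall>p\<in>U. vfield_near p X)"
proof
  assume near: "openin (mtop A) U \<and> (\<forall>p\<in>U. vfield_near p X)"
  then show "vfield_on A U X"
    unfolding vfield_on_def smooth_fun_on_iff using vfield_near_tangent vfield_near_smooth by (simp add: subset_iff)
qed (auto simp: vfield_on_def intro: vfield_on_imp_near)

lemma vfield_near_eventually:
  assumes "vfield_near p X" shows "eventually (\<lambda>q. vfield_near q X) (near p)"
proof -
  obtain U where U: "p \<in> U" "vfield_on A U X" using assms by (auto simp: vfield_near_def)
  then have "eventually (\<lambda>q. q \<in> U) (near p)" by (intro eventually_near_in_open) (simp_all add: vfield_on_def)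
  then show ?thesis by eventually_elim (rule vfield_on_imp_near[OF U(2)])
qed

lemma vfield_near_eventually_tangent:
  assumes "vfield_near p X" shows "eventually (\<lambda>q. X q \<in> tangent_space A q) (near p)"
  using vfield_near_eventually[OF assms] by eventually_elim (rule vfield_near_tangent)

lemma common_domainE:
  assumes "p \<in> pts A" "finite \<X>" "\<forall>X\<in>\<X>. vfield_near p X" "finite F" "\<forall>f\<in>F. smooth_near A p f"
  obtains W where "p \<in> W" "openin (mtop A) W" "\<forall>X\<in>\<X>. vfield_on A W X" "\<forall>f\<in>F. smooth_fun_on A W f"
proof -
  have "eventually (\<lambda>q. (\<forall>X\<in>\<X>. vfield_near q X) \<and> (\<forall>f\<in>F. smooth_near A q f)) (near p)"
    using assms(3,5)
    by (intro eventually_conj eventually_ball_finite ballI assms(2,4) vfield_near_eventually smooth_near_eventually)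
      simp_all
  then obtain W where "openin (mtop A) W" "p \<in> W"
    "\<forall>q\<in>W. (\<forall>X\<in>\<X>. vfield_near q X) \<and> (\<forall>f\<in>F. smooth_near A q f)"
    using assms(1) by (elim eventually_nearE[rotated])
  then show ?thesis using that by (simp add: vfield_on_iff smooth_fun_on_iff)
qed

lemma vfield_nearI_coords:
  assumes chart: "(V, \<phi>) \<in> A" "p \<in> V" and tangent: "eventually (\<lambda>q. X q \<in> tangent_space A q) (near p)"
    and smooth: "\<And>b. b \<in> Basis \<Longrightarrow> smooth_near A p (\<lambda>q. X q (\<lambda>r. \<phi> r \<bullet> b))"
  shows "vfield_near p X"
proof -
  let ?coords_smooth = "\<lambda>q. q \<in> V \<and> X q \<in> tangent_space A q \<and> (\<forall>b\<in>Basis. smooth_near A q (\<lambda>r. X r (\<lambda>s. \<phi> s \<bullet> b)))"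
  have "eventually ?coords_smooth (near p)"
    using smooth by (intro eventually_conj eventually_near_in_open[OF openin_chart[OF chart(1)] chart(2)]
        tangent eventually_ball_finite ballI smooth_near_eventually) auto
  then obtain W where W: "openin (mtop A) W" "p \<in> W" "\<forall>q\<in>W. ?coords_smooth q"
    using chart_pts[OF chart] by (elim eventually_nearE[rotated])
  have "smooth_near A q (\<lambda>r. X r f)" if q: "q \<in> W" and f: "smooth_near A q f" for q f
  proof -
    have chart': "(V, \<phi>) \<in> A" "q \<in> V" using chart(1) W(3) q by auto
    have "smooth_near A q (\<lambda>r. \<Sum>b\<in>Basis. X r (\<lambda>s. \<phi> s \<bullet> b) * coord_vec V \<phi> r b f)"
      using W(3) q
      by (intro smooth_near_sum chart_pts[OF chart'] smooth_near_mult coord_vec_smooth[OF chart' f]) simp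
    moreover have "eventually (\<lambda>r. (\<Sum>b\<in>Basis. X r (\<lambda>s. \<phi> s \<bullet> b) * coord_vec V \<phi> r b f) = X r f) (near q)"
      using eventually_near_in_open[OF W(1) q]
    proof eventually_elim
      case (elim r)
      then have "r \<in> V" "X r \<in> tangent_space A r" using W(3) by auto
      from fun_cong[OF tangent_expand[OF chart(1) this], of f] show ?case by (simp add: tvec_apply)
    qed
    ultimately show ?thesis by (rule smooth_near_cong)
  qed
  then have "vfield_on A W X"
    using W unfolding vfield_on_def smooth_fun_on_iff by (simp add: subset_iff)
  then show ?thesis using W(2) by (rule vfield_on_imp_near)
qed

lemma vfield_nearI:
  assumes p: "p \<in> pts A" and "eventually (\<lambda>q. X q \<in> tangent_space A q) (near p)"
    and "\<And>f. smooth_near A p f \<Longrightarrow> smooth_near A p (\<lambda>q. X q f)"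
  shows "vfield_near p X"
proof -
  obtain V \<phi> where chart: "(V, \<phi>) \<in> A" "p \<in> V" using p by (rule pts_chartE)
  show ?thesis by (rule vfield_nearI_coords[OF chart assms(2) assms(3)[OF smooth_near_coord[OF chart]]])
qed

lemma vfield_near_cong:
  assumes X: "vfield_near p X" and eq: "eventually (\<lambda>q. X q = Y q) (near p)"
  shows "vfield_near p Y"
proof (rule vfield_nearI[OF vfield_near_pts[OF X]])
  show "eventually (\<lambda>q. Y q \<in> tangent_space A q) (near p)"
    using vfield_near_eventually_tangent[OF X] eq by eventually_elim simp
  fix f assume "smooth_near A p f"
  from vfield_near_smooth[OF X this] show "smooth_near A p (\<lambda>q. Y q f)"
    by (rule smooth_near_cong) (use eq in eventually_elim, simp)
qed

lemma vfield_near_zero: "p \<in> pts A \<Longrightarrow> vfield_near p (\<lambda>q. tzero)"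
  by (rule vfield_nearI) (simp_all add: tzero_tangent tzero_apply smooth_near_const)

lemma vfield_near_add:
  assumes X: "vfield_near p X" and Y: "vfield_near p Y"
  shows "vfield_near p (\<lambda>q. tadd (X q) (Y q))"
proof (rule vfield_nearI[OF vfield_near_pts[OF X]])
  show "eventually (\<lambda>q. tadd (X q) (Y q) \<in> tangent_space A q) (near p)"
    using vfield_near_eventually_tangent[OF X] vfield_near_eventually_tangent[OF Y]
    by eventually_elim (rule tadd_tangent)
qed (simp add: tadd_apply smooth_near_add vfield_near_smooth X Y)

lemma vfield_near_scale:
  assumes f: "smooth_near A p f" and X: "vfield_near p X"
  shows "vfield_near p (\<lambda>q. tscale (f q) (X q))"
proof (rule vfield_nearI[OF vfield_near_pts[OF X]])
  show "eventually (\<lambda>q. tscale (f q) (X q) \<in> tangent_space A q) (near p)"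
    using vfield_near_eventually_tangent[OF X] by eventually_elim (rule tscale_tangent)
qed (simp add: tscale_apply smooth_near_mult f vfield_near_smooth X)

lemma vfield_near_cscale: "vfield_near p X \<Longrightarrow> vfield_near p (\<lambda>q. tscale c (X q))"
  by (rule vfield_near_scale[OF smooth_near_const[OF vfield_near_pts]])

lemma vfield_near_diff:
  "vfield_near p X \<Longrightarrow> vfield_near p Y \<Longrightarrow> vfield_near p (\<lambda>q. tdiff (X q) (Y q))"
  unfolding tdiff_eq_tadd by (intro vfield_near_add vfield_near_cscale)

lemma vfield_near_sum:
  assumes "p \<in> pts A" "finite I" "\<And>i. i \<in> I \<Longrightarrow> vfield_near p (X i)"
  shows "vfield_near p (\<lambda>q. tsum (\<lambda>i. X i q) I)"
  using assms(2,3)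
proof (induction I)
  case empty
  then show ?case using vfield_near_zero[OF assms(1)] by (simp add: tsum_def tzero_def)
next
  case (insert i I)
  then show ?case by (simp add: tsum_insert vfield_near_add)
qed

lemma vfield_near_coord_vec:
  assumes "(V, \<phi>) \<in> A" "p \<in> V" shows "vfield_near p (\<lambda>q. coord_vec V \<phi> q x)"
proof (rule vfield_nearI[OF chart_pts[OF assms]])
  show "eventually (\<lambda>q. coord_vec V \<phi> q x \<in> tangent_space A q) (near p)"
    using eventually_near_in_open[OF openin_chart[OF assms(1)] assms(2)]
    by eventually_elim (rule coord_vec_tangent[OF assms(1)])
qed (rule coord_vec_smooth[OF assms])

definition extension :: "'a \<Rightarrow> 'a tvec \<Rightarrow> 'a vfield" where
  "extension p x = (SOME X. vfield_near p X \<and> X p = x)"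

lemma extension:
  assumes p: "p \<in> pts A" and x: "x \<in> tangent_space A p"
  shows extension_near: "vfield_near p (extension p x)" and extension_at: "extension p x p = x"
proof -
  obtain V \<phi> where chart: "(V, \<phi>) \<in> A" "p \<in> V" using p by (rule pts_chartE)
  have "\<exists>X. vfield_near p X \<and> X p = x"
    using vfield_near_coord_vec[OF chart] coord_vec_coords[OF chart x] by metis
  then have "vfield_near p (extension p x) \<and> extension p x p = x"
    unfolding extension_def by (rule someI_ex)
  then show "vfield_near p (extension p x)" "extension p x p = x" by simp_all
qed

lemma vfield_near_apply_cong:
  "vfield_near p X \<Longrightarrow> eventually (\<lambda>q. f q = h q) (near p) \<Longrightarrow> X p f = X p h"
  using tangent_cong vfield_near_tangent vfield_near_pts by blast

lemma vfield_near_apply_eventually_const: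
  "vfield_near p X \<Longrightarrow> eventually (\<lambda>q. f q = c) (near p) \<Longrightarrow> X p f = 0"
  using vfield_near_apply_cong[of p X f "\<lambda>q. c"] tangent_const[OF vfield_near_tangent vfield_near_pts] by simp

subsection \<open>Lie brackets\<close>

lemma lie_bracket_apply:
  "smooth_near A p f \<Longrightarrow> lie_bracket A X Y p f = X p (\<lambda>q. Y q f) - Y p (\<lambda>q. X q f)"
  by (simp add: lie_bracket_def)

context
  fixes p X Y assumes X: "vfield_near p X" and Y: "vfield_near p Y"
begin

lemma second_derivative_add:
  assumes f: "smooth_near A p f" and h: "smooth_near A p h"
  shows "X p (\<lambda>q. Y q (\<lambda>r. f r + h r)) = X p (\<lambda>q. Y q f) + X p (\<lambda>q. Y q h)"
proof -
  have "eventually (\<lambda>q. Y q (\<lambda>r. f r + h r) = Y q f + Y q h) (near p)"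
    using vfield_near_eventually_tangent[OF Y] smooth_near_eventually[OF f] smooth_near_eventually[OF h]
    by eventually_elim (rule tangent_add)
  from vfield_near_apply_cong[OF X this] show ?thesis
    using tangent_add[OF vfield_near_tangent[OF X] vfield_near_smooth[OF Y f] vfield_near_smooth[OF Y h]] by simp
qed

lemma second_derivative_scale:
  assumes f: "smooth_near A p f"
  shows "X p (\<lambda>q. Y q (\<lambda>r. c * f r)) = c * X p (\<lambda>q. Y q f)"
proof -
  have "eventually (\<lambda>q. Y q (\<lambda>r. c * f r) = c * Y q f) (near p)"
    using vfield_near_eventually_tangent[OF Y] smooth_near_eventually[OF f]
    by eventually_elim (rule tangent_scale)
  from vfield_near_apply_cong[OF X this] show ?thesis
    using tangent_scale[OF vfield_near_tangent[OF X] vfield_near_smooth[OF Y f]] by simp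
qed

lemma second_derivative_mult:
  assumes f: "smooth_near A p f" and h: "smooth_near A p h"
  shows "X p (\<lambda>q. Y q (\<lambda>r. f r * h r)) =
    f p * X p (\<lambda>q. Y q h) + X p f * Y p h + h p * X p (\<lambda>q. Y q f) + X p h * Y p f"
proof -
  note Xp = vfield_near_tangent[OF X] and Yf = vfield_near_smooth[OF Y f] and Yh = vfield_near_smooth[OF Y h]
  have "eventually (\<lambda>q. Y q (\<lambda>r. f r * h r) = f q * Y q h + h q * Y q f) (near p)"
    using vfield_near_eventually_tangent[OF Y] smooth_near_eventually[OF f] smooth_near_eventually[OF h]
    by eventually_elim (rule tangent_mult)
  from vfield_near_apply_cong[OF X this] show ?thesis
    using tangent_add[OF Xp smooth_near_mult[OF f Yh] smooth_near_mult[OF h Yf]]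
      tangent_mult[OF Xp f Yh] tangent_mult[OF Xp h Yf] by simp
qed

end

lemma bracket_tangent:
  assumes X: "vfield_near p X" and Y: "vfield_near p Y"
  shows "lie_bracket A X Y p \<in> tangent_space A p"
  by (rule tangentI)
    (simp_all add: lie_bracket_def smooth_near_add smooth_near_mult smooth_near_cmult algebra_simps
      second_derivative_add[OF X Y] second_derivative_add[OF Y X] second_derivative_mult[OF X Y]
      second_derivative_mult[OF Y X] second_derivative_scale[OF X Y] second_derivative_scale[OF Y X])

lemma vfield_near_bracket:
  assumes X: "vfield_near p X" and Y: "vfield_near p Y"
  shows "vfield_near p (lie_bracket A X Y)"
proof (rule vfield_nearI[OF vfield_near_pts[OF X]])
  show "eventually (\<lambda>q. lie_bracket A X Y q \<in> tangent_space A q) (near p)"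
    using vfield_near_eventually[OF X] vfield_near_eventually[OF Y] by eventually_elim (rule bracket_tangent)
  fix f assume f: "smooth_near A p f"
  have "smooth_near A p (\<lambda>q. X q (\<lambda>r. Y r f) - Y q (\<lambda>r. X r f))"
    by (rule smooth_near_diff[OF vfield_near_smooth[OF X vfield_near_smooth[OF Y f]]
          vfield_near_smooth[OF Y vfield_near_smooth[OF X f]]])
  moreover have "eventually (\<lambda>q. X q (\<lambda>r. Y r f) - Y q (\<lambda>r. X r f) = lie_bracket A X Y q f) (near p)"
    using smooth_near_eventually[OF f] by eventually_elim (simp add: lie_bracket_apply)
  ultimately show "smooth_near A p (\<lambda>q. lie_bracket A X Y q f)" by (rule smooth_near_cong)
qed

lemma bracket_antisym: "lie_bracket A X Y p = tscale (- 1) (lie_bracket A Y X p)"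
  by (auto simp: lie_bracket_def tvec_apply)

lemma bracket_add_right:
  assumes X: "vfield_near p X" and Y: "vfield_near p Y" and Z: "vfield_near p Z"
  shows "lie_bracket A X (\<lambda>q. tadd (Y q) (Z q)) p = tadd (lie_bracket A X Y p) (lie_bracket A X Z p)"
proof
  fix f
  show "lie_bracket A X (\<lambda>q. tadd (Y q) (Z q)) p f = tadd (lie_bracket A X Y p) (lie_bracket A X Z p) f"
    using tangent_add[OF vfield_near_tangent[OF X] vfield_near_smooth[OF Y] vfield_near_smooth[OF Z], of f f]
    by (simp add: lie_bracket_def tvec_apply)
qed

lemma bracket_scale_right:
  assumes X: "vfield_near p X" and Y: "vfield_near p Y" and f: "smooth_near A p f"
  shows "lie_bracket A X (\<lambda>q. tscale (f q) (Y q)) p =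
    tadd (tscale (X p f) (Y p)) (tscale (f p) (lie_bracket A X Y p))"
proof
  fix h
  show "lie_bracket A X (\<lambda>q. tscale (f q) (Y q)) p h =
    tadd (tscale (X p f) (Y p)) (tscale (f p) (lie_bracket A X Y p)) h"
    using tangent_mult[OF vfield_near_tangent[OF X] f vfield_near_smooth[OF Y], of h]
      tangent_not_smooth[OF vfield_near_tangent[OF Y], of h]
    by (cases "smooth_near A p h") (simp_all add: lie_bracket_def tvec_apply algebra_simps)
qed

lemma bracket_add_left:
  assumes "vfield_near p X" "vfield_near p Y" "vfield_near p Z"
  shows "lie_bracket A (\<lambda>q. tadd (X q) (Y q)) Z p = tadd (lie_bracket A X Z p) (lie_bracket A Y Z p)"
  unfolding bracket_antisym[of _ Z] bracket_add_right[OF assms(3,1,2)]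
  by (rule ext) (simp add: tvec_apply algebra_simps)

lemma bracket_scale_left:
  assumes "vfield_near p X" "vfield_near p Y" "smooth_near A p f"
  shows "lie_bracket A (\<lambda>q. tscale (f q) (X q)) Y p =
    tdiff (tscale (f p) (lie_bracket A X Y p)) (tscale (Y p f) (X p))"
  unfolding bracket_antisym[of _ Y] bracket_scale_right[OF assms(2,1,3)]
  by (rule ext) (simp add: tvec_apply algebra_simps)

end

section \<open>Tensoriality\<close>

context atlas
begin

definition tensorial_at :: "'a \<Rightarrow> ('a vfield \<Rightarrow> real) \<Rightarrow> bool" where
  "tensorial_at p B \<longleftrightarrow>
     (\<forall>X Y. vfield_near p X \<and> vfield_near p Y \<longrightarrow> B (\<lambda>q. tadd (X q) (Y q)) = B X + B Y) \<and>
     (\<forall>f X. smooth_near A p f \<and> vfield_near p X \<longrightarrow> B (\<lambda>q. tscale (f q) (X q)) = f p * B X)"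

lemma tensorialI:
  assumes "\<And>X Y. vfield_near p X \<Longrightarrow> vfield_near p Y \<Longrightarrow> B (\<lambda>q. tadd (X q) (Y q)) = B X + B Y"
    and "\<And>f X. smooth_near A p f \<Longrightarrow> vfield_near p X \<Longrightarrow> B (\<lambda>q. tscale (f q) (X q)) = f p * B X"
  shows "tensorial_at p B"
  using assms by (simp add: tensorial_at_def)

lemma tensorial_add:
  "tensorial_at p B \<Longrightarrow> vfield_near p X \<Longrightarrow> vfield_near p Y \<Longrightarrow> B (\<lambda>q. tadd (X q) (Y q)) = B X + B Y"
  by (simp add: tensorial_at_def)

lemma tensorial_scale:
  "tensorial_at p B \<Longrightarrow> smooth_near A p f \<Longrightarrow> vfield_near p X \<Longrightarrow> B (\<lambda>q. tscale (f q) (X q)) = f p * B X"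
  by (simp add: tensorial_at_def)

lemma tensorial_at_cong:
  assumes B: "tensorial_at p B" and eq: "\<And>X. vfield_near p X \<Longrightarrow> C X = B X"
  shows "tensorial_at p C"
proof (rule tensorialI)
  fix X assume X: "vfield_near p X"
  show "C (\<lambda>q. tadd (X q) (Y q)) = C X + C Y" if Y: "vfield_near p Y" for Y
    unfolding eq[OF vfield_near_add[OF X Y]] eq[OF X] eq[OF Y] by (rule tensorial_add[OF B X Y])
  show "C (\<lambda>q. tscale (f q) (X q)) = f p * C X" if f: "smooth_near A p f" for f
    unfolding eq[OF vfield_near_scale[OF f X]] eq[OF X] by (rule tensorial_scale[OF B f X])
qed

lemma tensorial_diff: "tensorial_at p B \<Longrightarrow> tensorial_at p C \<Longrightarrow> tensorial_at p (\<lambda>X. B X - C X)"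
  by (rule tensorialI) (simp_all add: tensorial_add tensorial_scale algebra_simps)

lemma tensorial_cmult: "tensorial_at p B \<Longrightarrow> tensorial_at p (\<lambda>X. c * B X)"
  by (rule tensorialI) (simp_all add: tensorial_add tensorial_scale algebra_simps)

lemma tensorial_eval:
  assumes F: "covector_at p F" shows "tensorial_at p (\<lambda>X. F (X p))"
  by (rule tensorialI) (simp_all add: covector_add[OF F] covector_scale[OF F] vfield_near_tangent)

lemma tensorial_covector:
  assumes F: "covector_at p F" and B: "\<And>f. tensorial_at p (\<lambda>X. B X f)"
    and tangent: "\<And>X. vfield_near p X \<Longrightarrow> B X \<in> tangent_space A p"
  shows "tensorial_at p (\<lambda>X. F (B X))"
proof (rule tensorialI)
  fix X Y assume X: "vfield_near p X" and Y: "vfield_near p Y"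
  have "B (\<lambda>q. tadd (X q) (Y q)) = tadd (B X) (B Y)"
    by (rule ext) (simp add: tvec_apply tensorial_add[OF B X Y])
  then show "F (B (\<lambda>q. tadd (X q) (Y q))) = F (B X) + F (B Y)"
    using covector_add[OF F tangent[OF X] tangent[OF Y]] by simp
next
  fix f X assume f: "smooth_near A p f" and X: "vfield_near p X"
  have "B (\<lambda>q. tscale (f q) (X q)) = tscale (f p) (B X)"
    by (rule ext) (simp add: tvec_apply tensorial_scale[OF B f X])
  then show "F (B (\<lambda>q. tscale (f q) (X q))) = f p * F (B X)"
    using covector_scale[OF F tangent[OF X]] by simp
qed

text \<open>Multiplying by the indicator function of an open set shows that tensorial maps are local.\<close>

lemma tensorial_cong:
  assumes B: "tensorial_at p B" and X: "vfield_near p X" and eq: "eventually (\<lambda>q. X q = Y q) (near p)"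
  shows "B X = B Y"
proof -
  obtain W where W: "openin (mtop A) W" "p \<in> W" "\<forall>q\<in>W. X q = Y q"
    using vfield_near_pts[OF X] eq by (rule eventually_nearE)
  note indicator = smooth_near_indicator[OF W(1,2)]
  have "(\<lambda>q. tscale (indicat_real W q) (X q)) = (\<lambda>q. tscale (indicat_real W q) (Y q))"
    using W(3) by (auto simp: indicator_def tscale_0)
  then show ?thesis
    using tensorial_scale[OF B indicator X] tensorial_scale[OF B indicator vfield_near_cong[OF X eq]] W(2) by simp
qed

lemma tensorial_sum:
  assumes B: "tensorial_at p B" and p: "p \<in> pts A"
    and "finite I" "\<And>i. i \<in> I \<Longrightarrow> vfield_near p (X i)"
  shows "B (\<lambda>q. tsum (\<lambda>i. X i q) I) = (\<Sum>i\<in>I. B (X i))"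
  using assms(3,4)
proof (induction I)
  case empty
  have "B (\<lambda>q. tscale 0 tzero) = 0 * B (\<lambda>q. tzero)"
    by (rule tensorial_scale[OF B smooth_near_const[OF p] vfield_near_zero[OF p]])
  then show ?case by (simp add: tsum_def tscale_0 tzero_def)
next
  case (insert i I)
  then have "B (\<lambda>q. tadd (X i q) (tsum (\<lambda>i. X i q) I)) = B (X i) + B (\<lambda>q. tsum (\<lambda>i. X i q) I)"
    by (intro tensorial_add[OF B] vfield_near_sum[OF p]) simp_all
  then show ?case using insert by (simp add: tsum_insert)
qed

lemma tensorial_coords:
  assumes B: "tensorial_at p B" and X: "vfield_near p X" and chart: "(V, \<phi>) \<in> A" "p \<in> V"
  shows "B X = (\<Sum>b\<in>Basis. X p (\<lambda>q. \<phi> q \<bullet> b) * B (\<lambda>q. coord_vec V \<phi> q b))"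
proof -
  note coord = vfield_near_coord_vec[OF chart]
    and coefficient = vfield_near_smooth[OF X smooth_near_coord[OF chart]]
  have "eventually (\<lambda>q. X q = tsum (\<lambda>b. tscale (X q (\<lambda>r. \<phi> r \<bullet> b)) (coord_vec V \<phi> q b)) Basis) (near p)"
    using vfield_near_eventually_tangent[OF X] eventually_near_in_open[OF openin_chart[OF chart(1)] chart(2)]
    by eventually_elim (rule tangent_expand[OF chart(1)])
  from tensorial_cong[OF B X this]
  have "B X = B (\<lambda>q. tsum (\<lambda>b. tscale (X q (\<lambda>r. \<phi> r \<bullet> b)) (coord_vec V \<phi> q b)) Basis)" .
  also have "\<dots> = (\<Sum>b\<in>Basis. B (\<lambda>q. tscale (X q (\<lambda>r. \<phi> r \<bullet> b)) (coord_vec V \<phi> q b)))"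
    by (rule tensorial_sum[OF B vfield_near_pts[OF X] finite_Basis vfield_near_scale[OF coefficient coord]])
  finally show ?thesis by (simp add: tensorial_scale[OF B coefficient coord])
qed

lemma tensorial_eq_at:
  assumes B: "tensorial_at p B" and X: "vfield_near p X" and Y: "vfield_near p Y" and eq: "X p = Y p"
  shows "B X = B Y"
proof -
  obtain V \<phi> where chart: "(V, \<phi>) \<in> A" "p \<in> V" using vfield_near_pts[OF X] by (rule pts_chartE)
  show ?thesis using tensorial_coords[OF B X chart] tensorial_coords[OF B Y chart] eq by simp
qed

lemma tensorial_extension:
  assumes "tensorial_at p B" "vfield_near p X"
  shows "B (extension p (X p)) = B X"
  using tensorial_eq_at[OF assms(1) extension_near assms(2) extension_at]
    vfield_near_pts[OF assms(2)] vfield_near_tangent[OF assms(2)] by simp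

lemma covector_extension:
  assumes B: "tensorial_at p B" and p: "p \<in> pts A"
  shows "covector_at p (\<lambda>x. B (extension p x))"
proof (rule covector_atI)
  note near = extension_near[OF p] and at = extension_at[OF p]
  fix x assume x: "x \<in> tangent_space A p"
  show "B (extension p (tadd x y)) = B (extension p x) + B (extension p y)" if y: "y \<in> tangent_space A p" for y
    using tensorial_extension[OF B vfield_near_add[OF near[OF x] near[OF y]]]
      tensorial_add[OF B near[OF x] near[OF y]] by (simp add: at x y)
  show "B (extension p (tscale c x)) = c * B (extension p x)" for c
    using tensorial_extension[OF B vfield_near_cscale[OF near[OF x]]]
      tensorial_scale[OF B smooth_near_const[OF p] near[OF x]] by (simp add: at x)
qed

lemma tensorial_combination:
  assumes B: "tensorial_at p B" and X: "vfield_near p X" and I: "finite I"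
    and Y: "\<And>i. i \<in> I \<Longrightarrow> vfield_near p (Y i)" and eq: "X p = tsum (\<lambda>i. tscale (c i) (Y i p)) I"
  shows "B X = (\<Sum>i\<in>I. c i * B (Y i))"
proof -
  note F = covector_extension[OF B vfield_near_pts[OF X]]
  have "B X = B (extension p (tsum (\<lambda>i. tscale (c i) (Y i p)) I))"
    using tensorial_extension[OF B X] eq by simp
  also have "\<dots> = (\<Sum>i\<in>I. c i * B (extension p (Y i p)))"
    by (rule covector_combination[OF F I vfield_near_tangent[OF Y]])
  also have "\<dots> = (\<Sum>i\<in>I. c i * B (Y i))"
    by (rule sum.cong[OF refl]) (simp add: tensorial_extension[OF B Y])
  finally show ?thesis .
qed

definition bitensorial_at :: "'a \<Rightarrow> ('a vfield \<Rightarrow> 'a vfield \<Rightarrow> real) \<Rightarrow> bool" where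
  "bitensorial_at p B \<longleftrightarrow>
     (\<forall>X. vfield_near p X \<longrightarrow> tensorial_at p (\<lambda>Y. B Y X) \<and> tensorial_at p (\<lambda>Y. B X Y))"

lemma bitensorialI:
  assumes "\<And>X. vfield_near p X \<Longrightarrow> tensorial_at p (\<lambda>Y. B Y X)"
    and "\<And>X. vfield_near p X \<Longrightarrow> tensorial_at p (\<lambda>Y. B X Y)"
  shows "bitensorial_at p B"
  using assms by (simp add: bitensorial_at_def)

lemma bitensorial_left: "bitensorial_at p B \<Longrightarrow> vfield_near p Y \<Longrightarrow> tensorial_at p (\<lambda>X. B X Y)"
  and bitensorial_right: "bitensorial_at p B \<Longrightarrow> vfield_near p X \<Longrightarrow> tensorial_at p (\<lambda>Y. B X Y)"
  by (simp_all add: bitensorial_at_def)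

lemma bitensorial_eq_at:
  assumes B: "bitensorial_at p B" and X: "vfield_near p X" "vfield_near p X'" "X p = X' p"
    and Y: "vfield_near p Y" "vfield_near p Y'" "Y p = Y' p"
  shows "B X Y = B X' Y'"
  using tensorial_eq_at[OF bitensorial_left[OF B Y(1)] X] tensorial_eq_at[OF bitensorial_right[OF B X(2)] Y] by simp

section \<open>Germs of differential forms\<close>

definition form1_near :: "'a \<Rightarrow> ('a \<Rightarrow> 'a tvec \<Rightarrow> real) \<Rightarrow> bool" where
  "form1_near p \<eta> \<longleftrightarrow> eventually (\<lambda>q. covector_at q (\<eta> q)) (near p) \<and>
     (\<forall>X. vfield_near p X \<longrightarrow> smooth_near A p (\<lambda>q. \<eta> q (X q)))"

lemma form1_nearI:
  assumes "\<And>q. q \<in> pts A \<Longrightarrow> covector_at q (\<eta> q)"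
    and "\<And>X. vfield_near p X \<Longrightarrow> smooth_near A p (\<lambda>q. \<eta> q (X q))"
  shows "form1_near p \<eta>"
  unfolding form1_near_def
proof (intro conjI allI impI)
  show "eventually (\<lambda>q. covector_at q (\<eta> q)) (near p)"
    using eventually_near_pts by (rule eventually_mono) (rule assms(1))
qed (rule assms(2))

lemma form1_near_covector: "form1_near p \<eta> \<Longrightarrow> p \<in> pts A \<Longrightarrow> covector_at p (\<eta> p)"
  using eventually_near_imp by (auto simp: form1_near_def)

lemma form1_near_smooth: "form1_near p \<eta> \<Longrightarrow> vfield_near p X \<Longrightarrow> smooth_near A p (\<lambda>q. \<eta> q (X q))"
  by (simp add: form1_near_def)

lemma form1_near_diff:
  assumes "form1_near p \<eta>" "form1_near p \<zeta>" shows "form1_near p (\<lambda>q x. \<eta> q x - \<zeta> q x)"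
  unfolding form1_near_def
proof (intro conjI allI impI)
  show "eventually (\<lambda>q. covector_at q (\<lambda>x. \<eta> q x - \<zeta> q x)) (near p)"
    using assms[unfolded form1_near_def, THEN conjunct1] by eventually_elim (rule covector_at_diff)
qed (rule smooth_near_diff[OF form1_near_smooth[OF assms(1)] form1_near_smooth[OF assms(2)]])

context
  fixes p \<eta> V assumes \<eta>: "form1_near p \<eta>" and V: "vfield_near p V"
begin

lemma form1_derivative_add:
  assumes X: "vfield_near p X" and Y: "vfield_near p Y"
  shows "V p (\<lambda>q. \<eta> q (tadd (X q) (Y q))) = V p (\<lambda>q. \<eta> q (X q)) + V p (\<lambda>q. \<eta> q (Y q))"
proof -
  have "eventually (\<lambda>q. \<eta> q (tadd (X q) (Y q)) = \<eta> q (X q) + \<eta> q (Y q)) (near p)"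
    using \<eta>[unfolded form1_near_def, THEN conjunct1]
      vfield_near_eventually_tangent[OF X] vfield_near_eventually_tangent[OF Y]
    by eventually_elim (rule covector_add)
  from vfield_near_apply_cong[OF V this] show ?thesis
    using tangent_add[OF vfield_near_tangent[OF V] form1_near_smooth[OF \<eta> X] form1_near_smooth[OF \<eta> Y]] by simp
qed

lemma form1_derivative_scale:
  assumes f: "smooth_near A p f" and X: "vfield_near p X"
  shows "V p (\<lambda>q. \<eta> q (tscale (f q) (X q))) = f p * V p (\<lambda>q. \<eta> q (X q)) + \<eta> p (X p) * V p f"
proof -
  have "eventually (\<lambda>q. \<eta> q (tscale (f q) (X q)) = f q * \<eta> q (X q)) (near p)"
    using \<eta>[unfolded form1_near_def, THEN conjunct1] vfield_near_eventually_tangent[OF X]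
    by eventually_elim (rule covector_scale)
  from vfield_near_apply_cong[OF V this] show ?thesis
    using tangent_mult[OF vfield_near_tangent[OF V] f form1_near_smooth[OF \<eta> X]] by simp
qed

end

lemma closed_form_iff:
  "closed_form A \<eta> \<longleftrightarrow> (\<forall>p X Y. vfield_near p X \<and> vfield_near p Y \<longrightarrow> ext_deriv A \<eta> X Y p = 0)"
proof
  assume closed: "closed_form A \<eta>"
  show "\<forall>p X Y. vfield_near p X \<and> vfield_near p Y \<longrightarrow> ext_deriv A \<eta> X Y p = 0"
  proof (intro allI impI, elim conjE)
    fix p X Y assume X: "vfield_near p X" and Y: "vfield_near p Y"
    obtain W where "p \<in> W" "openin (mtop A) W" "\<forall>Z\<in>{X, Y}. vfield_on A W Z"
      by (rule common_domainE[OF vfield_near_pts[OF X], of "{X, Y}" "{}"]) (use X Y in simp_all)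
    then show "ext_deriv A \<eta> X Y p = 0" using closed by (simp add: closed_form_def)
  qed
qed (simp add: closed_form_def vfield_on_iff)

lemma closed_form_cong:
  assumes eq: "form_eq A \<eta> \<zeta>" shows "closed_form A \<eta> \<longleftrightarrow> closed_form A \<zeta>"
proof -
  have "ext_deriv A \<eta> X Y p = ext_deriv A \<zeta> X Y p" if X: "vfield_near p X" and Y: "vfield_near p Y" for p X Y
  proof -
    have "eventually (\<lambda>q. \<eta> q (Z q) = \<zeta> q (Z q)) (near p)" if Z: "vfield_near p Z" for Z
      using eventually_near_pts vfield_near_eventually_tangent[OF Z]
      by eventually_elim (use eq in \<open>simp add: form_eq_def\<close>)
    from vfield_near_apply_cong[OF X this[OF Y]] vfield_near_apply_cong[OF Y this[OF X]] show ?thesis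
      using eq bracket_tangent[OF X Y] vfield_near_pts[OF X] by (simp add: ext_deriv_def form_eq_def)
  qed
  then show ?thesis by (simp add: closed_form_iff)
qed

lemma ext_deriv_diff:
  assumes \<eta>: "form1_near p \<eta>" and \<zeta>: "form1_near p \<zeta>" and X: "vfield_near p X" and Y: "vfield_near p Y"
  shows "ext_deriv A (\<lambda>q x. \<eta> q x - \<zeta> q x) X Y p = ext_deriv A \<eta> X Y p - ext_deriv A \<zeta> X Y p"
  unfolding ext_deriv_def
    tangent_diff[OF vfield_near_tangent[OF X] form1_near_smooth[OF \<eta> Y] form1_near_smooth[OF \<zeta> Y]]
    tangent_diff[OF vfield_near_tangent[OF Y] form1_near_smooth[OF \<eta> X] form1_near_smooth[OF \<zeta> X]]
  by simp

lemma ext_deriv_antisym: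
  assumes \<eta>: "form1_near p \<eta>" and X: "vfield_near p X" and Y: "vfield_near p Y"
  shows "ext_deriv A \<eta> X Y p = - ext_deriv A \<eta> Y X p"
  unfolding ext_deriv_def bracket_antisym[of X Y p]
    covector_scale[OF form1_near_covector[OF \<eta> vfield_near_pts[OF X]] bracket_tangent[OF Y X]] by simp

lemma ext_deriv_tensorial_left:
  assumes \<eta>: "form1_near p \<eta>" and Y: "vfield_near p Y"
  shows "tensorial_at p (\<lambda>X. ext_deriv A \<eta> X Y p)"
proof (rule tensorialI)
  note F = form1_near_covector[OF \<eta> vfield_near_pts[OF Y]]
  fix X assume X: "vfield_near p X"
  show "ext_deriv A \<eta> (\<lambda>q. tadd (X q) (X' q)) Y p = ext_deriv A \<eta> X Y p + ext_deriv A \<eta> X' Y p"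
    if X': "vfield_near p X'" for X'
    unfolding ext_deriv_def bracket_add_left[OF X X' Y] form1_derivative_add[OF \<eta> Y X X']
      covector_add[OF F bracket_tangent[OF X Y] bracket_tangent[OF X' Y]] tadd_apply by simp
  show "ext_deriv A \<eta> (\<lambda>q. tscale (f q) (X q)) Y p = f p * ext_deriv A \<eta> X Y p"
    if f: "smooth_near A p f" for f
    unfolding ext_deriv_def bracket_scale_left[OF X Y f] form1_derivative_scale[OF \<eta> Y f X]
    using bracket_tangent[OF X Y] vfield_near_tangent[OF X]
    by (simp add: tscale_apply[of _ _ "\<lambda>q. \<eta> q (Y q)"] covector_diff[OF F]
        covector_scale[OF F] tscale_tangent algebra_simps)
qed

lemma ext_deriv_bitensorial:
  assumes \<eta>: "form1_near p \<eta>" shows "bitensorial_at p (\<lambda>X Y. ext_deriv A \<eta> X Y p)"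
proof (rule bitensorialI)
  fix X assume X: "vfield_near p X"
  show "tensorial_at p (\<lambda>Y. ext_deriv A \<eta> Y X p)" by (rule ext_deriv_tensorial_left[OF \<eta> X])
  from tensorial_cmult[OF this, of "- 1"] show "tensorial_at p (\<lambda>Y. ext_deriv A \<eta> X Y p)"
    by (rule tensorial_at_cong) (simp add: ext_deriv_antisym[OF \<eta> X])
qed

subsection \<open>Pullback of one-forms\<close>

definition related_near ::
    "('b, 'f::euclidean_space) chart set \<Rightarrow> ('a \<Rightarrow> 'b) \<Rightarrow> 'a \<Rightarrow> 'a vfield \<Rightarrow> 'b vfield \<Rightarrow> bool" where
  "related_near B \<Phi> p X Y \<longleftrightarrow> eventually (\<lambda>q. differential B \<Phi> q (X q) = Y (\<Phi> q)) (near p)"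

context
  fixes B :: "('b, 'f::euclidean_space) chart set" and \<Phi> :: "'a \<Rightarrow> 'b" and p
  assumes B: "atlas B" and \<Phi>: "smooth_map_at A B \<Phi> p"
begin

interpretation B: atlas B by (rule B)

lemma related_near_apply:
  assumes X: "vfield_near p X" and rel: "related_near B \<Phi> p X Y" and f: "smooth_near B (\<Phi> p) f"
  shows "X p (\<lambda>q. f (\<Phi> q)) = Y (\<Phi> p) f"
proof -
  have "differential B \<Phi> p (X p) = Y (\<Phi> p)"
    using eventually_near_imp[OF vfield_near_pts[OF X] rel[unfolded related_near_def]] .
  then show ?thesis using differential_apply[where \<Phi> = \<Phi>, OF f, of "X p"] by simp
qed

lemma related_near_apply_eventually:
  assumes rel: "related_near B \<Phi> p X Y" and f: "smooth_near B (\<Phi> p) f"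
  shows "eventually (\<lambda>q. X q (\<lambda>r. f (\<Phi> r)) = Y (\<Phi> q) f) (near p)"
  using rel[unfolded related_near_def]
    smooth_map_at_eventually[OF B \<Phi> B.smooth_near_pts[OF f] B.smooth_near_eventually[OF f]]
proof eventually_elim
  case (elim q)
  show ?case using differential_apply[where \<Phi> = \<Phi>, OF elim(2), of "X q"] elim(1) by simp
qed

context
  fixes X X' Y Y'
  assumes X: "vfield_near p X" "vfield_near p X'" and Y: "B.vfield_near (\<Phi> p) Y" "B.vfield_near (\<Phi> p) Y'"
    and related: "related_near B \<Phi> p X Y" "related_near B \<Phi> p X' Y'"
begin

lemma differential_bracket:
  "differential B \<Phi> p (lie_bracket A X X' p) = lie_bracket B Y Y' (\<Phi> p)"
proof (rule B.tangent_ext[OF differential_tangent[OF B \<Phi> bracket_tangent[OF X]] B.bracket_tangent[OF Y]])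
  fix f assume f: "smooth_near B (\<Phi> p) f"
  have "X p (\<lambda>q. X' q (\<lambda>r. f (\<Phi> r))) = Y (\<Phi> p) (\<lambda>q. Y' q f)"
    using vfield_near_apply_cong[OF X(1) related_near_apply_eventually[OF related(2) f]]
      related_near_apply[OF X(1) related(1) B.vfield_near_smooth[OF Y(2) f]] by simp
  moreover have "X' p (\<lambda>q. X q (\<lambda>r. f (\<Phi> r))) = Y' (\<Phi> p) (\<lambda>q. Y q f)"
    using vfield_near_apply_cong[OF X(2) related_near_apply_eventually[OF related(1) f]]
      related_near_apply[OF X(2) related(2) B.vfield_near_smooth[OF Y(1) f]] by simp
  ultimately show "differential B \<Phi> p (lie_bracket A X X' p) f = lie_bracket B Y Y' (\<Phi> p) f"
    by (simp add: differential_apply[where \<Phi> = \<Phi>, OF f] lie_bracket_apply[OF smooth_map_atD[OF \<Phi> f]]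
        B.lie_bracket_apply[OF f])
qed

lemma ext_deriv_pullback:
  assumes \<eta>: "B.form1_near (\<Phi> p) \<eta>"
  shows "ext_deriv A (pullback_form B \<Phi> \<eta>) X X' p = ext_deriv B \<eta> Y Y' (\<Phi> p)"
proof -
  have derivative: "Z p (\<lambda>q. pullback_form B \<Phi> \<eta> q (Z' q)) = V (\<Phi> p) (\<lambda>q. \<eta> q (V' q))"
    if "vfield_near p Z" "B.vfield_near (\<Phi> p) V'" "related_near B \<Phi> p Z V" "related_near B \<Phi> p Z' V'"
    for Z Z' V V'
  proof -
    have "eventually (\<lambda>q. pullback_form B \<Phi> \<eta> q (Z' q) = \<eta> (\<Phi> q) (V' (\<Phi> q))) (near p)"
      using that(4)[unfolded related_near_def] by eventually_elim (simp add: pullback_form_def)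
    from vfield_near_apply_cong[OF that(1) this] show ?thesis
      using related_near_apply[OF that(1,3) B.form1_near_smooth[OF \<eta> that(2)]] by simp
  qed
  have "pullback_form B \<Phi> \<eta> p (lie_bracket A X X' p) = \<eta> (\<Phi> p) (lie_bracket B Y Y' (\<Phi> p))"
    by (simp add: pullback_form_def differential_bracket)
  then show ?thesis
    unfolding ext_deriv_def derivative[OF X(1) Y(2) related] derivative[OF X(2) Y(1) related(2,1)] by simp
qed

end

end

end

section \<open>Connections\<close>

context atlas
begin

lemma tensorial_apply: "tensorial_at p (\<lambda>X. X p f)"
  by (rule tensorialI) (simp_all add: tvec_apply)

context
  fixes D assumes D: "connection A D"
begin

lemma connection_near:
  assumes X: "vfield_near p X" and Y: "vfield_near p Y" shows "vfield_near p (D X Y)"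
proof -
  obtain W where "p \<in> W" "\<forall>Z\<in>{X, Y}. vfield_on A W Z"
    by (rule common_domainE[OF vfield_near_pts[OF X], of "{X, Y}" "{}"]) (use X Y in simp_all)
  then show ?thesis using D unfolding connection_def by (meson insertCI vfield_on_imp_near)
qed

lemma connection_tangent: "vfield_near p X \<Longrightarrow> vfield_near p Y \<Longrightarrow> D X Y p \<in> tangent_space A p"
  by (rule vfield_near_tangent[OF connection_near])

lemma connection_add_left:
  assumes X: "vfield_near p X" and X': "vfield_near p X'" and Y: "vfield_near p Y"
  shows "D (\<lambda>q. tadd (X q) (X' q)) Y p = tadd (D X Y p) (D X' Y p)"
proof -
  obtain W where "p \<in> W" "\<forall>Z\<in>{X, X', Y}. vfield_on A W Z"
    by (rule common_domainE[OF vfield_near_pts[OF X], of "{X, X', Y}" "{}"]) (use X X' Y in simp_all)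
  then show ?thesis using D unfolding connection_def by (meson insertCI)
qed

lemma connection_scale_left:
  assumes f: "smooth_near A p f" and X: "vfield_near p X" and Y: "vfield_near p Y"
  shows "D (\<lambda>q. tscale (f q) (X q)) Y p = tscale (f p) (D X Y p)"
proof -
  obtain W where "p \<in> W" "\<forall>Z\<in>{X, Y}. vfield_on A W Z" "\<forall>h\<in>{f}. smooth_fun_on A W h"
    by (rule common_domainE[OF vfield_near_pts[OF X], of "{X, Y}" "{f}"]) (use X Y f in simp_all)
  then show ?thesis using D unfolding connection_def by (meson insertCI)
qed

lemma connection_add_right:
  assumes X: "vfield_near p X" and Y: "vfield_near p Y" and Y': "vfield_near p Y'"
  shows "D X (\<lambda>q. tadd (Y q) (Y' q)) p = tadd (D X Y p) (D X Y' p)"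
proof -
  obtain W where "p \<in> W" "\<forall>Z\<in>{X, Y, Y'}. vfield_on A W Z"
    by (rule common_domainE[OF vfield_near_pts[OF X], of "{X, Y, Y'}" "{}"]) (use X Y Y' in simp_all)
  then show ?thesis using D unfolding connection_def by (meson insertCI)
qed

lemma connection_scale_right:
  assumes f: "smooth_near A p f" and X: "vfield_near p X" and Y: "vfield_near p Y"
  shows "D X (\<lambda>q. tscale (f q) (Y q)) p = tadd (tscale (X p f) (Y p)) (tscale (f p) (D X Y p))"
proof -
  obtain W where "p \<in> W" "\<forall>Z\<in>{X, Y}. vfield_on A W Z" "\<forall>h\<in>{f}. smooth_fun_on A W h"
    by (rule common_domainE[OF vfield_near_pts[OF X], of "{X, Y}" "{f}"]) (use X Y f in simp_all)
  then show ?thesis using D unfolding connection_def by (meson insertCI)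
qed

lemma connection_cscale_right:
  assumes X: "vfield_near p X" and Y: "vfield_near p Y"
  shows "D X (\<lambda>q. tscale c (Y q)) p = tscale c (D X Y p)"
  using connection_scale_right[OF smooth_near_const[OF vfield_near_pts[OF X]] X Y, of c]
    tangent_const[OF vfield_near_tangent[OF X] vfield_near_pts[OF X], of c]
  by (auto simp: tvec_apply)

lemma connection_tensorial: "vfield_near p Y \<Longrightarrow> tensorial_at p (\<lambda>X. D X Y p f)"
  by (rule tensorialI) (simp_all add: connection_add_left connection_scale_left tvec_apply)

lemma connection_zero_left:
  assumes X: "vfield_near p X" and Y: "vfield_near p Y" and zero: "X p = tzero"
  shows "D X Y p = tzero"
proof
  fix f
  have "D X Y p f = 0"
    using tensorial_combination[OF connection_tensorial[OF Y] X, of "{}" "\<lambda>_. X"] zero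
    by (simp add: tsum_def tzero_def)
  then show "D X Y p f = tzero f" by (simp add: tvec_apply)
qed

text \<open>Again by the Leibniz rule for an indicator function.\<close>

lemma connection_cong_right:
  assumes X: "vfield_near p X" and Y: "vfield_near p Y" and eq: "eventually (\<lambda>q. Y q = Y' q) (near p)"
  shows "D X Y p = D X Y' p"
proof -
  obtain W where W: "openin (mtop A) W" "p \<in> W" "\<forall>q\<in>W. Y q = Y' q"
    using vfield_near_pts[OF X] eq by (rule eventually_nearE)
  note indicator = smooth_near_indicator[OF W(1,2)]
  have "eventually (\<lambda>q. indicat_real W q = 1) (near p)"
    using eventually_near_in_open[OF W(1,2)] by eventually_elim simp
  from vfield_near_apply_eventually_const[OF X this] have "X p (indicat_real W) = 0" .
  then have cutoff: "D X (\<lambda>q. tscale (indicat_real W q) (Z q)) p = D X Z p" if "vfield_near p Z" for Z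
    using connection_scale_right[OF indicator X that] W(2) by (simp add: tvec_apply fun_eq_iff)
  have "(\<lambda>q. tscale (indicat_real W q) (Y q)) = (\<lambda>q. tscale (indicat_real W q) (Y' q))"
    using W(3) by (auto simp: indicator_def tscale_0)
  then show ?thesis using cutoff[OF Y] cutoff[OF vfield_near_cong[OF Y eq]] by simp
qed

lemma connection_zero_right:
  assumes "vfield_near p X" shows "D X (\<lambda>q. tzero) p = tzero"
  using connection_cscale_right[OF assms vfield_near_zero[OF vfield_near_pts[OF assms]], of 0]
  by (simp add: tscale_0)

lemma connection_combination_right:
  assumes X: "vfield_near p X" and "finite I"
    and f: "\<And>i. i \<in> I \<Longrightarrow> smooth_near A p (f i)" and Y: "\<And>i. i \<in> I \<Longrightarrow> vfield_near p (Y i)"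
  shows "D X (\<lambda>q. tsum (\<lambda>i. tscale (f i q) (Y i q)) I) p =
    tsum (\<lambda>i. tadd (tscale (X p (f i)) (Y i p)) (tscale (f i p) (D X (Y i) p))) I"
  using assms(2-4)
proof (induction I)
  case empty
  then show ?case using connection_zero_right[OF X] by (simp add: tsum_def tzero_def)
next
  case (insert i I)
  have "vfield_near p (\<lambda>q. tscale (f i q) (Y i q))"
    "vfield_near p (\<lambda>q. tsum (\<lambda>i. tscale (f i q) (Y i q)) I)"
    using insert by (intro vfield_near_sum vfield_near_scale vfield_near_pts[OF X]; simp)+
  from connection_add_right[OF X this] show ?case
    using insert connection_scale_right[OF _ X, of "f i" "Y i"] by (simp add: tsum_insert)
qed

end

lemma connection_diff_tensorial_right:
  assumes D: "connection A D" and D': "connection A D'" and X: "vfield_near p X"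
  shows "tensorial_at p (\<lambda>Y. D X Y p f - D' X Y p f)"
  by (rule tensorialI)
    (simp_all add: connection_add_right[OF D X] connection_add_right[OF D' X]
      connection_scale_right[OF D _ X] connection_scale_right[OF D' _ X] tvec_apply algebra_simps)

lemma connectionI:
  assumes "\<And>p X Y. vfield_near p X \<Longrightarrow> vfield_near p Y \<Longrightarrow> vfield_near p (D X Y)"
    and "\<And>p X X' Y. vfield_near p X \<Longrightarrow> vfield_near p X' \<Longrightarrow> vfield_near p Y \<Longrightarrow>
      D (\<lambda>q. tadd (X q) (X' q)) Y p = tadd (D X Y p) (D X' Y p)"
    and "\<And>p f X Y. smooth_near A p f \<Longrightarrow> vfield_near p X \<Longrightarrow> vfield_near p Y \<Longrightarrow>
      D (\<lambda>q. tscale (f q) (X q)) Y p = tscale (f p) (D X Y p)"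
    and "\<And>p X Y Y'. vfield_near p X \<Longrightarrow> vfield_near p Y \<Longrightarrow> vfield_near p Y' \<Longrightarrow>
      D X (\<lambda>q. tadd (Y q) (Y' q)) p = tadd (D X Y p) (D X Y' p)"
    and "\<And>p f X Y. smooth_near A p f \<Longrightarrow> vfield_near p X \<Longrightarrow> vfield_near p Y \<Longrightarrow>
      D X (\<lambda>q. tscale (f q) (Y q)) p = tadd (tscale (X p f) (Y p)) (tscale (f p) (D X Y p))"
  shows "connection A D"
  using assms unfolding connection_def by (simp add: vfield_on_iff smooth_fun_on_iff)

lemma torsion_free_iff:
  "torsion_free A D \<longleftrightarrow>
    (\<forall>p X Y. vfield_near p X \<and> vfield_near p Y \<longrightarrow> tdiff (D X Y p) (D Y X p) = lie_bracket A X Y p)"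
proof
  assume torsion_free: "torsion_free A D"
  show "\<forall>p X Y. vfield_near p X \<and> vfield_near p Y \<longrightarrow> tdiff (D X Y p) (D Y X p) = lie_bracket A X Y p"
  proof (intro allI impI, elim conjE)
    fix p X Y assume X: "vfield_near p X" and Y: "vfield_near p Y"
    obtain W where "p \<in> W" "\<forall>Z\<in>{X, Y}. vfield_on A W Z"
      by (rule common_domainE[OF vfield_near_pts[OF X], of "{X, Y}" "{}"]) (use X Y in simp_all)
    then show "tdiff (D X Y p) (D Y X p) = lie_bracket A X Y p"
      using torsion_free by (simp add: torsion_free_def)
  qed
qed (simp add: torsion_free_def vfield_on_iff)

lemma torsion_free_bracket:
  "torsion_free A D \<Longrightarrow> vfield_near p X \<Longrightarrow> vfield_near p Y \<Longrightarrow>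
    tdiff (D X Y p) (D Y X p) = lie_bracket A X Y p"
  by (simp add: torsion_free_iff)

lemma flat_commute:
  assumes flat: "flat A D" and X: "vfield_near p X" and Y: "vfield_near p Y" and Z: "vfield_near p Z"
  shows "tdiff (D X (D Y Z) p) (D Y (D X Z) p) = D (lie_bracket A X Y) Z p"
proof -
  obtain W where "p \<in> W" "\<forall>V\<in>{X, Y, Z}. vfield_on A W V"
    by (rule common_domainE[OF vfield_near_pts[OF X], of "{X, Y, Z}" "{}"]) (use X Y Z in simp_all)
  then have "tdiff (tdiff (D X (D Y Z) p) (D Y (D X Z) p)) (D (lie_bracket A X Y) Z p) = tzero"
    using flat by (simp add: flat_def)
  then show ?thesis by (simp only: tdiff_eq_tzero_iff)
qed

section \<open>Covariant derivatives of two-forms\<close>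

definition form2_near :: "'a \<Rightarrow> ('a \<Rightarrow> 'a tvec \<Rightarrow> 'a tvec \<Rightarrow> real) \<Rightarrow> bool" where
  "form2_near p w \<longleftrightarrow> (\<forall>Z. vfield_near p Z \<longrightarrow>
     form1_near p (\<lambda>q x. w q x (Z q)) \<and> form1_near p (\<lambda>q x. w q (Z q) x))"

lemma form2_near_left: "form2_near p w \<Longrightarrow> vfield_near p Z \<Longrightarrow> form1_near p (\<lambda>q x. w q x (Z q))"
  and form2_near_right: "form2_near p w \<Longrightarrow> vfield_near p Z \<Longrightarrow> form1_near p (\<lambda>q x. w q (Z q) x)"
  by (simp_all add: form2_near_def)

lemma form2_near_swap: "form2_near p w \<Longrightarrow> form2_near p (\<lambda>q x y. w q y x)"
  by (simp add: form2_near_def)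

lemma form2_nearI:
  assumes "\<And>q z. q \<in> pts A \<Longrightarrow> z \<in> tangent_space A q \<Longrightarrow> covector_at q (\<lambda>x. w q x z)"
    and "\<And>q z. q \<in> pts A \<Longrightarrow> z \<in> tangent_space A q \<Longrightarrow> covector_at q (\<lambda>x. w q z x)"
    and smooth: "\<And>X Y. vfield_near p X \<Longrightarrow> vfield_near p Y \<Longrightarrow> smooth_near A p (\<lambda>q. w q (X q) (Y q))"
  shows "form2_near p w"
  unfolding form2_near_def form1_near_def
proof (intro allI impI conjI)
  fix Z assume Z: "vfield_near p Z"
  note Z_near = vfield_near_eventually[OF Z]
  show "eventually (\<lambda>q. covector_at q (\<lambda>x. w q x (Z q))) (near p)"
    using Z_near by eventually_elim (intro assms(1) vfield_near_pts vfield_near_tangent)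
  show "eventually (\<lambda>q. covector_at q (\<lambda>x. w q (Z q) x)) (near p)"
    using Z_near by eventually_elim (intro assms(2) vfield_near_pts vfield_near_tangent)
  fix X assume "vfield_near p X"
  with Z show "smooth_near A p (\<lambda>q. w q (X q) (Z q))" "smooth_near A p (\<lambda>q. w q (Z q) (X q))"
    by (simp_all add: smooth)
qed

context
  fixes D w p assumes D: "connection A D" and w: "form2_near p w"
begin

lemma cov_deriv_tensorial_direction:
  assumes X: "vfield_near p X" and Y: "vfield_near p Y"
  shows "tensorial_at p (\<lambda>Z. cov_deriv_form2 D w Z X Y p)"
proof -
  have "covector_at p (\<lambda>x. w p x (Y p))"
    by (rule form1_near_covector[OF form2_near_left[OF w Y] vfield_near_pts[OF Y]])
  from tensorial_covector[where B = "\<lambda>Z. D Z X p", OF this connection_tensorial[OF D X]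
      connection_tangent[OF D _ X]]
  have "tensorial_at p (\<lambda>Z. w p (D Z X p) (Y p))" by simp
  moreover
  have "covector_at p (\<lambda>y. w p (X p) y)"
    by (rule form1_near_covector[OF form2_near_right[OF w X] vfield_near_pts[OF X]])
  from tensorial_covector[where B = "\<lambda>Z. D Z Y p", OF this connection_tensorial[OF D Y]
      connection_tangent[OF D _ Y]]
  have "tensorial_at p (\<lambda>Z. w p (X p) (D Z Y p))" by simp
  ultimately show ?thesis
    unfolding cov_deriv_form2_def by (intro tensorial_diff[OF tensorial_diff] tensorial_apply)
qed

lemma cov_deriv_tensorial_left:
  assumes Z: "vfield_near p Z" and Y: "vfield_near p Y"
  shows "tensorial_at p (\<lambda>X. cov_deriv_form2 D w Z X Y p)"
proof (rule tensorialI)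
  note wY = form2_near_left[OF w Y]
  note wYp = form1_near_covector[OF wY vfield_near_pts[OF Y]]
    form1_near_covector[OF form2_near_left[OF w connection_near[OF D Z Y]] vfield_near_pts[OF Y]]
  fix X assume X: "vfield_near p X"
  note ZX = connection_tangent[OF D Z X]
  show "cov_deriv_form2 D w Z (\<lambda>q. tadd (X q) (X' q)) Y p =
      cov_deriv_form2 D w Z X Y p + cov_deriv_form2 D w Z X' Y p"
    if X': "vfield_near p X'" for X'
    unfolding cov_deriv_form2_def connection_add_right[OF D Z X X'] form1_derivative_add[OF wY Z X X']
    by (simp add: covector_add[OF wYp(1)] covector_add[OF wYp(2)] ZX
        connection_tangent[OF D Z X'] vfield_near_tangent X X')
  show "cov_deriv_form2 D w Z (\<lambda>q. tscale (f q) (X q)) Y p = f p * cov_deriv_form2 D w Z X Y p"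
    if f: "smooth_near A p f" for f
    unfolding cov_deriv_form2_def connection_scale_right[OF D f Z X] form1_derivative_scale[OF wY Z f X]
    by (simp add: covector_add[OF wYp(1)] covector_scale[OF wYp(1)] covector_scale[OF wYp(2)] ZX
        vfield_near_tangent X tscale_tangent algebra_simps)
qed

end

lemma cov_deriv_tensorial_right:
  assumes D: "connection A D" and w: "form2_near p w" and Z: "vfield_near p Z" and X: "vfield_near p X"
  shows "tensorial_at p (\<lambda>Y. cov_deriv_form2 D w Z X Y p)"
  using cov_deriv_tensorial_left[OF D form2_near_swap[OF w] Z X]
  by (rule tensorial_at_cong) (simp add: cov_deriv_form2_def)

lemma cov_deriv_bitensorial:
  assumes D: "connection A D" and w: "form2_near p w" and Y: "vfield_near p Y"
  shows "bitensorial_at p (\<lambda>Z X. cov_deriv_form2 D w Z X Y p)"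
  using cov_deriv_tensorial_direction[OF D w _ Y] cov_deriv_tensorial_left[OF D w _ Y] by (rule bitensorialI)

end

section \<open>The tangent bundle as a manifold\<close>

context atlas
begin

definition tangent_over :: "'a set \<Rightarrow> 'a tpoint set" where
  "tangent_over W = {u. fst u \<in> W \<and> snd u \<in> tangent_space A (fst u)}"

definition bundle_coords :: "('a \<Rightarrow> 'e) \<Rightarrow> 'a tpoint \<Rightarrow> 'e \<times> 'e" where
  "bundle_coords \<phi> u = (\<phi> (fst u), coords \<phi> (snd u))"

abbreviation TB :: "('a tpoint, 'e \<times> 'e) chart set" where
  "TB \<equiv> tangent_bundle A"

lemma tangent_over_iff: "u \<in> tangent_over W \<longleftrightarrow> fst u \<in> W \<and> snd u \<in> tangent_space A (fst u)"
  by (simp add: tangent_over_def)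

lemma tangent_over_Int: "tangent_over U \<inter> tangent_over V = tangent_over (U \<inter> V)"
  by (auto simp: tangent_over_iff)

lemma tangent_chart_eq: "tangent_chart A (U, \<phi>) = (tangent_over U, bundle_coords \<phi>)"
  by (auto simp: tangent_chart_def tangent_over_def bundle_coords_def coords_def)

lemma bundle_chart: "(U, \<phi>) \<in> A \<Longrightarrow> (tangent_over U, bundle_coords \<phi>) \<in> TB"
  unfolding tangent_bundle_def tangent_chart_eq[symmetric] by (rule imageI)

lemma bundle_chartE:
  assumes "(T, \<Phi>) \<in> TB"
  obtains U \<phi> where "(U, \<phi>) \<in> A" "T = tangent_over U" "\<Phi> = bundle_coords \<phi>"
proof -
  obtain c where c: "c \<in> A" "(T, \<Phi>) = tangent_chart A c" using assms unfolding tangent_bundle_def by (rule imageE)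
  obtain U \<phi> where "c = (U, \<phi>)" by (cases c)
  with c that show ?thesis by (simp add: tangent_chart_eq)
qed

context
  fixes U \<phi> assumes chart: "(U, \<phi>) \<in> A"
begin

lemma bundle_coords_inj_on: "inj_on (bundle_coords \<phi>) (tangent_over U)"
proof (rule inj_onI)
  fix u w assume u: "u \<in> tangent_over U" and w: "w \<in> tangent_over U" and eq: "bundle_coords \<phi> u = bundle_coords \<phi> w"
  have fst_eq: "fst u = fst w"
    using inj_onD[OF chart_inj_on[OF chart]] u w eq by (simp add: tangent_over_iff bundle_coords_def)
  moreover have "snd u = snd w"
    by (rule coords_inject[OF chart, of "fst u"])
      (use u w eq fst_eq in \<open>simp_all add: tangent_over_iff bundle_coords_def\<close>)
  ultimately show "u = w" by (rule prod_eqI)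
qed

lemma coord_vec_in_tangent_over: "p \<in> U \<Longrightarrow> (p, coord_vec U \<phi> p y) \<in> tangent_over U"
  by (simp add: tangent_over_iff coord_vec_tangent[OF chart])

lemma bundle_coords_coord_vec: "p \<in> U \<Longrightarrow> bundle_coords \<phi> (p, coord_vec U \<phi> p y) = (\<phi> p, y)"
  by (simp add: bundle_coords_def coords_coord_vec[OF chart])

lemma bundle_coords_inverse:
  assumes "p \<in> U" shows "inv_into (tangent_over U) (bundle_coords \<phi>) (\<phi> p, y) = (p, coord_vec U \<phi> p y)"
  using inv_into_f_f[OF bundle_coords_inj_on coord_vec_in_tangent_over[OF assms]]
  by (simp only: bundle_coords_coord_vec[OF assms])

lemma bundle_coords_image:
  assumes W: "W \<subseteq> U" shows "bundle_coords \<phi> ` tangent_over W = \<phi> ` W \<times> UNIV"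
proof
  show "bundle_coords \<phi> ` tangent_over W \<subseteq> \<phi> ` W \<times> UNIV" by (auto simp: bundle_coords_def tangent_over_iff)
  show "\<phi> ` W \<times> UNIV \<subseteq> bundle_coords \<phi> ` tangent_over W"
  proof clarify
    fix p y assume "p \<in> W"
    then have "p \<in> U" "(p, coord_vec U \<phi> p y) \<in> tangent_over W"
      using W coord_vec_tangent[OF chart] by (auto simp: tangent_over_iff)
    then show "(\<phi> p, y) \<in> bundle_coords \<phi> ` tangent_over W"
      by (intro image_eqI[of _ _ "(p, coord_vec U \<phi> p y)"]) (simp_all add: bundle_coords_coord_vec)
  qed
qed

end

text \<open>A change of bundle charts acts on the fibres by the derivative of the change of base charts.\<close>

lemma smooth_on_bundle_transition:
  assumes chart: "(U, \<phi>) \<in> A" and chart': "(V, \<psi>) \<in> A"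
  shows "smooth_on (\<phi> ` (U \<inter> V) \<times> UNIV) (bundle_coords \<psi> \<circ> inv_into (tangent_over U) (bundle_coords \<phi>))"
proof -
  let ?S = "\<phi> ` (U \<inter> V)" and ?t = "\<psi> \<circ> inv_into U \<phi>"
  let ?k = "\<lambda>b. (\<lambda>q. \<psi> q \<bullet> b) \<circ> inv_into U \<phi>"
  have S: "open ?S" "open (?S \<times> (UNIV :: 'e set))"
    using open_overlap_image[OF chart chart'] by (simp_all add: open_Times)
  have "smooth_on ?S (\<lambda>x. ?t x \<bullet> b)" for b
    by (rule smooth_on_bilinear[OF bounded_bilinear_inner S(1) smooth_on_transition[OF chart chart']
        smooth_on_const[OF S(1)]])
  then have k: "smooth_on ?S (?k b)" for b by (simp add: o_def)
  have base: "smooth_on (?S \<times> (UNIV :: 'e set)) (\<lambda>z. h (fst z))" if "smooth_on ?S h"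
    for h :: "'e \<Rightarrow> 'z::real_normed_vector"
    by (rule smooth_on_compose[OF S(2,1) _ _ that]) (auto intro: smooth_on_linear[OF S(2)] bounded_linear_fst)
  have "smooth_on (?S \<times> (UNIV :: 'e set)) (\<lambda>z. (?t (fst z),
      \<Sum>b\<in>Basis. (\<Sum>c\<in>Basis. (snd z \<bullet> c) * frechet_derivative (?k b) (at (fst z)) c) *\<^sub>R b))"
    by (intro smooth_on_Pair smooth_on_sum smooth_on_bilinear[OF bounded_bilinear_scaleR] S smooth_on_const
        smooth_on_bilinear[OF bounded_bilinear_mult] base smooth_on_transition[OF chart chart']
        smooth_on_frechet_derivative k smooth_on_bilinear[OF bounded_bilinear_inner]
        smooth_on_linear[OF S(2) bounded_linear_snd])
  then show ?thesis
  proof (rule smooth_on_cong[OF S(2)])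
    fix z assume "z \<in> ?S \<times> (UNIV :: 'e set)"
    then obtain p y where z: "z = (\<phi> p, y)" "p \<in> U" "p \<in> V" by auto
    have "coord_vec U \<phi> p y (\<lambda>q. \<psi> q \<bullet> b) = (\<Sum>c\<in>Basis. (y \<bullet> c) * frechet_derivative (?k b) (at (\<phi> p)) c)" for b
      by (subst coord_vec_eq_sum[OF chart z(2)]) (simp add: coord_vec_def smooth_near_coord[OF chart' z(3)])
    then show "(?t (fst z), \<Sum>b\<in>Basis. (\<Sum>c\<in>Basis. (snd z \<bullet> c) * frechet_derivative (?k b) (at (fst z)) c) *\<^sub>R b) =
       (bundle_coords \<psi> \<circ> inv_into (tangent_over U) (bundle_coords \<phi>)) z"
      unfolding z(1) o_apply bundle_coords_inverse[OF chart z(2)]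
      using chart_inverse[OF chart z(2)] by (simp add: bundle_coords_def coords_def)
  qed
qed

lemma smooth_atlas_tangent_bundle: "smooth_atlas TB"
  unfolding smooth_atlas_def
proof (intro conjI ballI; clarify)
  fix T \<Phi> assume "(T, \<Phi>) \<in> TB"
  then obtain U \<phi> where chart: "(U, \<phi>) \<in> A" "T = tangent_over U" "\<Phi> = bundle_coords \<phi>" by (rule bundle_chartE)
  show "inj_on \<Phi> T \<and> open (\<Phi> ` T)"
    using bundle_coords_inj_on[OF chart(1)] bundle_coords_image[OF chart(1) order_refl]
      open_chart_image[OF chart(1)]
    by (simp add: chart open_Times)
  fix T' \<Psi> assume "(T', \<Psi>) \<in> TB"
  then obtain V \<psi> where chart': "(V, \<psi>) \<in> A" "T' = tangent_over V" "\<Psi> = bundle_coords \<psi>" by (rule bundle_chartE)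
  have "\<Phi> ` (T \<inter> T') = \<phi> ` (U \<inter> V) \<times> UNIV"
    using bundle_coords_image[OF chart(1), of "U \<inter> V"] by (simp add: chart chart' tangent_over_Int)
  then show "open (\<Phi> ` (T \<inter> T')) \<and> smooth_on (\<Phi> ` (T \<inter> T')) (\<Psi> \<circ> inv_into T \<Phi>)"
    using smooth_on_bundle_transition[OF chart(1) chart'(1)] open_overlap_image[OF chart(1) chart'(1)]
    by (simp add: chart chart' open_Times)
qed

interpretation TM: atlas TB
  by unfold_locales (rule smooth_atlas_tangent_bundle)

lemma pts_tangent_bundle_iff: "u \<in> pts TB \<longleftrightarrow> fst u \<in> pts A \<and> snd u \<in> tangent_space A (fst u)"
proof
  assume "u \<in> pts TB"
  then obtain T \<Phi> where T: "(T, \<Phi>) \<in> TB" "u \<in> T" by (rule TM.pts_chartE)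
  from T(1) obtain U \<phi> where "(U, \<phi>) \<in> A" "T = tangent_over U" by (rule bundle_chartE)
  with T(2) show "fst u \<in> pts A \<and> snd u \<in> tangent_space A (fst u)" by (auto simp: tangent_over_iff chart_pts)
next
  assume u: "fst u \<in> pts A \<and> snd u \<in> tangent_space A (fst u)"
  then obtain U \<phi> where "(U, \<phi>) \<in> A" "fst u \<in> U" by (blast elim: pts_chartE)
  then show "u \<in> pts TB" using u by (intro TM.chart_pts[OF bundle_chart]) (simp_all add: tangent_over_iff)
qed

lemma pts_tangent_bundle_chartE:
  assumes "u \<in> pts TB" obtains U \<phi> where "(U, \<phi>) \<in> A" "fst u \<in> U" "u \<in> tangent_over U"
  using assms by (auto simp: pts_tangent_bundle_iff tangent_over_iff elim: pts_chartE)

lemma eventually_in_tangent_over: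
  "(U, \<phi>) \<in> A \<Longrightarrow> u \<in> tangent_over U \<Longrightarrow> eventually (\<lambda>w. w \<in> tangent_over U) (TM.near u)"
  by (rule TM.eventually_near_in_open[OF TM.openin_chart[OF bundle_chart]])

lemma smooth_near_bundle_coord:
  assumes "(U, \<phi>) \<in> A" "u \<in> tangent_over U" "b \<in> Basis"
  shows "smooth_near TB u (\<lambda>w. \<phi> (fst w) \<bullet> b)" and "smooth_near TB u (\<lambda>w. snd w (\<lambda>q. \<phi> q \<bullet> b))"
  using TM.smooth_near_coord[OF bundle_chart[OF assms(1)] assms(2), of "(b, 0)"]
    TM.smooth_near_coord[OF bundle_chart[OF assms(1)] assms(2), of "(0, b)"]
  by (simp_all add: bundle_coords_def coords_inner assms(3))

lemma smooth_map_at_base: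
  assumes u: "u \<in> pts TB" shows "smooth_map_at TB A fst u"
proof -
  obtain U \<phi> where chart: "(U, \<phi>) \<in> A" "fst u \<in> U" and u_over: "u \<in> tangent_over U"
    using u by (rule pts_tangent_bundle_chartE)
  have "eventually (\<lambda>w. fst w \<in> U) (TM.near u)"
    using eventually_in_tangent_over[OF chart(1) u_over] by eventually_elim (simp add: tangent_over_iff)
  then show ?thesis
    by (rule TM.smooth_map_at_chartI[where \<Phi> = fst, OF atlas_axioms chart u])
      (rule smooth_near_bundle_coord(1)[OF chart(1) u_over])
qed

lemma smooth_near_base: "u \<in> pts TB \<Longrightarrow> smooth_near A (fst u) f \<Longrightarrow> smooth_near TB u (\<lambda>w. f (fst w))"
  by (rule TM.smooth_map_atD[where \<Phi> = fst, OF smooth_map_at_base])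

lemma eventually_near_base:
  "u \<in> pts TB \<Longrightarrow> eventually P (near (fst u)) \<Longrightarrow> eventually (\<lambda>w. P (fst w)) (TM.near u)"
  by (rule TM.smooth_map_at_eventually[where \<Phi> = fst, OF atlas_axioms smooth_map_at_base])
    (simp_all add: pts_tangent_bundle_iff)

text \<open>A function \<open>f\<close> on the base induces the functions \<open>\<lambda>w. f (fst w)\<close> and \<open>\<lambda>w. snd w f\<close> on the tangent
  bundle; tangent vectors and vector fields on the tangent bundle are tested on these.\<close>

lemma smooth_near_fibre:
  assumes u: "u \<in> pts TB" and f: "smooth_near A (fst u) f"
  shows "smooth_near TB u (\<lambda>w. snd w f)"
proof -
  obtain U \<phi> where chart: "(U, \<phi>) \<in> A" "fst u \<in> U" and u_over: "u \<in> tangent_over U"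
    using u by (rule pts_tangent_bundle_chartE)
  have "smooth_near TB u (\<lambda>w. \<Sum>b\<in>Basis. snd w (\<lambda>q. \<phi> q \<bullet> b) * coord_vec U \<phi> (fst w) b f)"
    by (intro TM.smooth_near_sum[OF u] TM.smooth_near_mult smooth_near_bundle_coord(2)[OF chart(1) u_over]
        smooth_near_base[OF u coord_vec_smooth[OF chart f]])
  moreover have "eventually (\<lambda>w. (\<Sum>b\<in>Basis. snd w (\<lambda>q. \<phi> q \<bullet> b) * coord_vec U \<phi> (fst w) b f) = snd w f) (TM.near u)"
    using eventually_in_tangent_over[OF chart(1) u_over]
  proof eventually_elim
    case (elim w)
    then have "fst w \<in> U" "snd w \<in> tangent_space A (fst w)" by (simp_all add: tangent_over_iff)
    from fun_cong[OF tangent_expand[OF chart(1) this], of f] show ?case by (simp add: tvec_apply)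
  qed
  ultimately show ?thesis by (rule TM.smooth_near_cong)
qed

lemma bundle_Basis_cases:
  assumes "b \<in> (Basis :: ('e \<times> 'e) set)"
  obtains b' where "b' \<in> Basis" "\<And>\<phi>. (\<lambda>w. bundle_coords \<phi> w \<bullet> b) = (\<lambda>w. \<phi> (fst w) \<bullet> b')"
  | b' where "b' \<in> Basis" "\<And>\<phi>. (\<lambda>w. bundle_coords \<phi> w \<bullet> b) = (\<lambda>w. snd w (\<lambda>q. \<phi> q \<bullet> b'))"
  using assms by (auto simp: Basis_prod_def bundle_coords_def coords_inner)

lemma bundle_tangent_eqI:
  assumes u: "u \<in> pts TB" and x: "x \<in> tangent_space TB u" and y: "y \<in> tangent_space TB u"
    and base: "\<And>f. smooth_near A (fst u) f \<Longrightarrow> x (\<lambda>w. f (fst w)) = y (\<lambda>w. f (fst w))"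
    and fibre: "\<And>f. smooth_near A (fst u) f \<Longrightarrow> x (\<lambda>w. snd w f) = y (\<lambda>w. snd w f)"
  shows "x = y"
proof -
  obtain U \<phi> where chart: "(U, \<phi>) \<in> A" "fst u \<in> U" and u_over: "u \<in> tangent_over U"
    using u by (rule pts_tangent_bundle_chartE)
  show ?thesis
  proof (rule TM.tangent_eqI_coords[OF x y bundle_chart[OF chart(1)] u_over])
    fix b :: "'e \<times> 'e" assume "b \<in> Basis"
    then show "x (\<lambda>w. bundle_coords \<phi> w \<bullet> b) = y (\<lambda>w. bundle_coords \<phi> w \<bullet> b)"
      by (cases rule: bundle_Basis_cases)
        (simp_all add: base[OF smooth_near_coord[OF chart]] fibre[OF smooth_near_coord[OF chart]])
  qed
qed

lemma bundle_vfield_nearI: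
  assumes u: "u \<in> pts TB" and tangent: "eventually (\<lambda>w. W w \<in> tangent_space TB w) (TM.near u)"
    and base: "\<And>f. smooth_near A (fst u) f \<Longrightarrow> smooth_near TB u (\<lambda>w. W w (\<lambda>w. f (fst w)))"
    and fibre: "\<And>f. smooth_near A (fst u) f \<Longrightarrow> smooth_near TB u (\<lambda>w. W w (\<lambda>w. snd w f))"
  shows "TM.vfield_near u W"
proof -
  obtain U \<phi> where chart: "(U, \<phi>) \<in> A" "fst u \<in> U" and u_over: "u \<in> tangent_over U"
    using u by (rule pts_tangent_bundle_chartE)
  show ?thesis
  proof (rule TM.vfield_nearI_coords[OF bundle_chart[OF chart(1)] u_over tangent])
    fix b :: "'e \<times> 'e" assume "b \<in> Basis"
    then show "smooth_near TB u (\<lambda>w. W w (\<lambda>w. bundle_coords \<phi> w \<bullet> b))"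
      by (cases rule: bundle_Basis_cases)
        (simp_all add: base[OF smooth_near_coord[OF chart]] fibre[OF smooth_near_coord[OF chart]])
  qed
qed

lemma section_pts: "vfield_near p Y \<Longrightarrow> (p, Y p) \<in> pts TB"
  by (simp add: pts_tangent_bundle_iff vfield_near_pts vfield_near_tangent)

lemma smooth_map_at_section:
  assumes Y: "vfield_near p Y" shows "smooth_map_at A TB (\<lambda>q. (q, Y q)) p"
proof -
  obtain U \<phi> where chart: "(U, \<phi>) \<in> A" "p \<in> U" using vfield_near_pts[OF Y] by (rule pts_chartE)
  have over: "(p, Y p) \<in> tangent_over U" using chart vfield_near_tangent[OF Y] by (simp add: tangent_over_iff)
  have "eventually (\<lambda>q. (q, Y q) \<in> tangent_over U) (near p)"
    using eventually_near_in_open[OF openin_chart[OF chart(1)] chart(2)] vfield_near_eventually_tangent[OF Y]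
    by eventually_elim (simp add: tangent_over_iff)
  then show ?thesis
  proof (rule smooth_map_at_chartI[where \<Phi> = "\<lambda>q. (q, Y q)",
        OF TM.atlas_axioms bundle_chart[OF chart(1)] over vfield_near_pts[OF Y]])
    fix b :: "'e \<times> 'e" assume "b \<in> Basis"
    then consider b' where "b' \<in> Basis" "b = (b', 0)" | b' where "b' \<in> Basis" "b = (0, b')"
      by (auto simp: Basis_prod_def)
    then show "smooth_near A p (\<lambda>q. bundle_coords \<phi> (q, Y q) \<bullet> b)"
      by cases (simp_all add: bundle_coords_def coords_inner smooth_near_coord[OF chart] vfield_near_smooth[OF Y])
  qed
qed

end

section \<open>Vertical lifts\<close>

context atlas
begin

interpretation TM: atlas TB
  by unfold_locales (rule smooth_atlas_tangent_bundle)

abbreviation vlift :: "'a tpoint \<Rightarrow> 'a tvec \<Rightarrow> 'a tpoint tvec" where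
  "vlift \<equiv> vertical_lift A"

lemma vlift_eq_coord_vec:
  assumes chart: "(U, \<phi>) \<in> A" and u: "u \<in> tangent_over U" and x: "x \<in> tangent_space A (fst u)"
  shows "vlift u x = TM.coord_vec (tangent_over U) (bundle_coords \<phi>) u (0, coords \<phi> x)"
proof
  fix F
  show "vlift u x F = TM.coord_vec (tangent_over U) (bundle_coords \<phi>) u (0, coords \<phi> x) F"
  proof (cases "smooth_near TB u F")
    case True
    let ?k = "F \<circ> inv_into (tangent_over U) (bundle_coords \<phi>)"
    have "F (fst u, tadd (snd u) (tscale t x)) = ?k (bundle_coords \<phi> u + t *\<^sub>R (0, coords \<phi> x))" for t
    proof -
      have over: "(fst u, tadd (snd u) (tscale t x)) \<in> tangent_over U"
        using u x by (simp add: tangent_over_iff tadd_tangent tscale_tangent)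
      have "bundle_coords \<phi> u + t *\<^sub>R (0, coords \<phi> x) = bundle_coords \<phi> (fst u, tadd (snd u) (tscale t x))"
        by (simp add: bundle_coords_def coords_add coords_scale)
      then show ?thesis using TM.chart_inverse[OF bundle_chart[OF chart] over] by simp
    qed
    then show ?thesis
      using True
        deriv_along_line[OF TM.chart_has_derivative[OF bundle_chart[OF chart] u True], of "(0, coords \<phi> x)"]
      by (simp add: vertical_lift_def TM.coord_vec_def)
  qed (simp add: vertical_lift_def TM.coord_vec_def)
qed

context
  fixes u assumes u: "u \<in> pts TB"
begin

lemma vlift_tangent:
  assumes x: "x \<in> tangent_space A (fst u)" shows "vlift u x \<in> tangent_space TB u"
proof -
  obtain U \<phi> where chart: "(U, \<phi>) \<in> A" and u_over: "u \<in> tangent_over U" using u by (rule pts_tangent_bundle_chartE)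
  show ?thesis
    unfolding vlift_eq_coord_vec[OF chart u_over x] by (rule TM.coord_vec_tangent[OF bundle_chart[OF chart] u_over])
qed

lemma vlift_base: "vlift u x (\<lambda>w. f (fst w)) = 0"
  by (simp add: vertical_lift_def)

lemma vlift_covector:
  assumes F: "covector_at (fst u) F" and smooth: "smooth_near TB u G" and x: "x \<in> tangent_space A (fst u)"
    and G: "\<And>y. y \<in> tangent_space A (fst u) \<Longrightarrow> G (fst u, y) = F y"
  shows "vlift u x G = F x"
proof -
  have "snd u \<in> tangent_space A (fst u)" using u by (simp add: pts_tangent_bundle_iff)
  then have "(\<lambda>t. G (fst u, tadd (snd u) (tscale t x))) = (\<lambda>t. F (snd u) + t * F x)"
    using x by (simp add: G tadd_tangent tscale_tangent covector_add[OF F] covector_scale[OF F])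
  moreover have "((\<lambda>t. F (snd u) + t * F x) has_field_derivative F x) (at 0)" by (auto intro!: derivative_eq_intros)
  ultimately show ?thesis using smooth by (simp add: vertical_lift_def DERIV_imp_deriv)
qed

lemma vlift_fibre:
  assumes "x \<in> tangent_space A (fst u)" "smooth_near A (fst u) f" shows "vlift u x (\<lambda>w. snd w f) = x f"
  by (rule vlift_covector[where F = "\<lambda>y. y f", OF _ smooth_near_fibre[OF u assms(2)] assms(1)])
    (simp_all add: covector_at_def tvec_apply)

end

end

section \<open>Horizontal lifts\<close>

locale affine_connection = atlas A
  for A :: "('a, 'e::euclidean_space) chart set" +
  fixes nab :: "'a vfield \<Rightarrow> 'a vfield \<Rightarrow> 'a vfield"
  assumes connection_nab: "connection A nab"
begin

sublocale TM: atlas TB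
  by unfold_locales (rule smooth_atlas_tangent_bundle)

lemmas nab_near = connection_near[OF connection_nab]
lemmas nab_tangent = connection_tangent[OF connection_nab]

subsection \<open>The Hessian of a function\<close>

text \<open>The guard keeps \<open>hessian f p\<close> bilinear also at points near which \<open>f\<close> is not smooth.\<close>

definition hessian :: "('a \<Rightarrow> real) \<Rightarrow> 'a \<Rightarrow> 'a tvec \<Rightarrow> 'a tvec \<Rightarrow> real" where
  "hessian f p x y = (if smooth_near A p f
     then extension p x p (\<lambda>q. extension p y q f) - nab (extension p x) (extension p y) p f else 0)"

lemma second_derivative_bitensorial:
  assumes f: "smooth_near A p f"
  shows "bitensorial_at p (\<lambda>X Y. X p (\<lambda>q. Y q f) - nab X Y p f)"
proof (rule bitensorialI)
  fix X assume X: "vfield_near p X"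
  note Xp = vfield_near_tangent[OF X] and smooth = vfield_near_smooth[OF _ f]
  show "tensorial_at p (\<lambda>Y. Y p (\<lambda>q. X q f) - nab Y X p f)"
    by (rule tensorial_diff[OF tensorial_apply connection_tensorial[OF connection_nab X]])
  show "tensorial_at p (\<lambda>Y. X p (\<lambda>q. Y q f) - nab X Y p f)"
  proof (rule tensorialI)
    fix Y assume Y: "vfield_near p Y"
    show "X p (\<lambda>q. tadd (Y q) (Z q) f) - nab X (\<lambda>q. tadd (Y q) (Z q)) p f =
        X p (\<lambda>q. Y q f) - nab X Y p f + (X p (\<lambda>q. Z q f) - nab X Z p f)" if Z: "vfield_near p Z" for Z
      unfolding connection_add_right[OF connection_nab X Y Z] tadd_apply
        tangent_add[OF Xp smooth[OF Y] smooth[OF Z]]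
      by simp
    show "X p (\<lambda>q. tscale (h q) (Y q) f) - nab X (\<lambda>q. tscale (h q) (Y q)) p f =
        h p * (X p (\<lambda>q. Y q f) - nab X Y p f)" if h: "smooth_near A p h" for h
      unfolding connection_scale_right[OF connection_nab h X Y] tadd_apply tscale_apply
        tangent_mult[OF Xp h smooth[OF Y]]
      by (simp add: algebra_simps)
  qed
qed

lemma hessian_vfields:
  assumes X: "vfield_near p X" and Y: "vfield_near p Y" and f: "smooth_near A p f"
  shows "hessian f p (X p) (Y p) = X p (\<lambda>q. Y q f) - nab X Y p f"
proof -
  note p = vfield_near_pts[OF X] and Xp = vfield_near_tangent[OF X] and Yp = vfield_near_tangent[OF Y]
  show ?thesis
    using bitensorial_eq_at[OF second_derivative_bitensorial[OF f] extension_near[OF p Xp] X extension_at[OF p Xp]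
        extension_near[OF p Yp] Y extension_at[OF p Yp]] f
    by (simp add: hessian_def)
qed

lemma covector_hessian:
  assumes p: "p \<in> pts A" and z: "z \<in> tangent_space A p"
  shows covector_hessian_left: "covector_at p (\<lambda>x. hessian f p x z)"
    and covector_hessian_right: "covector_at p (\<lambda>x. hessian f p z x)"
proof -
  note Z = extension_near[OF p z]
  have "covector_at p (\<lambda>x. hessian f p x z) \<and> covector_at p (\<lambda>x. hessian f p z x)"
  proof (cases "smooth_near A p f")
    case True
    show ?thesis
      using covector_extension[OF bitensorial_left[OF second_derivative_bitensorial[OF True] Z] p]
        covector_extension[OF bitensorial_right[OF second_derivative_bitensorial[OF True] Z] p] True
      by (simp add: hessian_def)
  qed (simp add: hessian_def covector_at_def)
  then show "covector_at p (\<lambda>x. hessian f p x z)" "covector_at p (\<lambda>x. hessian f p z x)" by simp_all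
qed

lemma form2_near_hessian:
  assumes f: "smooth_near A p f" shows "form2_near p (hessian f)"
proof (rule form2_nearI[OF covector_hessian])
  fix X Y assume X: "vfield_near p X" and Y: "vfield_near p Y"
  have "smooth_near A p (\<lambda>q. X q (\<lambda>r. Y r f) - nab X Y q f)"
    by (intro smooth_near_diff vfield_near_smooth[OF X] vfield_near_smooth[OF Y]
        vfield_near_smooth[OF nab_near[OF X Y]] f)
  moreover have "eventually (\<lambda>q. X q (\<lambda>r. Y r f) - nab X Y q f = hessian f q (X q) (Y q)) (near p)"
    using vfield_near_eventually[OF X] vfield_near_eventually[OF Y] smooth_near_eventually[OF f]
    by eventually_elim (rule hessian_vfields[symmetric])
  ultimately show "smooth_near A p (\<lambda>q. hessian f q (X q) (Y q))" by (rule smooth_near_cong)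
qed

subsection \<open>Existence and uniqueness of horizontal lifts\<close>

lemma ex_parallel_extension:
  assumes p: "p \<in> pts A" and x: "x \<in> tangent_space A p" and y: "y \<in> tangent_space A p"
  obtains X Y where "vfield_near p X" "vfield_near p Y" "X p = x" "Y p = y" "nab X Y p = tzero"
proof (cases "x = tzero")
  case True
  show ?thesis
    by (rule that[OF extension_near[OF p x] extension_near[OF p y] extension_at[OF p x] extension_at[OF p y]
          connection_zero_left[OF connection_nab extension_near[OF p x] extension_near[OF p y]]])
      (use extension_at[OF p x] True in simp)
next
  case False
  let ?X = "extension p x" and ?Y = "extension p y"
  let ?N = "extension p (nab ?X ?Y p)"
  note X = extension_near[OF p x] extension_at[OF p x] and Y = extension_near[OF p y] extension_at[OF p y]
  note N = extension_near[OF p nab_tangent[OF X(1) Y(1)]] extension_at[OF p nab_tangent[OF X(1) Y(1)]]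
  obtain f where f: "x f \<noteq> 0" using False by (auto simp: fun_eq_iff tzero_apply)
  then have f_smooth: "smooth_near A p f" using tangent_not_smooth[OF x] by blast
  define h where "h q = (f q - f p) * (- 1 / x f)" for q
  note diff = smooth_near_diff[OF f_smooth smooth_near_const[OF p, of "f p"]]
  have h: "smooth_near A p h"
    unfolding h_def[abs_def] by (rule smooth_near_mult[OF diff smooth_near_const[OF p]])
  have "x h = - 1"
    using tangent_mult[OF x diff smooth_near_const[OF p], of "- 1 / x f"] f
      tangent_diff[OF x f_smooth smooth_near_const[OF p], of "f p"]
    by (simp add: h_def[abs_def] tangent_const[OF x p])
  moreover have hN: "vfield_near p (\<lambda>q. tscale (h q) (?N q))" by (rule vfield_near_scale[OF h N(1)])
  ultimately have "nab ?X (\<lambda>q. tadd (?Y q) (tscale (h q) (?N q))) p = tzero"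
    unfolding connection_add_right[OF connection_nab X(1) Y(1) hN]
      connection_scale_right[OF connection_nab h X(1) N(1)]
    by (simp add: X(2) N(2) fun_eq_iff tvec_apply) (simp add: h_def)
  moreover have "tadd (?Y p) (tscale (h p) (?N p)) = y"
    by (simp add: h_def Y(2) fun_eq_iff tvec_apply)
  ultimately show ?thesis using that[OF X(1) vfield_near_add[OF Y(1) hN] X(2)] by simp
qed

lemma section_velocity:
  assumes Y: "vfield_near p Y"
  shows section_velocity_tangent:
      "x \<in> tangent_space A p \<Longrightarrow> differential TB (\<lambda>q. (q, Y q)) p x \<in> tangent_space TB (p, Y p)"
    and section_velocity_base:
      "smooth_near A p f \<Longrightarrow> differential TB (\<lambda>q. (q, Y q)) p x (\<lambda>w. f (fst w)) = x f"
    and section_velocity_fibre: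
      "smooth_near A p f \<Longrightarrow> differential TB (\<lambda>q. (q, Y q)) p x (\<lambda>w. snd w f) = x (\<lambda>q. Y q f)"
  using differential_tangent[where \<Phi> = "\<lambda>q. (q, Y q)", OF TM.atlas_axioms smooth_map_at_section[OF Y], of x]
    differential_apply[where \<Phi> = "\<lambda>q. (q, Y q)" and v = x, OF smooth_near_base[OF section_pts[OF Y]]]
    differential_apply[where \<Phi> = "\<lambda>q. (q, Y q)" and v = x, OF smooth_near_fibre[OF section_pts[OF Y]]]
  by simp_all

abbreviation hlift :: "'a tpoint \<Rightarrow> 'a tvec \<Rightarrow> 'a tpoint tvec" where
  "hlift \<equiv> horizontal_lift A nab"

abbreviation hpart :: "'a tpoint \<Rightarrow> 'a tpoint tvec \<Rightarrow> 'a tvec" where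
  "hpart \<equiv> differential A fst"

context
  fixes u assumes u: "u \<in> pts TB"
begin

lemma fst_pts: "fst u \<in> pts A" and snd_tangent: "snd u \<in> tangent_space A (fst u)"
  using u by (simp_all add: pts_tangent_bundle_iff)

lemma hpart_tangent: "w \<in> tangent_space TB u \<Longrightarrow> hpart u w \<in> tangent_space A (fst u)"
  by (rule TM.differential_tangent[OF atlas_axioms smooth_map_at_base[OF u]])

lemma hpart_apply: "smooth_near A (fst u) f \<Longrightarrow> hpart u w f = w (\<lambda>v. f (fst v))"
  by (rule differential_apply)

lemma hpart_eqI:
  assumes w: "w \<in> tangent_space TB u" and x: "x \<in> tangent_space A (fst u)"
    and eq: "\<And>f. smooth_near A (fst u) f \<Longrightarrow> w (\<lambda>v. f (fst v)) = x f"
  shows "hpart u w = x"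
  by (rule tangent_ext[OF hpart_tangent[OF w] x]) (simp add: hpart_apply eq)

lemma horizontal_spaceD:
  assumes w: "w \<in> horizontal_space A nab u"
  shows "w \<in> tangent_space TB u"
    and "smooth_near A (fst u) f \<Longrightarrow> w (\<lambda>v. snd v f) = hessian f (fst u) (hpart u w) (snd u)"
proof -
  obtain X Y where X: "vfield_near (fst u) X" and Y: "vfield_near (fst u) Y" "Y (fst u) = snd u"
    and parallel: "nab X Y (fst u) = tzero" and w: "w = differential TB (\<lambda>q. (q, Y q)) (fst u) (X (fst u))"
    using w unfolding horizontal_space_def vfield_near_def by blast
  have u_eq: "(fst u, Y (fst u)) = u" by (simp add: Y(2))
  note Xp = vfield_near_tangent[OF X]
  show tangent: "w \<in> tangent_space TB u"
    using section_velocity_tangent[OF Y(1) Xp] unfolding u_eq w .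
  have "hpart u w = X (fst u)"
    by (rule hpart_eqI[OF tangent Xp]) (simp add: w section_velocity_base[OF Y(1)])
  then show "w (\<lambda>v. snd v f) = hessian f (fst u) (hpart u w) (snd u)" if f: "smooth_near A (fst u) f"
    using hessian_vfields[OF X Y(1) f] section_velocity_fibre[OF Y(1) f, of "X (fst u)"]
    by (simp add: w Y(2) parallel tzero_apply)
qed

lemma ex_horizontal:
  assumes x: "x \<in> tangent_space A (fst u)"
  obtains w where "w \<in> horizontal_space A nab u" "hpart u w = x"
proof -
  obtain X Y where X: "vfield_near (fst u) X" "X (fst u) = x" and Y: "vfield_near (fst u) Y" "Y (fst u) = snd u"
    and parallel: "nab X Y (fst u) = tzero"
    using ex_parallel_extension[OF fst_pts x snd_tangent] by metis
  obtain W where "fst u \<in> W" "\<forall>Z\<in>{X, Y}. vfield_on A W Z"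
    by (rule common_domainE[OF fst_pts, of "{X, Y}" "{}"]) (use X Y in simp_all)
  then have "\<exists>W X' Y'. fst u \<in> W \<and> vfield_on A W X' \<and> vfield_on A W Y' \<and> Y' (fst u) = snd u \<and>
      nab X' Y' (fst u) = tzero \<and>
      differential TB (\<lambda>q. (q, Y q)) (fst u) x = differential TB (\<lambda>q. (q, Y' q)) (fst u) (X' (fst u))"
    using X(2) Y(2) parallel by (intro exI[of _ W] exI[of _ X] exI[of _ Y]) simp
  then have horizontal: "differential TB (\<lambda>q. (q, Y q)) (fst u) x \<in> horizontal_space A nab u"
    by (simp only: horizontal_space_def mem_Collect_eq)
  show ?thesis
    by (rule that[OF horizontal hpart_eqI[OF horizontal_spaceD(1)[OF horizontal] x]])
      (simp add: section_velocity_base[OF Y(1)])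
qed

lemma horizontal_eqI:
  assumes w: "w \<in> horizontal_space A nab u" and w': "w' \<in> horizontal_space A nab u" and eq: "hpart u w = hpart u w'"
  shows "w = w'"
proof (rule bundle_tangent_eqI[OF u horizontal_spaceD(1)[OF w] horizontal_spaceD(1)[OF w']])
  fix f assume f: "smooth_near A (fst u) f"
  show "w (\<lambda>v. f (fst v)) = w' (\<lambda>v. f (fst v))" using eq hpart_apply[OF f, of w] hpart_apply[OF f, of w'] by simp
  show "w (\<lambda>v. snd v f) = w' (\<lambda>v. snd v f)"
    by (simp add: horizontal_spaceD(2)[OF w f] horizontal_spaceD(2)[OF w' f] eq)
qed

context
  fixes x assumes x: "x \<in> tangent_space A (fst u)"
begin

lemma hlift_horizontal: "hlift u x \<in> horizontal_space A nab u" and hpart_hlift: "hpart u (hlift u x) = x"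
proof -
  obtain w where w: "w \<in> horizontal_space A nab u \<and> hpart u w = x" using ex_horizontal[OF x] by blast
  have "hlift u x = w"
    unfolding horizontal_lift_def
  proof (rule the_equality)
    fix w' assume "w' \<in> horizontal_space A nab u \<and> hpart u w' = x"
    with w show "w' = w" by (intro horizontal_eqI) simp_all
  qed (rule w)
  with w show "hlift u x \<in> horizontal_space A nab u" "hpart u (hlift u x) = x" by simp_all
qed

lemmas hlift_tangent = horizontal_spaceD(1)[OF hlift_horizontal]

lemma hlift_base: "smooth_near A (fst u) f \<Longrightarrow> hlift u x (\<lambda>w. f (fst w)) = x f"
  using hpart_apply[of f "hlift u x"] by (simp add: hpart_hlift)

lemma hlift_fibre: "smooth_near A (fst u) f \<Longrightarrow> hlift u x (\<lambda>w. snd w f) = hessian f (fst u) x (snd u)"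
  using horizontal_spaceD(2)[OF hlift_horizontal] by (simp add: hpart_hlift)

lemma hpart_vlift: "hpart u (vlift u x) = tzero"
  by (rule hpart_eqI[OF vlift_tangent[OF u x] tzero_tangent]) (simp add: vlift_base[OF u] tzero_apply)

end

end

end

section \<open>Vector fields along the bundle projection\<close>

context affine_connection
begin

definition along_near :: "'a tpoint \<Rightarrow> ('a tpoint \<Rightarrow> 'a tvec) \<Rightarrow> bool" where
  "along_near u \<zeta> \<longleftrightarrow> eventually (\<lambda>w. \<zeta> w \<in> tangent_space A (fst w)) (TM.near u) \<and>
     (\<forall>f. smooth_near A (fst u) f \<longrightarrow> smooth_near TB u (\<lambda>w. \<zeta> w f))"

lemma along_nearI:
  assumes "eventually (\<lambda>w. \<zeta> w \<in> tangent_space A (fst w)) (TM.near u)"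
    and "\<And>f. smooth_near A (fst u) f \<Longrightarrow> smooth_near TB u (\<lambda>w. \<zeta> w f)"
  shows "along_near u \<zeta>"
  using assms by (simp add: along_near_def)

lemma along_near_tangent: "along_near u \<zeta> \<Longrightarrow> eventually (\<lambda>w. \<zeta> w \<in> tangent_space A (fst w)) (TM.near u)"
  and along_near_smooth: "along_near u \<zeta> \<Longrightarrow> smooth_near A (fst u) f \<Longrightarrow> smooth_near TB u (\<lambda>w. \<zeta> w f)"
  by (simp_all add: along_near_def)

context
  fixes u assumes u: "u \<in> pts TB"
begin

lemma along_near_base:
  assumes X: "vfield_near (fst u) X" shows "along_near u (\<lambda>w. X (fst w))"
proof (rule along_nearI)
  show "eventually (\<lambda>w. X (fst w) \<in> tangent_space A (fst w)) (TM.near u)"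
    by (rule eventually_near_base[OF u vfield_near_eventually_tangent[OF X]])
qed (rule smooth_near_base[OF u vfield_near_smooth[OF X]])

lemma along_near_snd: "along_near u snd"
proof (rule along_nearI)
  show "eventually (\<lambda>w. snd w \<in> tangent_space A (fst w)) (TM.near u)"
    using TM.eventually_near_pts by eventually_elim (rule snd_tangent)
qed (rule smooth_near_fibre[OF u])

lemma along_near_expand:
  assumes \<zeta>: "along_near u \<zeta>" and chart: "(U, \<phi>) \<in> A" "fst u \<in> U"
  shows "eventually (\<lambda>w. \<zeta> w = tsum (\<lambda>b. tscale (\<zeta> w (\<lambda>q. \<phi> q \<bullet> b)) (coord_vec U \<phi> (fst w) b)) Basis) (TM.near u)"
proof -
  have "eventually (\<lambda>w. fst w \<in> U) (TM.near u)"
    by (rule eventually_near_base[OF u eventually_near_in_open[OF openin_chart[OF chart(1)] chart(2)]])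
  then show ?thesis using along_near_tangent[OF \<zeta>] by eventually_elim (rule tangent_expand[OF chart(1)])
qed

lemma along_form1_smooth:
  assumes \<eta>: "form1_near (fst u) \<eta>" and \<zeta>: "along_near u \<zeta>"
  shows "smooth_near TB u (\<lambda>w. \<eta> (fst w) (\<zeta> w))"
proof -
  obtain U \<phi> where chart: "(U, \<phi>) \<in> A" "fst u \<in> U" and "u \<in> tangent_over U"
    using u by (rule pts_tangent_bundle_chartE)
  let ?e = "\<lambda>b q. coord_vec U \<phi> q b"
  have "smooth_near TB u (\<lambda>w. \<Sum>b\<in>Basis. \<zeta> w (\<lambda>q. \<phi> q \<bullet> b) * \<eta> (fst w) (?e b (fst w)))"
    by (intro TM.smooth_near_sum[OF u] TM.smooth_near_mult along_near_smooth[OF \<zeta>] smooth_near_coord[OF chart]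
        smooth_near_base[OF u] form1_near_smooth[OF \<eta>] vfield_near_coord_vec[OF chart])
  moreover have "eventually (\<lambda>w. (\<Sum>b\<in>Basis. \<zeta> w (\<lambda>q. \<phi> q \<bullet> b) * \<eta> (fst w) (?e b (fst w))) =
      \<eta> (fst w) (\<zeta> w)) (TM.near u)"
    using along_near_expand[OF \<zeta> chart] eventually_near_base[OF u \<eta>[unfolded form1_near_def, THEN conjunct1]]
      eventually_near_base[OF u eventually_near_in_open[OF openin_chart[OF chart(1)] chart(2)]]
  proof eventually_elim
    case (elim w)
    have "\<eta> (fst w) (tsum (\<lambda>b. tscale (\<zeta> w (\<lambda>q. \<phi> q \<bullet> b)) (?e b (fst w))) Basis) =
        (\<Sum>b\<in>Basis. \<zeta> w (\<lambda>q. \<phi> q \<bullet> b) * \<eta> (fst w) (?e b (fst w)))"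
      by (rule covector_combination[OF elim(2) finite_Basis coord_vec_tangent[OF chart(1) elim(3)]])
    then show ?case using elim(1) by simp
  qed
  ultimately show ?thesis by (rule TM.smooth_near_cong)
qed

lemma along_form2_smooth:
  assumes \<omega>: "form2_near (fst u) \<omega>"
    and covector: "\<And>q z. q \<in> pts A \<Longrightarrow> z \<in> tangent_space A q \<Longrightarrow> covector_at q (\<lambda>x. \<omega> q x z)"
    and \<zeta>: "along_near u \<zeta>" and \<eta>: "along_near u \<eta>"
  shows "smooth_near TB u (\<lambda>w. \<omega> (fst w) (\<zeta> w) (\<eta> w))"
proof -
  obtain U \<phi> where chart: "(U, \<phi>) \<in> A" "fst u \<in> U" and "u \<in> tangent_over U"
    using u by (rule pts_tangent_bundle_chartE)
  let ?e = "\<lambda>b q. coord_vec U \<phi> q b"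
  have "smooth_near TB u (\<lambda>w. \<omega> (fst w) (?e b (fst w)) (\<eta> w))" for b
    by (rule along_form1_smooth[OF form2_near_right[OF \<omega> vfield_near_coord_vec[OF chart]] \<eta>])
  then have "smooth_near TB u (\<lambda>w. \<Sum>b\<in>Basis. \<zeta> w (\<lambda>q. \<phi> q \<bullet> b) * \<omega> (fst w) (?e b (fst w)) (\<eta> w))"
    by (intro TM.smooth_near_sum[OF u] TM.smooth_near_mult along_near_smooth[OF \<zeta>] smooth_near_coord[OF chart])
  moreover have "eventually (\<lambda>w. (\<Sum>b\<in>Basis. \<zeta> w (\<lambda>q. \<phi> q \<bullet> b) * \<omega> (fst w) (?e b (fst w)) (\<eta> w)) =
      \<omega> (fst w) (\<zeta> w) (\<eta> w)) (TM.near u)"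
    using along_near_expand[OF \<zeta> chart] along_near_tangent[OF \<eta>] TM.eventually_near_pts
      eventually_near_base[OF u eventually_near_in_open[OF openin_chart[OF chart(1)] chart(2)]]
  proof eventually_elim
    case (elim w)
    have "\<omega> (fst w) (tsum (\<lambda>b. tscale (\<zeta> w (\<lambda>q. \<phi> q \<bullet> b)) (?e b (fst w))) Basis) (\<eta> w) =
        (\<Sum>b\<in>Basis. \<zeta> w (\<lambda>q. \<phi> q \<bullet> b) * \<omega> (fst w) (?e b (fst w)) (\<eta> w))"
      by (rule covector_combination[OF covector[OF fst_pts[OF elim(3)] elim(2)] finite_Basis
            coord_vec_tangent[OF chart(1) elim(4)]])
    then show ?case using elim(1) by simp
  qed
  ultimately show ?thesis by (rule TM.smooth_near_cong)
qed

lemma along_hessian_smooth: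
  assumes \<zeta>: "along_near u \<zeta>" and f: "smooth_near A (fst u) f"
  shows "smooth_near TB u (\<lambda>w. hessian f (fst w) (\<zeta> w) (snd w))"
  by (rule along_form2_smooth[OF form2_near_hessian[OF f] covector_hessian_left \<zeta> along_near_snd])

lemma vfield_near_hlift:
  assumes \<zeta>: "along_near u \<zeta>" shows "TM.vfield_near u (\<lambda>w. hlift w (\<zeta> w))"
proof (rule bundle_vfield_nearI[OF u])
  note tangent = along_near_tangent[OF \<zeta>] TM.eventually_near_pts
  show "eventually (\<lambda>w. hlift w (\<zeta> w) \<in> tangent_space TB w) (TM.near u)"
    using tangent by eventually_elim (rule hlift_tangent)
  fix f assume f: "smooth_near A (fst u) f"
  note f_smooth = eventually_near_base[OF u smooth_near_eventually[OF f]]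
  have "eventually (\<lambda>w. \<zeta> w f = hlift w (\<zeta> w) (\<lambda>v. f (fst v))) (TM.near u)"
    using tangent f_smooth by eventually_elim (rule hlift_base[symmetric])
  then show "smooth_near TB u (\<lambda>w. hlift w (\<zeta> w) (\<lambda>v. f (fst v)))"
    by (rule TM.smooth_near_cong[OF along_near_smooth[OF \<zeta> f]])
  have "eventually (\<lambda>w. hessian f (fst w) (\<zeta> w) (snd w) = hlift w (\<zeta> w) (\<lambda>v. snd v f)) (TM.near u)"
    using tangent f_smooth by eventually_elim (rule hlift_fibre[symmetric])
  then show "smooth_near TB u (\<lambda>w. hlift w (\<zeta> w) (\<lambda>v. snd v f))"
    by (rule TM.smooth_near_cong[OF along_hessian_smooth[OF \<zeta> f]])
qed

lemma vfield_near_vlift: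
  assumes \<zeta>: "along_near u \<zeta>" shows "TM.vfield_near u (\<lambda>w. vlift w (\<zeta> w))"
proof (rule bundle_vfield_nearI[OF u])
  note tangent = along_near_tangent[OF \<zeta>] TM.eventually_near_pts
  show "eventually (\<lambda>w. vlift w (\<zeta> w) \<in> tangent_space TB w) (TM.near u)"
    using tangent by eventually_elim (rule vlift_tangent)
  fix f assume f: "smooth_near A (fst u) f"
  have "eventually (\<lambda>w. 0 = vlift w (\<zeta> w) (\<lambda>v. f (fst v))) (TM.near u)"
    using TM.eventually_near_pts by eventually_elim (rule vlift_base[symmetric])
  then show "smooth_near TB u (\<lambda>w. vlift w (\<zeta> w) (\<lambda>v. f (fst v)))"
    by (rule TM.smooth_near_cong[OF TM.smooth_near_const[OF u]])
  have "eventually (\<lambda>w. \<zeta> w f = vlift w (\<zeta> w) (\<lambda>v. snd v f)) (TM.near u)"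
    using tangent eventually_near_base[OF u smooth_near_eventually[OF f]]
    by eventually_elim (rule vlift_fibre[symmetric])
  then show "smooth_near TB u (\<lambda>w. vlift w (\<zeta> w) (\<lambda>v. snd v f))"
    by (rule TM.smooth_near_cong[OF along_near_smooth[OF \<zeta> f]])
qed

end

section \<open>Horizontal and vertical parts\<close>

definition vpart :: "'a tpoint \<Rightarrow> 'a tpoint tvec \<Rightarrow> 'a tvec" where
  "vpart u w f = (if smooth_near A (fst u) f
     then w (\<lambda>v. snd v f) - hessian f (fst u) (hpart u w) (snd u) else 0)"

context
  fixes u assumes u: "u \<in> pts TB"
begin

lemma vertical_vectorE:
  assumes w: "w \<in> tangent_space TB u" and vertical: "hpart u w = tzero"
  obtains y where "y \<in> tangent_space A (fst u)" "w = vlift u y"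
proof -
  obtain U \<phi> where chart: "(U, \<phi>) \<in> A" "fst u \<in> U" and over: "u \<in> tangent_over U"
    using u by (rule pts_tangent_bundle_chartE)
  let ?y = "coord_vec U \<phi> (fst u) (\<Sum>b\<in>Basis. w (\<lambda>v. snd v (\<lambda>q. \<phi> q \<bullet> b)) *\<^sub>R b)"
  note y = coord_vec_tangent[OF chart] and coord = smooth_near_coord[OF chart]
  have "w = vlift u ?y"
  proof (rule TM.tangent_eqI_coords[OF w vlift_tangent[OF u y] bundle_chart[OF chart(1)] over])
    fix b :: "'e \<times> 'e" assume "b \<in> Basis"
    then show "w (\<lambda>v. bundle_coords \<phi> v \<bullet> b) = vlift u ?y (\<lambda>v. bundle_coords \<phi> v \<bullet> b)"
    proof (cases rule: bundle_Basis_cases)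
      case (1 b')
      have "w (\<lambda>v. \<phi> (fst v) \<bullet> b') = 0" using hpart_apply[OF u coord, of w b'] vertical by (simp add: tzero_apply)
      then show ?thesis using vlift_base[OF u, of ?y "\<lambda>q. \<phi> q \<bullet> b'"] by (simp add: 1)
    next
      case (2 b')
      then show ?thesis by (simp add: vlift_fibre[OF u y coord] coord_vec_coord[OF chart] inner_sum_left_Basis)
    qed
  qed
  with y show ?thesis by (rule that)
qed

lemma hpart_add: "hpart u (tadd w w') = tadd (hpart u w) (hpart u w')"
  and hpart_scale: "hpart u (tscale c w) = tscale c (hpart u w)"
  and hpart_diff: "hpart u (tdiff w w') = tdiff (hpart u w) (hpart u w')"
  by (auto simp: differential_def tvec_apply)

lemma vpart_add:
  "w \<in> tangent_space TB u \<Longrightarrow> w' \<in> tangent_space TB u \<Longrightarrow> vpart u (tadd w w') = tadd (vpart u w) (vpart u w')"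
  by (rule ext) (simp add: vpart_def tvec_apply hpart_add hpart_tangent[OF u]
      covector_add[OF covector_hessian_left[OF fst_pts[OF u] snd_tangent[OF u]]])

lemma vpart_scale: "w \<in> tangent_space TB u \<Longrightarrow> vpart u (tscale c w) = tscale c (vpart u w)"
  by (rule ext) (simp add: vpart_def tvec_apply hpart_scale hpart_tangent[OF u] right_diff_distrib
      covector_scale[OF covector_hessian_left[OF fst_pts[OF u] snd_tangent[OF u]]])

lemma vpart_diff:
  "w \<in> tangent_space TB u \<Longrightarrow> w' \<in> tangent_space TB u \<Longrightarrow> vpart u (tdiff w w') = tdiff (vpart u w) (vpart u w')"
  by (simp add: tdiff_eq_tadd vpart_add vpart_scale TM.tscale_tangent)

lemma vpart_hlift:
  assumes x: "x \<in> tangent_space A (fst u)" shows "vpart u (hlift u x) = tzero"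
  by (rule ext) (simp add: vpart_def hpart_hlift[OF u x] hlift_fibre[OF u x] tzero_apply)

lemma vpart_vlift:
  assumes x: "x \<in> tangent_space A (fst u)" shows "vpart u (vlift u x) = x"
proof
  fix f
  show "vpart u (vlift u x) f = x f"
    using covector_zero[OF covector_hessian_left[OF fst_pts[OF u] snd_tangent[OF u]]] tangent_not_smooth[OF x, of f]
    by (simp add: vpart_def hpart_vlift[OF u x] vlift_fibre[OF u x])
qed

lemma parts_of_lifts:
  assumes x: "x \<in> tangent_space A (fst u)" and y: "y \<in> tangent_space A (fst u)"
  shows "hpart u (tadd (hlift u x) (vlift u y)) = x" and "vpart u (tadd (hlift u x) (vlift u y)) = y"
  using hlift_tangent[OF u x] vlift_tangent[OF u y]
  by (simp_all add: hpart_add vpart_add hpart_hlift[OF u x] hpart_vlift[OF u y] vpart_hlift[OF x] vpart_vlift[OF y]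
      fun_eq_iff tvec_apply)

lemma horizontal_vertical_decomposition:
  assumes w: "w \<in> tangent_space TB u"
  shows vpart_tangent: "vpart u w \<in> tangent_space A (fst u)"
    and hlift_vlift_parts: "w = tadd (hlift u (hpart u w)) (vlift u (vpart u w))"
proof -
  note x = hpart_tangent[OF u w]
  have "hpart u (tdiff w (hlift u (hpart u w))) = tzero"
    by (simp add: hpart_diff hpart_hlift[OF u x] tdiff_eq_tzero_iff)
  then obtain y where y: "y \<in> tangent_space A (fst u)" "tdiff w (hlift u (hpart u w)) = vlift u y"
    using vertical_vectorE[OF TM.tdiff_tangent[OF w hlift_tangent[OF u x]]] by metis
  from y(2) have w_eq: "w = tadd (hlift u (hpart u w)) (vlift u y)"
    by (simp add: fun_eq_iff tvec_apply algebra_simps)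
  with parts_of_lifts(2)[OF x y(1)] have "vpart u w = y" by simp
  with y(1) w_eq show "vpart u w \<in> tangent_space A (fst u)" "w = tadd (hlift u (hpart u w)) (vlift u (vpart u w))"
    by simp_all
qed

lemma parts_eqI:
  assumes "w \<in> tangent_space TB u" "w' \<in> tangent_space TB u" "hpart u w = hpart u w'" "vpart u w = vpart u w'"
  shows "w = w'"
  using hlift_vlift_parts[OF assms(1)] hlift_vlift_parts[OF assms(2)] assms(3,4) by simp

lemma along_near_hpart:
  assumes W: "TM.vfield_near u W" shows "along_near u (\<lambda>w. hpart w (W w))"
proof (rule along_nearI)
  show "eventually (\<lambda>w. hpart w (W w) \<in> tangent_space A (fst w)) (TM.near u)"
    using TM.eventually_near_pts TM.vfield_near_eventually_tangent[OF W] by eventually_elim (rule hpart_tangent)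
  fix f assume f: "smooth_near A (fst u) f"
  have "eventually (\<lambda>w. W w (\<lambda>v. f (fst v)) = hpart w (W w) f) (TM.near u)"
    using TM.eventually_near_pts eventually_near_base[OF u smooth_near_eventually[OF f]]
    by eventually_elim (rule hpart_apply[symmetric])
  then show "smooth_near TB u (\<lambda>w. hpart w (W w) f)"
    by (rule TM.smooth_near_cong[OF TM.vfield_near_smooth[OF W smooth_near_base[OF u f]]])
qed

lemma along_near_vpart:
  assumes W: "TM.vfield_near u W" shows "along_near u (\<lambda>w. vpart w (W w))"
proof (rule along_nearI)
  show "eventually (\<lambda>w. vpart w (W w) \<in> tangent_space A (fst w)) (TM.near u)"
    using TM.eventually_near_pts TM.vfield_near_eventually_tangent[OF W]
    by eventually_elim (rule affine_connection.vpart_tangent[OF affine_connection_axioms])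
  fix f assume f: "smooth_near A (fst u) f"
  have "smooth_near TB u (\<lambda>w. W w (\<lambda>v. snd v f) - hessian f (fst w) (hpart w (W w)) (snd w))"
    by (intro TM.smooth_near_diff TM.vfield_near_smooth[OF W smooth_near_fibre[OF u f]]
        along_hessian_smooth[OF u along_near_hpart[OF W] f])
  moreover have "eventually (\<lambda>w. W w (\<lambda>v. snd v f) - hessian f (fst w) (hpart w (W w)) (snd w) =
      vpart w (W w) f) (TM.near u)"
    using eventually_near_base[OF u smooth_near_eventually[OF f]] by eventually_elim (simp add: vpart_def)
  ultimately show "smooth_near TB u (\<lambda>w. vpart w (W w) f)" by (rule TM.smooth_near_cong)
qed

end

subsection \<open>Brackets of lifted vector fields\<close>

abbreviation horizontal_field :: "'a vfield \<Rightarrow> 'a tpoint vfield" where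
  "horizontal_field X \<equiv> \<lambda>w. hlift w (X (fst w))"

abbreviation vertical_field :: "'a vfield \<Rightarrow> 'a tpoint vfield" where
  "vertical_field X \<equiv> \<lambda>w. vlift w (X (fst w))"

context
  fixes u assumes u: "u \<in> pts TB"
begin

lemma horizontal_field_near: "vfield_near (fst u) X \<Longrightarrow> TM.vfield_near u (horizontal_field X)"
  and vertical_field_near: "vfield_near (fst u) X \<Longrightarrow> TM.vfield_near u (vertical_field X)"
  by (rule vfield_near_hlift[OF u along_near_base[OF u]] vfield_near_vlift[OF u along_near_base[OF u]], assumption)+

lemma horizontal_field_related:
  assumes X: "vfield_near (fst u) X" shows "TM.related_near A fst u (horizontal_field X) X"
  unfolding TM.related_near_def
  using TM.eventually_near_pts eventually_near_base[OF u vfield_near_eventually_tangent[OF X]]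
  by eventually_elim (rule hpart_hlift)

lemma hpart_horizontal_bracket:
  assumes X: "vfield_near (fst u) X" and Y: "vfield_near (fst u) Y"
  shows "hpart u (lie_bracket TB (horizontal_field X) (horizontal_field Y) u) = lie_bracket A X Y (fst u)"
  by (rule TM.differential_bracket[OF atlas_axioms smooth_map_at_base[OF u] horizontal_field_near[OF X]
        horizontal_field_near[OF Y] X Y horizontal_field_related[OF X] horizontal_field_related[OF Y]])

lemma vertical_field_base: "eventually (\<lambda>w. vertical_field X w (\<lambda>v. f (fst v)) = 0) (TM.near u)"
  using TM.eventually_near_pts by eventually_elim (rule vlift_base)

lemma vertical_field_fibre:
  assumes X: "vfield_near (fst u) X" and f: "smooth_near A (fst u) f"
  shows "eventually (\<lambda>w. vertical_field X w (\<lambda>v. snd v f) = X (fst w) f) (TM.near u)"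
  using TM.eventually_near_pts eventually_near_base[OF u vfield_near_eventually_tangent[OF X]]
    eventually_near_base[OF u smooth_near_eventually[OF f]]
  by eventually_elim (rule vlift_fibre)

lemma horizontal_field_base:
  assumes X: "vfield_near (fst u) X" and f: "smooth_near A (fst u) f"
  shows "eventually (\<lambda>w. horizontal_field X w (\<lambda>v. f (fst v)) = X (fst w) f) (TM.near u)"
  using TM.eventually_near_pts eventually_near_base[OF u vfield_near_eventually_tangent[OF X]]
    eventually_near_base[OF u smooth_near_eventually[OF f]]
  by eventually_elim (rule hlift_base)

lemma horizontal_field_fibre:
  assumes X: "vfield_near (fst u) X" and f: "smooth_near A (fst u) f"
  shows "eventually (\<lambda>w. horizontal_field X w (\<lambda>v. snd v f) = hessian f (fst w) (X (fst w)) (snd w)) (TM.near u)"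
  using TM.eventually_near_pts eventually_near_base[OF u vfield_near_eventually_tangent[OF X]]
    eventually_near_base[OF u smooth_near_eventually[OF f]]
  by eventually_elim (rule hlift_fibre)

lemma bracket_vertical_vertical:
  assumes X: "vfield_near (fst u) X" and Y: "vfield_near (fst u) Y"
  shows "lie_bracket TB (vertical_field X) (vertical_field Y) u = tzero"
proof (rule bundle_tangent_eqI[OF u TM.bracket_tangent TM.tzero_tangent])
  note VX = vertical_field_near[OF X] and VY = vertical_field_near[OF Y]
  show "TM.vfield_near u (vertical_field X)" "TM.vfield_near u (vertical_field Y)" by (rule VX, rule VY)
  fix f assume f: "smooth_near A (fst u) f"
  show "lie_bracket TB (vertical_field X) (vertical_field Y) u (\<lambda>w. f (fst w)) = tzero (\<lambda>w. f (fst w))"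
    using TM.vfield_near_apply_eventually_const[OF VX vertical_field_base[of Y f]]
      TM.vfield_near_apply_eventually_const[OF VY vertical_field_base[of X f]]
    by (simp add: lie_bracket_def tzero_apply)
  have "vertical_field Z u (\<lambda>w. vertical_field W w (\<lambda>v. snd v f)) = 0"
    if Z: "vfield_near (fst u) Z" and W: "vfield_near (fst u) W" for Z W
    using TM.vfield_near_apply_cong[OF vertical_field_near[OF Z] vertical_field_fibre[OF W f]]
      vlift_base[OF u, of _ "\<lambda>q. W q f"] by simp
  from this[OF X Y] this[OF Y X]
  show "lie_bracket TB (vertical_field X) (vertical_field Y) u (\<lambda>w. snd w f) = tzero (\<lambda>w. snd w f)"
    by (simp add: lie_bracket_def tzero_apply)
qed

lemma bracket_horizontal_vertical:
  assumes X: "vfield_near (fst u) X" and Y: "vfield_near (fst u) Y"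
  shows "lie_bracket TB (horizontal_field X) (vertical_field Y) u = vlift u (nab X Y (fst u))"
proof (rule bundle_tangent_eqI[OF u TM.bracket_tangent vlift_tangent[OF u nab_tangent[OF X Y]]])
  note HX = horizontal_field_near[OF X] and VY = vertical_field_near[OF Y]
  note Xp = vfield_near_tangent[OF X] and Yp = vfield_near_tangent[OF Y]
  show "TM.vfield_near u (horizontal_field X)" "TM.vfield_near u (vertical_field Y)" by (rule HX, rule VY)
  fix f assume f: "smooth_near A (fst u) f"
  have "horizontal_field X u (\<lambda>w. vertical_field Y w (\<lambda>v. f (fst v))) = 0"
    by (rule TM.vfield_near_apply_eventually_const[OF HX vertical_field_base])
  moreover have "vertical_field Y u (\<lambda>w. horizontal_field X w (\<lambda>v. f (fst v))) = 0"
    using TM.vfield_near_apply_cong[OF VY horizontal_field_base[OF X f]] vlift_base[OF u, of _ "\<lambda>q. X q f"] by simp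
  ultimately show "lie_bracket TB (horizontal_field X) (vertical_field Y) u (\<lambda>w. f (fst w)) =
      vlift u (nab X Y (fst u)) (\<lambda>w. f (fst w))"
    using vlift_base[OF u, of "nab X Y (fst u)" f] by (simp add: lie_bracket_def)
  have "horizontal_field X u (\<lambda>w. vertical_field Y w (\<lambda>v. snd v f)) = X (fst u) (\<lambda>q. Y q f)"
    using TM.vfield_near_apply_cong[OF HX vertical_field_fibre[OF Y f]]
      hlift_base[OF u Xp vfield_near_smooth[OF Y f]]
    by simp
  moreover have "vertical_field Y u (\<lambda>w. horizontal_field X w (\<lambda>v. snd v f)) =
      hessian f (fst u) (X (fst u)) (Y (fst u))"
    unfolding TM.vfield_near_apply_cong[OF VY horizontal_field_fibre[OF X f]]
    by (rule vlift_covector[OF u covector_hessian_right[OF fst_pts[OF u] Xp]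
          along_hessian_smooth[OF u along_near_base[OF u X] f] Yp]) simp
  ultimately show "lie_bracket TB (horizontal_field X) (vertical_field Y) u (\<lambda>w. snd w f) =
      vlift u (nab X Y (fst u)) (\<lambda>w. snd w f)"
    using smooth_near_fibre[OF u f]
    by (simp add: lie_bracket_def vlift_fibre[OF u nab_tangent[OF X Y] f] hessian_vfields[OF X Y f])
qed

end

end

section \<open>Riemannian metrics\<close>

locale riemannian = atlas A for A :: "('a, 'e::euclidean_space) chart set" +
  fixes g :: "'a \<Rightarrow> 'a tvec \<Rightarrow> 'a tvec \<Rightarrow> real"
  assumes metric: "riemannian_metric A g"
begin

context
  fixes p assumes p: "p \<in> pts A"
begin

lemma g_sym: "x \<in> tangent_space A p \<Longrightarrow> y \<in> tangent_space A p \<Longrightarrow> g p x y = g p y x"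
  using metric p unfolding riemannian_metric_def by blast

lemma g_pos: "x \<in> tangent_space A p \<Longrightarrow> x \<noteq> tzero \<Longrightarrow> g p x x > 0"
  using metric p unfolding riemannian_metric_def by blast

lemma covector_g_left: "z \<in> tangent_space A p \<Longrightarrow> covector_at p (\<lambda>x. g p x z)"
  using metric p unfolding riemannian_metric_def covector_at_def by blast

lemma covector_g_right:
  assumes z: "z \<in> tangent_space A p" shows "covector_at p (\<lambda>x. g p z x)"
proof (rule covector_atI)
  note left = covector_g_left[OF z]
  fix x assume x: "x \<in> tangent_space A p"
  show "g p z (tadd x y) = g p z x + g p z y" if y: "y \<in> tangent_space A p" for y
    using covector_add[OF left x y] by (simp add: g_sym[OF z] x y tadd_tangent)
  show "g p z (tscale c x) = c * g p z x" for c
    using covector_scale[OF left x] by (simp add: g_sym[OF z] x tscale_tangent)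
qed

lemmas g_add_left = covector_add[OF covector_g_left]
lemmas g_add_right = covector_add[OF covector_g_right]
lemmas g_scale_left = covector_scale[OF covector_g_left]
lemmas g_scale_right = covector_scale[OF covector_g_right]
lemmas g_diff_left = covector_diff[OF covector_g_left]
lemmas g_zero_left = covector_zero[OF covector_g_left]
lemmas g_zero_right = covector_zero[OF covector_g_right]

lemma g_eqI:
  assumes x: "x \<in> tangent_space A p" and y: "y \<in> tangent_space A p"
    and eq: "\<And>z. z \<in> tangent_space A p \<Longrightarrow> g p x z = g p y z"
  shows "x = y"
proof -
  have "g p (tdiff x y) (tdiff x y) = 0" using g_diff_left[OF _ x y] eq by (simp add: x y tdiff_tangent)
  then have "tdiff x y = tzero" using g_pos[OF tdiff_tangent[OF x y]] by force
  then show ?thesis by (simp only: tdiff_eq_tzero_iff)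
qed

end

lemma g_eqI_vfield:
  assumes p: "p \<in> pts A" and x: "x \<in> tangent_space A p" and y: "y \<in> tangent_space A p"
    and eq: "\<And>Z. vfield_near p Z \<Longrightarrow> g p x (Z p) = g p y (Z p)"
  shows "x = y"
proof (rule g_eqI[OF p x y])
  fix z assume z: "z \<in> tangent_space A p"
  show "g p x z = g p y z" using eq[OF extension_near[OF p z]] by (simp add: extension_at[OF p z])
qed

lemma g_smooth:
  assumes X: "vfield_near p X" and Y: "vfield_near p Y"
  shows "smooth_near A p (\<lambda>q. g q (X q) (Y q))"
proof -
  obtain W where "p \<in> W" "\<forall>Z\<in>{X, Y}. vfield_on A W Z"
    by (rule common_domainE[OF vfield_near_pts[OF X], of "{X, Y}" "{}"]) (use X Y in simp_all)
  then show ?thesis using metric by (simp add: riemannian_metric_def smooth_fun_on_iff)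
qed

lemma form2_near_g: "form2_near p g"
  by (rule form2_nearI[OF covector_g_left covector_g_right g_smooth])

lemma g_derivative_sym:
  assumes X: "vfield_near p X" and Y: "vfield_near p Y" and Z: "vfield_near p Z"
  shows "Z p (\<lambda>q. g q (X q) (Y q)) = Z p (\<lambda>q. g q (Y q) (X q))"
proof (rule vfield_near_apply_cong[OF Z])
  show "eventually (\<lambda>q. g q (X q) (Y q) = g q (Y q) (X q)) (near p)"
    using eventually_near_pts vfield_near_eventually_tangent[OF X] vfield_near_eventually_tangent[OF Y]
    by eventually_elim (rule g_sym)
qed

subsection \<open>Orthonormal frames\<close>

definition orthonormal_at :: "'a \<Rightarrow> nat \<Rightarrow> (nat \<Rightarrow> 'a tvec) \<Rightarrow> bool" where
  "orthonormal_at p k e \<longleftrightarrow> (\<forall>i<k. e i \<in> tangent_space A p) \<and>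
     (\<forall>i<k. \<forall>j<k. g p (e i) (e j) = (if i = j then 1 else 0))"

definition residual :: "'a \<Rightarrow> nat \<Rightarrow> (nat \<Rightarrow> 'a tvec) \<Rightarrow> 'a tvec \<Rightarrow> 'a tvec" where
  "residual p k e x = tdiff x (tsum (\<lambda>i. tscale (g p x (e i)) (e i)) {..<k})"

context
  fixes p k e assumes p: "p \<in> pts A" and on: "orthonormal_at p k e"
begin

lemma orthonormal_tangent: "i < k \<Longrightarrow> e i \<in> tangent_space A p"
  using on by (simp add: orthonormal_at_def)

lemma orthonormal_combination_tangent: "tsum (\<lambda>i. tscale (c i) (e i)) {..<k} \<in> tangent_space A p"
  by (intro tsum_tangent tscale_tangent orthonormal_tangent) simp

lemma orthonormal_combination_inner:
  assumes j: "j < k" shows "g p (tsum (\<lambda>i. tscale (c i) (e i)) {..<k}) (e j) = c j"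
proof -
  have "g p (tsum (\<lambda>i. tscale (c i) (e i)) {..<k}) (e j) = (\<Sum>i<k. c i * g p (e i) (e j))"
    by (rule covector_combination[OF covector_g_left[OF p orthonormal_tangent[OF j]] _ orthonormal_tangent])
      simp_all
  also have "\<dots> = (\<Sum>i<k. if i = j then c i else 0)"
    using on j by (intro sum.cong) (auto simp: orthonormal_at_def)
  finally show ?thesis using j by simp
qed

lemma residual_orthogonal:
  "x \<in> tangent_space A p \<Longrightarrow> j < k \<Longrightarrow> g p (residual p k e x) (e j) = 0"
  unfolding residual_def
  by (simp add: g_diff_left[OF p] orthonormal_tangent orthonormal_combination_tangent orthonormal_combination_inner)

lemma orthonormal_coords_inj:
  assumes chart: "(U, \<phi>) \<in> A" "p \<in> U" shows "inj_on (\<lambda>i. coords \<phi> (e i)) {..<k}"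
proof (rule inj_onI)
  fix i j assume ij: "i \<in> {..<k}" "j \<in> {..<k}" and "coords \<phi> (e i) = coords \<phi> (e j)"
  then have "e i = e j" using coords_inject[OF chart] orthonormal_tangent by simp
  then have "g p (e i) (e j) = g p (e j) (e j)" by simp
  then show "i = j" using on ij by (auto simp: orthonormal_at_def split: if_splits)
qed

lemma orthonormal_expand_span:
  assumes chart: "(U, \<phi>) \<in> A" "p \<in> U" and x: "x \<in> tangent_space A p"
    and span: "coords \<phi> x \<in> span ((\<lambda>i. coords \<phi> (e i)) ` {..<k})"
  shows "x = tsum (\<lambda>i. tscale (g p x (e i)) (e i)) {..<k}"
proof -
  note inj = orthonormal_coords_inj[OF chart]
  obtain u where "coords \<phi> x = (\<Sum>y\<in>(\<lambda>i. coords \<phi> (e i)) ` {..<k}. u y *\<^sub>R y)"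
    using span by (auto simp: span_finite)
  also have "\<dots> = coords \<phi> (tsum (\<lambda>i. tscale (u (coords \<phi> (e i))) (e i)) {..<k})"
    by (simp add: sum.reindex[OF inj] coords_sum coords_scale)
  finally have x_eq: "x = tsum (\<lambda>i. tscale (u (coords \<phi> (e i))) (e i)) {..<k}"
    by (rule coords_inject[OF chart x orthonormal_combination_tangent])
  have "g p x (e i) = u (coords \<phi> (e i))" if "i < k" for i
    using orthonormal_combination_inner[OF that, of "\<lambda>i. u (coords \<phi> (e i))"] x_eq by simp
  then have "tsum (\<lambda>i. tscale (g p x (e i)) (e i)) {..<k} = tsum (\<lambda>i. tscale (u (coords \<phi> (e i))) (e i)) {..<k}"
    by (auto simp: tvec_apply)
  then show ?thesis using x_eq by simp
qed

lemma orthonormal_coords_independent: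
  assumes chart: "(U, \<phi>) \<in> A" "p \<in> U"
  shows "independent ((\<lambda>i. coords \<phi> (e i)) ` {..<k})" and "card ((\<lambda>i. coords \<phi> (e i)) ` {..<k}) = k"
proof -
  note inj = orthonormal_coords_inj[OF chart]
  show "card ((\<lambda>i. coords \<phi> (e i)) ` {..<k}) = k" using inj by (simp add: card_image)
  show "independent ((\<lambda>i. coords \<phi> (e i)) ` {..<k})"
  proof (rule independent_if_scalars_zero)
    fix u y assume zero: "(\<Sum>y\<in>(\<lambda>i. coords \<phi> (e i)) ` {..<k}. u y *\<^sub>R y) = 0"
      and "y \<in> (\<lambda>i. coords \<phi> (e i)) ` {..<k}"
    then obtain j where j: "j < k" "y = coords \<phi> (e j)" by auto
    let ?s = "tsum (\<lambda>i. tscale (u (coords \<phi> (e i))) (e i)) {..<k}"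
    have "coords \<phi> ?s = coords \<phi> tzero"
      using zero by (simp add: sum.reindex[OF inj] coords_sum coords_scale) (simp add: coords_def tzero_apply)
    then have "?s = tzero"
      by (rule coords_inject[OF chart orthonormal_combination_tangent tzero_tangent])
    then show "u y = 0"
      using orthonormal_combination_inner[OF j(1), of "\<lambda>i. u (coords \<phi> (e i))"] j
      by (simp add: g_zero_left[OF p orthonormal_tangent])
  qed simp
qed

lemma ex_residual_nonzero:
  assumes k: "k < DIM('e)" shows "\<exists>x\<in>tangent_space A p. residual p k e x \<noteq> tzero"
proof (rule ccontr)
  assume none: "\<not> ?thesis"
  obtain U \<phi> where chart: "(U, \<phi>) \<in> A" "p \<in> U" using p by (rule pts_chartE)
  have "y \<in> span ((\<lambda>i. coords \<phi> (e i)) ` {..<k})" for y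
  proof -
    let ?x = "coord_vec U \<phi> p y"
    have "residual p k e ?x = tzero" using none coord_vec_tangent[OF chart] by blast
    then have "?x = tsum (\<lambda>i. tscale (g p ?x (e i)) (e i)) {..<k}"
      by (simp only: residual_def tdiff_eq_tzero_iff)
    then have "coords \<phi> ?x = coords \<phi> (tsum (\<lambda>i. tscale (g p ?x (e i)) (e i)) {..<k})" by (rule arg_cong)
    also have "\<dots> = (\<Sum>i<k. g p ?x (e i) *\<^sub>R coords \<phi> (e i))" by (simp only: coords_sum coords_scale)
    also have "\<dots> \<in> span ((\<lambda>i. coords \<phi> (e i)) ` {..<k})"
      by (intro span_sum span_scale span_base) auto
    finally show ?thesis by (simp add: coords_coord_vec[OF chart])
  qed
  then have "DIM('e) \<le> card ((\<lambda>i. coords \<phi> (e i)) ` {..<k})"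
    using dim_le_card[of UNIV "(\<lambda>i. coords \<phi> (e i)) ` {..<k}"] by auto
  then show False using card_image_le[of "{..<k}" "\<lambda>i. coords \<phi> (e i)"] k by simp
qed

lemma orthonormal_at_extend:
  assumes r: "r \<in> tangent_space A p" "g p r r > 0" "\<And>j. j < k \<Longrightarrow> g p r (e j) = 0"
  shows "orthonormal_at p (Suc k) (e(k := tscale (inverse (sqrt (g p r r))) r))"
proof -
  let ?n = "tscale (inverse (sqrt (g p r r))) r"
  have "inverse (sqrt (g p r r)) * (inverse (sqrt (g p r r)) * g p r r) = 1"
    using r(2) by (simp add: field_simps)
  then have "g p ?n ?n = 1" by (simp add: g_scale_left[OF p] g_scale_right[OF p] r(1) tscale_tangent)
  moreover have "g p ?n (e j) = 0" "g p (e j) ?n = 0" if "j < k" for j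
    using r(3)[OF that] g_sym[OF p r(1) orthonormal_tangent[OF that]]
    by (simp_all add: g_scale_left[OF p] g_scale_right[OF p] r(1) orthonormal_tangent that)
  ultimately have "g p ((e(k := ?n)) i) ((e(k := ?n)) j) = (if i = j then 1 else 0)"
    if "i < Suc k" "j < Suc k" for i j
    using on that by (cases "i = k"; cases "j = k") (simp_all add: orthonormal_at_def)
  then show ?thesis
    using r(1) orthonormal_tangent by (simp add: orthonormal_at_def less_Suc_eq tscale_tangent)
qed

end

lemma orthonormal_expand:
  assumes p: "p \<in> pts A" and e: "orthonormal_at p DIM('e) e" and x: "x \<in> tangent_space A p"
  shows "x = tsum (\<lambda>i. tscale (g p x (e i)) (e i)) {..<DIM('e)}"
proof -
  obtain U \<phi> where chart: "(U, \<phi>) \<in> A" "p \<in> U" using p by (rule pts_chartE)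
  have "UNIV \<subseteq> span ((\<lambda>i. coords \<phi> (e i)) ` {..<DIM('e)})"
    using orthonormal_coords_independent[OF p e chart] by (intro card_ge_dim_independent) auto
  then show ?thesis using orthonormal_expand_span[OF p e chart x] by auto
qed

definition orthonormal_near :: "'a \<Rightarrow> nat \<Rightarrow> (nat \<Rightarrow> 'a vfield) \<Rightarrow> bool" where
  "orthonormal_near p k E \<longleftrightarrow> (\<forall>i<k. vfield_near p (E i)) \<and>
     eventually (\<lambda>q. orthonormal_at q k (\<lambda>i. E i q)) (near p)"

abbreviation frame_near :: "'a \<Rightarrow> (nat \<Rightarrow> 'a vfield) \<Rightarrow> bool" where
  "frame_near p E \<equiv> orthonormal_near p DIM('e) E"

text \<open>One step of the Gram--Schmidt process.\<close>

lemma orthonormal_near_extend: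
  assumes p: "p \<in> pts A" and E: "orthonormal_near p k E" and k: "k < DIM('e)"
  shows "\<exists>N. orthonormal_near p (Suc k) (E(k := N))"
proof -
  have vf: "vfield_near p (E i)" if "i < k" for i using E that by (simp add: orthonormal_near_def)
  have on: "eventually (\<lambda>q. orthonormal_at q k (\<lambda>i. E i q)) (near p)" using E by (simp add: orthonormal_near_def)
  note on_p = eventually_near_imp[OF p on]
  obtain x where x: "x \<in> tangent_space A p" "residual p k (\<lambda>i. E i p) x \<noteq> tzero"
    using ex_residual_nonzero[OF p on_p k] by blast
  note X = extension_near[OF p x(1)]
  define R where "R q = residual q k (\<lambda>i. E i q) (extension p x q)" for q
  define n where "n q = inverse (sqrt (g q (R q) (R q)))" for q
  have R: "vfield_near p R"
    unfolding R_def[abs_def] residual_def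
    by (intro vfield_near_diff X vfield_near_sum p vfield_near_scale g_smooth vf) simp_all
  have R_p_pos: "g p (R p) (R p) > 0"
    using g_pos[OF p vfield_near_tangent[OF R]] x by (simp add: R_def extension_at[OF p])
  have R_pos: "eventually (\<lambda>q. g q (R q) (R q) \<in> {0<..}) (near p)"
    by (rule smooth_near_continuous[OF g_smooth[OF R R]]) (use R_p_pos in simp_all)
  have N: "vfield_near p (\<lambda>q. tscale (n q) (R q))"
    unfolding n_def[abs_def]
    by (rule vfield_near_scale[OF smooth_near_inverse_sqrt[OF g_smooth[OF R R] R_p_pos] R])
  have "eventually (\<lambda>q. orthonormal_at q (Suc k) (\<lambda>i. (E(k := \<lambda>q. tscale (n q) (R q))) i q)) (near p)"
    using eventually_near_pts on vfield_near_eventually_tangent[OF X] vfield_near_eventually_tangent[OF R]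
      R_pos
  proof eventually_elim
    case (elim q)
    have "orthonormal_at q (Suc k) ((\<lambda>i. E i q)(k := tscale (n q) (R q)))"
      unfolding n_def
      by (rule orthonormal_at_extend[OF elim(1,2,4)])
        (use elim(5) residual_orthogonal[OF elim(1,2,3)] in \<open>simp_all add: R_def\<close>)
    moreover have "(\<lambda>i. (E(k := \<lambda>q. tscale (n q) (R q))) i q) = (\<lambda>i. E i q)(k := tscale (n q) (R q))" by auto
    ultimately show ?case by simp
  qed
  then have "orthonormal_near p (Suc k) (E(k := \<lambda>q. tscale (n q) (R q)))"
    using N vf by (simp add: orthonormal_near_def less_Suc_eq)
  then show ?thesis by (rule exI[of "\<lambda>N. orthonormal_near p (Suc k) (E(k := N))"])
qed

lemma ex_frame_near:
  assumes p: "p \<in> pts A" obtains E where "frame_near p E"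
proof -
  have "\<exists>E. orthonormal_near p k E" if "k \<le> DIM('e)" for k
    using that
  proof (induction k)
    case 0
    then show ?case by (simp add: orthonormal_near_def orthonormal_at_def)
  next
    case (Suc k)
    then show ?case using orthonormal_near_extend[OF p] by (metis Suc_le_eq Suc_leD)
  qed
  then show ?thesis using that by blast
qed

lemma frame_on_imp_near:
  assumes "orthonormal_frame_on A g U E" "p \<in> U" shows "frame_near p E"
proof -
  have E: "\<And>i. i < DIM('e) \<Longrightarrow> vfield_on A U (E i)"
    and on: "\<And>q. q \<in> U \<Longrightarrow> orthonormal_at q DIM('e) (\<lambda>i. E i q)"
    using assms(1) by (simp_all add: orthonormal_frame_on_def orthonormal_at_def vfield_on_def)
  have "eventually (\<lambda>q. q \<in> U) (near p)"
    using E[OF DIM_positive] assms(2) by (intro eventually_near_in_open) (simp add: vfield_on_def)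
  then have "eventually (\<lambda>q. orthonormal_at q DIM('e) (\<lambda>i. E i q)) (near p)" by (rule eventually_mono) (rule on)
  then show ?thesis using E assms(2) by (simp add: orthonormal_near_def vfield_on_iff)
qed

context
  fixes p E assumes E: "frame_near p E"
begin

lemma frame_vfield: "i < DIM('e) \<Longrightarrow> vfield_near p (E i)"
  using E by (simp add: orthonormal_near_def)

lemma frame_pts: "p \<in> pts A"
  by (rule vfield_near_pts[OF frame_vfield[OF DIM_positive]])

lemma frame_orthonormal: "eventually (\<lambda>q. orthonormal_at q DIM('e) (\<lambda>i. E i q)) (near p)"
  using E by (simp add: orthonormal_near_def)

lemma frame_inner:
  "i < DIM('e) \<Longrightarrow> j < DIM('e) \<Longrightarrow> g p (E i p) (E j p) = (if i = j then 1 else 0)"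
  using eventually_near_imp[OF frame_pts frame_orthonormal] by (simp add: orthonormal_at_def)

lemma frame_tangent: "i < DIM('e) \<Longrightarrow> E i p \<in> tangent_space A p"
  by (rule vfield_near_tangent[OF frame_vfield])

lemma frame_expand: "x \<in> tangent_space A p \<Longrightarrow> x = tsum (\<lambda>i. tscale (g p x (E i p)) (E i p)) {..<DIM('e)}"
  by (rule orthonormal_expand[OF frame_pts eventually_near_imp[OF frame_pts frame_orthonormal]])

lemma frame_eventually: "eventually (\<lambda>q. frame_near q E) (near p)"
proof -
  have "eventually (\<lambda>q. \<forall>i\<in>{..<DIM('e)}. vfield_near q (E i)) (near p)"
    by (intro eventually_ball_finite ballI vfield_near_eventually frame_vfield) simp_all
  then show ?thesis
    using eventually_near_eventually[OF frame_orthonormal]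
    by eventually_elim (simp add: orthonormal_near_def)
qed

lemma frame_near_imp_on: "\<exists>U. p \<in> U \<and> orthonormal_frame_on A g U E"
proof -
  obtain W where "openin (mtop A) W" "p \<in> W" "\<forall>q\<in>W. frame_near q E"
    using frame_pts frame_eventually by (rule eventually_nearE)
  then show ?thesis
    using riemannian.frame_vfield[OF riemannian_axioms] riemannian.frame_inner[OF riemannian_axioms]
    by (intro exI[of _ W]) (simp add: orthonormal_frame_on_def vfield_on_iff)
qed

lemma Parseval:
  assumes x: "x \<in> tangent_space A p" and y: "y \<in> tangent_space A p"
  shows "(\<Sum>i<DIM('e). g p x (E i p) * g p (E i p) y) = g p x y"
  using covector_combination[OF covector_g_left[OF frame_pts y], of "{..<DIM('e)}" "\<lambda>i. E i p" "\<lambda>i. g p x (E i p)"]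
    frame_expand[OF x] frame_tangent by simp

lemma tensorial_frame:
  assumes "tensorial_at p B" "vfield_near p X"
  shows "B X = (\<Sum>i<DIM('e). g p (X p) (E i p) * B (E i))"
  by (rule tensorial_combination[OF assms _ frame_vfield frame_expand[OF vfield_near_tangent[OF assms(2)]]])
    simp_all

end
end

subsection \<open>Metric duals and traces\<close>

context riemannian
begin

definition metric_dual :: "'a \<Rightarrow> ('a vfield \<Rightarrow> real) \<Rightarrow> 'a tvec" where
  "metric_dual p B = (THE w. w \<in> tangent_space A p \<and> (\<forall>Z. vfield_near p Z \<longrightarrow> g p w (Z p) = B Z))"

lemma metric_dual_eqI:
  assumes p: "p \<in> pts A" and w: "w \<in> tangent_space A p" and eq: "\<And>Z. vfield_near p Z \<Longrightarrow> g p w (Z p) = B Z"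
  shows "metric_dual p B = w"
  unfolding metric_dual_def
proof (rule the_equality)
  fix w' assume "w' \<in> tangent_space A p \<and> (\<forall>Z. vfield_near p Z \<longrightarrow> g p w' (Z p) = B Z)"
  then show "w' = w" using eq by (intro g_eqI_vfield[OF p _ w]) simp_all
qed (use w eq in simp)

lemma frame_dual_inner:
  assumes E: "frame_near p E" and B: "tensorial_at p B" and Z: "vfield_near p Z"
  shows "g p (tsum (\<lambda>i. tscale (B (E i)) (E i p)) {..<DIM('e)}) (Z p) = B Z"
proof -
  note Zp = vfield_near_tangent[OF Z]
  have "g p (tsum (\<lambda>i. tscale (B (E i)) (E i p)) {..<DIM('e)}) (Z p) = (\<Sum>i<DIM('e). B (E i) * g p (E i p) (Z p))"
    by (rule covector_combination[OF covector_g_left[OF frame_pts[OF E] Zp] _ frame_tangent[OF E]]) simp_all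
  also have "\<dots> = (\<Sum>i<DIM('e). g p (Z p) (E i p) * B (E i))"
    by (intro sum.cong) (simp_all add: g_sym[OF frame_pts[OF E]] frame_tangent[OF E] Zp)
  finally show ?thesis using tensorial_frame[OF E B Z] by simp
qed

lemma metric_dual_frame:
  assumes E: "frame_near p E" and B: "tensorial_at p B"
  shows "metric_dual p B = tsum (\<lambda>i. tscale (B (E i)) (E i p)) {..<DIM('e)}"
proof (rule metric_dual_eqI[OF frame_pts[OF E]])
  show "tsum (\<lambda>i. tscale (B (E i)) (E i p)) {..<DIM('e)} \<in> tangent_space A p"
    by (intro tsum_tangent tscale_tangent frame_tangent[OF E]) simp
qed (rule frame_dual_inner[OF E B])

lemma metric_dual:
  assumes p: "p \<in> pts A" and B: "tensorial_at p B"
  shows metric_dual_tangent: "metric_dual p B \<in> tangent_space A p"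
    and metric_dual_inner: "vfield_near p Z \<Longrightarrow> g p (metric_dual p B) (Z p) = B Z"
proof -
  obtain E where E: "frame_near p E" using ex_frame_near[OF p] .
  show "metric_dual p B \<in> tangent_space A p"
    unfolding metric_dual_frame[OF E B] by (intro tsum_tangent tscale_tangent frame_tangent[OF E]) simp
  show "vfield_near p Z \<Longrightarrow> g p (metric_dual p B) (Z p) = B Z"
    unfolding metric_dual_frame[OF E B] by (rule frame_dual_inner[OF E B])
qed

lemma metric_dual_tensorial:
  assumes p: "p \<in> pts A" and B: "\<And>X. vfield_near p X \<Longrightarrow> tensorial_at p (B X)"
    and linear: "\<And>Z. vfield_near p Z \<Longrightarrow> tensorial_at p (\<lambda>X. B X Z)"
  shows "tensorial_at p (\<lambda>X. metric_dual p (B X) f)"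
proof (rule tensorialI)
  note tangent = metric_dual_tangent[OF p B] and inner = metric_dual_inner[OF p B]
  fix X assume X: "vfield_near p X"
  show "metric_dual p (B (\<lambda>q. tadd (X q) (Y q))) f = metric_dual p (B X) f + metric_dual p (B Y) f"
    if Y: "vfield_near p Y" for Y
  proof -
    have "metric_dual p (B (\<lambda>q. tadd (X q) (Y q))) = tadd (metric_dual p (B X)) (metric_dual p (B Y))"
      by (rule metric_dual_eqI[OF p])
        (simp_all add: tadd_tangent tangent X Y g_add_left[OF p] inner tensorial_add[OF linear] vfield_near_tangent)
    then show ?thesis by (simp add: tvec_apply)
  qed
  show "metric_dual p (B (\<lambda>q. tscale (h q) (X q))) f = h p * metric_dual p (B X) f"
    if h: "smooth_near A p h" for h
  proof -
    have "metric_dual p (B (\<lambda>q. tscale (h q) (X q))) = tscale (h p) (metric_dual p (B X))"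
      by (rule metric_dual_eqI[OF p])
        (simp_all add: tscale_tangent tangent X g_scale_left[OF p] inner
            tensorial_scale[OF linear h] vfield_near_tangent)
    then show ?thesis by (simp add: tvec_apply)
  qed
qed

lemma vfield_near_metric_dual:
  assumes p: "p \<in> pts A" and B: "eventually (\<lambda>q. tensorial_at q (B q)) (near p)"
    and smooth: "\<And>Z. vfield_near p Z \<Longrightarrow> smooth_near A p (\<lambda>q. B q Z)"
  shows "vfield_near p (\<lambda>q. metric_dual q (B q))"
proof -
  obtain E where E: "frame_near p E" using ex_frame_near[OF p] .
  have "vfield_near p (\<lambda>q. tsum (\<lambda>i. tscale (B q (E i)) (E i q)) {..<DIM('e)})"
    by (intro vfield_near_sum p vfield_near_scale smooth frame_vfield[OF E]) simp_all
  moreover have "eventually (\<lambda>q. tsum (\<lambda>i. tscale (B q (E i)) (E i q)) {..<DIM('e)} = metric_dual q (B q)) (near p)"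
    using B frame_eventually[OF E] by eventually_elim (rule metric_dual_frame[symmetric])
  ultimately show ?thesis by (rule vfield_near_cong)
qed

lemma trace_frame_independent:
  assumes B: "bitensorial_at p B" and E: "frame_near p E" and F: "frame_near p F"
  shows "(\<Sum>i<DIM('e). B (F i) (F i)) = (\<Sum>i<DIM('e). B (E i) (E i))"
proof -
  let ?n = "{..<DIM('e)}" and ?c = "\<lambda>i a. g p (F i p) (E a p)"
  note p = frame_pts[OF E] and tE = frame_tangent[OF E] and tF = frame_tangent[OF F]
  have "B (F i) (F i) = (\<Sum>a\<in>?n. \<Sum>b\<in>?n. ?c i a * ?c i b * B (E a) (E b))" if "i \<in> ?n" for i
  proof -
    note Fi = frame_vfield[OF F that[unfolded lessThan_iff]]
    have "B (F i) (F i) = (\<Sum>a\<in>?n. ?c i a * B (E a) (F i))"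
      by (rule tensorial_frame[OF E bitensorial_left[OF B Fi] Fi])
    also have "\<dots> = (\<Sum>a\<in>?n. ?c i a * (\<Sum>b\<in>?n. ?c i b * B (E a) (E b)))"
      by (intro sum.cong refl arg_cong[of _ _ "(*) _"]
          tensorial_frame[OF E bitensorial_right[OF B frame_vfield[OF E]] Fi]) simp
    finally show ?thesis by (simp add: sum_distrib_left mult.assoc)
  qed
  then have "(\<Sum>i\<in>?n. B (F i) (F i)) = (\<Sum>i\<in>?n. \<Sum>a\<in>?n. \<Sum>b\<in>?n. ?c i a * ?c i b * B (E a) (E b))"
    by (rule sum.cong[OF refl])
  also have "\<dots> = (\<Sum>a\<in>?n. \<Sum>b\<in>?n. \<Sum>i\<in>?n. ?c i a * ?c i b * B (E a) (E b))"
    by (subst sum.swap, rule sum.cong[OF refl], rule sum.swap)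
  also have "\<dots> = (\<Sum>a\<in>?n. \<Sum>b\<in>?n. if a = b then B (E a) (E b) else 0)"
  proof (intro sum.cong refl)
    fix a b assume ab: "a \<in> ?n" "b \<in> ?n"
    have "(\<Sum>i\<in>?n. ?c i a * ?c i b) = (\<Sum>i\<in>?n. g p (E a p) (F i p) * g p (F i p) (E b p))"
      using ab by (intro sum.cong refl) (simp add: g_sym[OF p tF tE])
    also have "\<dots> = (if a = b then 1 else 0)"
      using ab by (simp add: Parseval[OF F tE tE] frame_inner[OF E])
    finally show "(\<Sum>i\<in>?n. ?c i a * ?c i b * B (E a) (E b)) = (if a = b then B (E a) (E b) else 0)"
      by (simp add: sum_distrib_right[symmetric])
  qed
  finally show ?thesis by simp
qed

definition tensor_at :: "'a \<Rightarrow> ('a vfield \<Rightarrow> 'a vfield \<Rightarrow> 'a vfield) \<Rightarrow> bool" where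
  "tensor_at p \<gamma> \<longleftrightarrow> (\<forall>X Y. vfield_near p X \<and> vfield_near p Y \<longrightarrow> \<gamma> X Y p \<in> tangent_space A p) \<and>
     (\<forall>f. bitensorial_at p (\<lambda>X Y. \<gamma> X Y p f))"

lemma tensor_tangent:
  "tensor_at p \<gamma> \<Longrightarrow> vfield_near p X \<Longrightarrow> vfield_near p Y \<Longrightarrow> \<gamma> X Y p \<in> tangent_space A p"
  by (simp add: tensor_at_def)

lemma tensor_left: "tensor_at p \<gamma> \<Longrightarrow> vfield_near p Y \<Longrightarrow> tensorial_at p (\<lambda>X. \<gamma> X Y p f)"
  and tensor_right: "tensor_at p \<gamma> \<Longrightarrow> vfield_near p X \<Longrightarrow> tensorial_at p (\<lambda>Y. \<gamma> X Y p f)"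
  by (simp_all add: tensor_at_def bitensorial_at_def)

lemma tensor_at_diff:
  assumes "tensor_at p \<gamma>" "tensor_at p \<delta>"
  shows "tensor_at p (\<lambda>X Y q. tdiff (\<gamma> X Y q) (\<delta> X Y q))"
  using assms by (simp add: tensor_at_def bitensorial_at_def tdiff_tangent tdiff_apply tensorial_diff)

lemma metric_trace_frame:
  assumes \<gamma>: "tensor_at p \<gamma>" and E: "frame_near p E"
  shows "metric_trace A g \<gamma> p = tsum (\<lambda>i. \<gamma> (E i) (E i) p) {..<DIM('e)}"
  unfolding metric_trace_def
proof (rule the_equality)
  have B: "bitensorial_at p (\<lambda>X Y. \<gamma> X Y p f)" for f using \<gamma> by (simp add: tensor_at_def)
  show "\<forall>V F. p \<in> V \<and> orthonormal_frame_on A g V F \<longrightarrow>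
      tsum (\<lambda>i. \<gamma> (E i) (E i) p) {..<DIM('e)} = tsum (\<lambda>i. \<gamma> (F i) (F i) p) {..<DIM('e)}"
  proof (intro allI impI ext, elim conjE)
    fix V F f assume "p \<in> V" "orthonormal_frame_on A g V F"
    from trace_frame_independent[OF B frame_on_imp_near[OF this(2,1)] E]
    show "tsum (\<lambda>i. \<gamma> (E i) (E i) p) {..<DIM('e)} f = tsum (\<lambda>i. \<gamma> (F i) (F i) p) {..<DIM('e)} f"
      by (simp only: tsum_apply)
  qed
qed (use frame_near_imp_on[OF E] in blast)

lemma metric_trace_tangent:
  assumes p: "p \<in> pts A" and \<gamma>: "tensor_at p \<gamma>" shows "metric_trace A g \<gamma> p \<in> tangent_space A p"
proof -
  obtain E where E: "frame_near p E" using ex_frame_near[OF p] .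
  show ?thesis
    unfolding metric_trace_frame[OF \<gamma> E] by (intro tsum_tangent tensor_tangent[OF \<gamma>] frame_vfield[OF E]) simp_all
qed

lemma metric_trace_diff:
  assumes p: "p \<in> pts A" and \<gamma>: "tensor_at p \<gamma>" and \<delta>: "tensor_at p \<delta>"
  shows "metric_trace A g (\<lambda>X Y q. tdiff (\<gamma> X Y q) (\<delta> X Y q)) p =
    tdiff (metric_trace A g \<gamma> p) (metric_trace A g \<delta> p)"
proof -
  obtain E where E: "frame_near p E" using ex_frame_near[OF p] .
  show ?thesis
    unfolding metric_trace_frame[OF \<gamma> E] metric_trace_frame[OF \<delta> E] metric_trace_frame[OF tensor_at_diff[OF \<gamma> \<delta>] E]
    by (rule ext) (simp add: tvec_apply sum_subtractf)
qed

subsection \<open>Adjoint tensors\<close>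

context
  fixes \<gamma> p assumes p: "p \<in> pts A" and \<gamma>: "tensor_at p \<gamma>"
begin

lemma adjoint_tensor_eq_dual:
  "adjoint_tensor A g \<gamma> X Y p = metric_dual p (\<lambda>Z. g p (Y p) (\<gamma> X Z p))"
  unfolding adjoint_tensor_def metric_dual_def
  by (rule arg_cong[of _ _ The]) (auto simp: vfield_near_def)

lemma inner_tensor_tensorial:
  assumes X: "vfield_near p X" and y: "y \<in> tangent_space A p"
  shows "tensorial_at p (\<lambda>Z. g p y (\<gamma> X Z p))" and "tensorial_at p (\<lambda>Z. g p y (\<gamma> Z X p))"
  using tensorial_covector[where B = "\<lambda>Z. \<gamma> X Z p", OF covector_g_right[OF p y] tensor_right[OF \<gamma> X]
      tensor_tangent[OF \<gamma> X]]
    tensorial_covector[where B = "\<lambda>Z. \<gamma> Z X p", OF covector_g_right[OF p y] tensor_left[OF \<gamma> X]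
        tensor_tangent[OF \<gamma> _ X]]
  by simp_all

lemma tensor_at_adjoint: "tensor_at p (adjoint_tensor A g \<gamma>)"
proof -
  have dual: "tensorial_at p (\<lambda>Z. g p (Y p) (\<gamma> X Z p))" if "vfield_near p X" "vfield_near p Y" for X Y
    by (rule inner_tensor_tensorial(1)[OF that(1) vfield_near_tangent[OF that(2)]])
  have "tensorial_at p (\<lambda>X. adjoint_tensor A g \<gamma> X Y p f)" if Y: "vfield_near p Y" for Y f
    unfolding adjoint_tensor_eq_dual
    by (rule metric_dual_tensorial[OF p dual[OF _ Y] inner_tensor_tensorial(2)[OF _ vfield_near_tangent[OF Y]]])
  moreover have "tensorial_at p (\<lambda>Y. adjoint_tensor A g \<gamma> X Y p f)" if X: "vfield_near p X" for X f
    unfolding adjoint_tensor_eq_dual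
  proof (rule metric_dual_tensorial[OF p dual[OF X]])
    show "tensorial_at p (\<lambda>Y. g p (Y p) (\<gamma> X Z p))" if Z: "vfield_near p Z" for Z
      by (rule tensorial_eval[OF covector_g_left[OF p tensor_tangent[OF \<gamma> X Z]]])
  qed
  ultimately show ?thesis
    using metric_dual_tangent[OF p dual] by (simp add: tensor_at_def bitensorial_at_def adjoint_tensor_eq_dual)
qed

lemma adjoint_tensor_inner:
  assumes "vfield_near p X" "vfield_near p Y" "vfield_near p Z"
  shows "g p (adjoint_tensor A g \<gamma> X Y p) (Z p) = g p (Y p) (\<gamma> X Z p)"
  unfolding adjoint_tensor_eq_dual
  by (rule metric_dual_inner[OF p inner_tensor_tensorial(1)[OF assms(1) vfield_near_tangent[OF assms(2)]] assms(3)])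

end

end

section \<open>The Levi-Civita connection\<close>

context riemannian
begin

definition koszul :: "'a vfield \<Rightarrow> 'a vfield \<Rightarrow> 'a vfield \<Rightarrow> 'a \<Rightarrow> real" where
  "koszul X Y Z p = X p (\<lambda>q. g q (Y q) (Z q)) + Y p (\<lambda>q. g q (Z q) (X q)) - Z p (\<lambda>q. g q (X q) (Y q))
     + g p (lie_bracket A X Y p) (Z p) - g p (lie_bracket A Y Z p) (X p) + g p (lie_bracket A Z X p) (Y p)"

lemma g_derivative_add:
  assumes V: "vfield_near p V" and X: "vfield_near p X" and Y: "vfield_near p Y" and Z: "vfield_near p Z"
  shows "V p (\<lambda>q. g q (tadd (X q) (Y q)) (Z q)) = V p (\<lambda>q. g q (X q) (Z q)) + V p (\<lambda>q. g q (Y q) (Z q))"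
    and "V p (\<lambda>q. g q (Z q) (tadd (X q) (Y q))) = V p (\<lambda>q. g q (Z q) (X q)) + V p (\<lambda>q. g q (Z q) (Y q))"
  using form1_derivative_add[OF form2_near_left[OF form2_near_g Z] V X Y]
    form1_derivative_add[OF form2_near_right[OF form2_near_g Z] V X Y] .

lemma g_derivative_scale:
  assumes V: "vfield_near p V" and f: "smooth_near A p f" and X: "vfield_near p X" and Z: "vfield_near p Z"
  shows "V p (\<lambda>q. g q (tscale (f q) (X q)) (Z q)) = f p * V p (\<lambda>q. g q (X q) (Z q)) + g p (X p) (Z p) * V p f"
    and "V p (\<lambda>q. g q (Z q) (tscale (f q) (X q))) = f p * V p (\<lambda>q. g q (Z q) (X q)) + g p (Z p) (X p) * V p f"
  using form1_derivative_scale[OF form2_near_left[OF form2_near_g Z] V f X]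
    form1_derivative_scale[OF form2_near_right[OF form2_near_g Z] V f X] .

context
  fixes p assumes p: "p \<in> pts A"
begin

lemmas koszul_simps = koszul_def tvec_apply(2,3) g_derivative_add g_derivative_scale
  g_add_left[OF p] g_add_right[OF p] g_diff_left[OF p] covector_diff[OF covector_g_right[OF p]]
  g_scale_left[OF p] g_scale_right[OF p]
  bracket_add_left bracket_add_right bracket_scale_left bracket_scale_right
  vfield_near_tangent bracket_tangent tscale_tangent tadd_tangent algebra_simps

lemma koszul_tensorial_left:
  assumes Y: "vfield_near p Y" and Z: "vfield_near p Z" shows "tensorial_at p (\<lambda>X. koszul X Y Z p)"
proof (rule tensorialI)
  fix X assume X: "vfield_near p X"
  note sym = g_sym[OF p vfield_near_tangent[OF X] vfield_near_tangent[OF Z]]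
  show "koszul (\<lambda>q. tadd (X q) (X' q)) Y Z p = koszul X Y Z p + koszul X' Y Z p" if "vfield_near p X'" for X'
    using X that Y Z by (simp add: koszul_simps)
  show "koszul (\<lambda>q. tscale (f q) (X q)) Y Z p = f p * koszul X Y Z p" if "smooth_near A p f" for f
    using X that Y Z sym by (simp add: koszul_simps)
qed

lemma koszul_tensorial_right:
  assumes X: "vfield_near p X" and Y: "vfield_near p Y" shows "tensorial_at p (\<lambda>Z. koszul X Y Z p)"
proof (rule tensorialI)
  fix Z assume Z: "vfield_near p Z"
  note sym = g_sym[OF p vfield_near_tangent[OF Z] vfield_near_tangent[OF Y]]
  show "koszul X Y (\<lambda>q. tadd (Z q) (Z' q)) p = koszul X Y Z p + koszul X Y Z' p" if "vfield_near p Z'" for Z'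
    using Z that X Y by (simp add: koszul_simps)
  show "koszul X Y (\<lambda>q. tscale (f q) (Z q)) p = f p * koszul X Y Z p" if "smooth_near A p f" for f
    using Z that X Y sym by (simp add: koszul_simps)
qed

context
  fixes X Y Z assumes X: "vfield_near p X" and Y: "vfield_near p Y" and Z: "vfield_near p Z"
begin

lemma koszul_add_middle:
  "vfield_near p Y' \<Longrightarrow> koszul X (\<lambda>q. tadd (Y q) (Y' q)) Z p = koszul X Y Z p + koszul X Y' Z p"
  using X Y Z by (simp add: koszul_simps)

lemma koszul_scale_middle:
  "smooth_near A p f \<Longrightarrow>
    koszul X (\<lambda>q. tscale (f q) (Y q)) Z p = f p * koszul X Y Z p + 2 * X p f * g p (Y p) (Z p)"
  using X Y Z g_sym[OF p vfield_near_tangent[OF X] vfield_near_tangent[OF Y]] by (simp add: koszul_simps)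

lemma koszul_antisym: "koszul X Y Z p - koszul Y X Z p = 2 * g p (lie_bracket A X Y p) (Z p)"
  using X Y Z g_derivative_sym[OF X Y Z] g_derivative_sym[OF Z Y X] g_derivative_sym[OF X Z Y]
    bracket_antisym[of Y X p] bracket_antisym[of X Z p] bracket_antisym[of Z Y p]
  by (simp add: koszul_simps)

lemma koszul_sym: "koszul X Y Z p + koszul X Z Y p = 2 * X p (\<lambda>q. g q (Y q) (Z q))"
  using X Y Z g_derivative_sym[OF X Y Z] g_derivative_sym[OF Z Y X] g_derivative_sym[OF X Z Y]
    bracket_antisym[of Y X p] bracket_antisym[of X Z p] bracket_antisym[of Z Y p]
  by (simp add: koszul_simps)

lemma koszul_smooth: "smooth_near A p (koszul X Y Z)"
proof -
  note derivative = vfield_near_smooth[OF _ g_smooth] and bracket = g_smooth[OF vfield_near_bracket]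
  show ?thesis
    unfolding koszul_def[abs_def]
    by (rule smooth_near_add[OF smooth_near_diff[OF smooth_near_add[OF smooth_near_diff[OF smooth_near_add
            [OF derivative[OF X Y Z] derivative[OF Y Z X]] derivative[OF Z X Y]]
            bracket[OF X Y Z]] bracket[OF Y Z X]] bracket[OF Z X Y]])
qed

end

end

text \<open>Koszul's formula determines \<open>g (D\<^sub>X Y) Z\<close>, hence \<open>D\<^sub>X Y\<close> by duality.\<close>

definition koszul_connection :: "'a vfield \<Rightarrow> 'a vfield \<Rightarrow> 'a vfield" where
  "koszul_connection X Y p = metric_dual p (\<lambda>Z. (1/2) * koszul X Y Z p)"

lemma half_koszul_tensorial:
  "vfield_near p X \<Longrightarrow> vfield_near p Y \<Longrightarrow> tensorial_at p (\<lambda>Z. (1/2) * koszul X Y Z p)"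
  by (rule tensorial_cmult[OF koszul_tensorial_right[OF vfield_near_pts]])

lemma koszul_connection_tangent:
  "vfield_near p X \<Longrightarrow> vfield_near p Y \<Longrightarrow> koszul_connection X Y p \<in> tangent_space A p"
  unfolding koszul_connection_def by (rule metric_dual_tangent[OF vfield_near_pts half_koszul_tensorial])

lemma koszul_connection_inner:
  "vfield_near p X \<Longrightarrow> vfield_near p Y \<Longrightarrow> vfield_near p Z \<Longrightarrow>
    g p (koszul_connection X Y p) (Z p) = (1/2) * koszul X Y Z p"
  unfolding koszul_connection_def by (rule metric_dual_inner[OF vfield_near_pts half_koszul_tensorial])

lemma connection_koszul_connection: "connection A koszul_connection"
proof (rule connectionI)
  fix p X Y assume X: "vfield_near p X" and Y: "vfield_near p Y"
  note p = vfield_near_pts[OF X] and tangent = koszul_connection_tangent and inner = koszul_connection_inner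
  show "vfield_near p (koszul_connection X Y)"
    unfolding koszul_connection_def[abs_def]
  proof (rule vfield_near_metric_dual[OF p])
    show "eventually (\<lambda>q. tensorial_at q (\<lambda>Z. (1/2) * koszul X Y Z q)) (near p)"
      using vfield_near_eventually[OF X] vfield_near_eventually[OF Y]
      by eventually_elim (rule half_koszul_tensorial)
    show "smooth_near A p (\<lambda>q. (1/2) * koszul X Y Z q)" if Z: "vfield_near p Z" for Z
      by (rule smooth_near_cmult[OF koszul_smooth[OF p X Y Z]])
  qed
  have left: "tensorial_at p (\<lambda>X. koszul_connection X Y p f)" for f
    unfolding koszul_connection_def
    by (rule metric_dual_tensorial[OF p half_koszul_tensorial[OF _ Y]
          tensorial_cmult[OF koszul_tensorial_left[OF p Y]]])
  show "koszul_connection (\<lambda>q. tadd (X q) (X' q)) Y p = tadd (koszul_connection X Y p) (koszul_connection X' Y p)"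
    if "vfield_near p X'" for X'
    by (rule ext) (simp only: tensorial_add[OF left X that] tvec_apply)
  show "koszul_connection (\<lambda>q. tscale (f q) (X q)) Y p = tscale (f p) (koszul_connection X Y p)"
    if "smooth_near A p f" for f
    by (rule ext) (simp only: tensorial_scale[OF left that X] tvec_apply)
  show "koszul_connection X (\<lambda>q. tadd (Y q) (Y' q)) p = tadd (koszul_connection X Y p) (koszul_connection X Y' p)"
    if Y': "vfield_near p Y'" for Y'
    unfolding koszul_connection_def[of X "\<lambda>q. tadd (Y q) (Y' q)"]
    by (rule metric_dual_eqI[OF p])
      (simp_all add: tadd_tangent tangent inner X Y Y' g_add_left[OF p] vfield_near_tangent
        koszul_add_middle[OF p X Y] algebra_simps)
  show "koszul_connection X (\<lambda>q. tscale (f q) (Y q)) p =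
      tadd (tscale (X p f) (Y p)) (tscale (f p) (koszul_connection X Y p))"
    if f: "smooth_near A p f" for f
    unfolding koszul_connection_def[of X "\<lambda>q. tscale (f q) (Y q)"]
    by (rule metric_dual_eqI[OF p])
      (simp_all add: tadd_tangent tscale_tangent tangent inner X Y f g_add_left[OF p] g_scale_left[OF p]
        vfield_near_tangent koszul_scale_middle[OF p X Y] algebra_simps)
qed

lemma torsion_free_koszul_connection: "torsion_free A koszul_connection"
  unfolding torsion_free_iff
proof (intro allI impI, elim conjE)
  fix p X Y assume X: "vfield_near p X" and Y: "vfield_near p Y"
  note p = vfield_near_pts[OF X] and tangent = koszul_connection_tangent[OF X Y] koszul_connection_tangent[OF Y X]
  show "tdiff (koszul_connection X Y p) (koszul_connection Y X p) = lie_bracket A X Y p"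
  proof (rule g_eqI_vfield[OF p tdiff_tangent[OF tangent] bracket_tangent[OF X Y]])
    fix Z assume Z: "vfield_near p Z"
    show "g p (tdiff (koszul_connection X Y p) (koszul_connection Y X p)) (Z p) = g p (lie_bracket A X Y p) (Z p)"
      unfolding g_diff_left[OF p vfield_near_tangent[OF Z] tangent]
        koszul_connection_inner[OF X Y Z] koszul_connection_inner[OF Y X Z]
      using koszul_antisym[OF p X Y Z] by simp
  qed
qed

lemma metric_connection_iff:
  "metric_connection A g D \<longleftrightarrow> (\<forall>p X Y Z. vfield_near p X \<and> vfield_near p Y \<and> vfield_near p Z \<longrightarrow>
     X p (\<lambda>q. g q (Y q) (Z q)) = g p (D X Y p) (Z p) + g p (Y p) (D X Z p))"
proof
  assume metric: "metric_connection A g D"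
  show "\<forall>p X Y Z. vfield_near p X \<and> vfield_near p Y \<and> vfield_near p Z \<longrightarrow>
     X p (\<lambda>q. g q (Y q) (Z q)) = g p (D X Y p) (Z p) + g p (Y p) (D X Z p)"
  proof (intro allI impI, elim conjE)
    fix p X Y Z assume near: "vfield_near p X" "vfield_near p Y" "vfield_near p Z"
    obtain W where "p \<in> W" "\<forall>V\<in>{X, Y, Z}. vfield_on A W V"
      by (rule common_domainE[OF vfield_near_pts[OF near(1)], of "{X, Y, Z}" "{}"]) (use near in simp_all)
    then show "X p (\<lambda>q. g q (Y q) (Z q)) = g p (D X Y p) (Z p) + g p (Y p) (D X Z p)"
      using metric by (simp add: metric_connection_def)
  qed
qed (simp add: metric_connection_def vfield_on_iff)

lemma metric_connection_koszul_connection: "metric_connection A g koszul_connection"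
  unfolding metric_connection_iff
proof (intro allI impI, elim conjE)
  fix p X Y Z assume X: "vfield_near p X" and Y: "vfield_near p Y" and Z: "vfield_near p Z"
  show "X p (\<lambda>q. g q (Y q) (Z q)) = g p (koszul_connection X Y p) (Z p) + g p (Y p) (koszul_connection X Z p)"
    unfolding g_sym[OF vfield_near_pts[OF X] vfield_near_tangent[OF Y] koszul_connection_tangent[OF X Z]]
      koszul_connection_inner[OF X Y Z] koszul_connection_inner[OF X Z Y]
    using koszul_sym[OF vfield_near_pts[OF X] X Y Z] by simp
qed

abbreviation LC :: "'a vfield \<Rightarrow> 'a vfield \<Rightarrow> 'a vfield" where
  "LC \<equiv> levi_civita A g"

lemma levi_civita:
  shows connection_LC: "connection A LC" and torsion_free_LC: "torsion_free A LC"
    and metric_connection_LC: "metric_connection A g LC"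
proof -
  have "\<exists>D. connection A D \<and> torsion_free A D \<and> metric_connection A g D"
    using connection_koszul_connection torsion_free_koszul_connection metric_connection_koszul_connection by blast
  then have "connection A LC \<and> torsion_free A LC \<and> metric_connection A g LC"
    unfolding levi_civita_def by (rule someI_ex)
  then show "connection A LC" "torsion_free A LC" "metric_connection A g LC" by simp_all
qed

lemma LC_metric:
  "vfield_near p X \<Longrightarrow> vfield_near p Y \<Longrightarrow> vfield_near p Z \<Longrightarrow>
    X p (\<lambda>q. g q (Y q) (Z q)) = g p (LC X Y p) (Z p) + g p (Y p) (LC X Z p)"
  using metric_connection_LC unfolding metric_connection_iff by simp

lemmas LC_tangent = connection_tangent[OF connection_LC]

lemma LC_norm_derivative:
  assumes X: "vfield_near p X" and Y: "vfield_near p Y"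
  shows "X p (\<lambda>q. g q (Y q) (Y q)) = 2 * g p (LC X Y p) (Y p)"
  using LC_metric[OF X Y Y] g_sym[OF vfield_near_pts[OF X] LC_tangent[OF X Y] vfield_near_tangent[OF Y]] by simp

lemma LC_diagonal_inner:
  assumes Z: "vfield_near p Z" and W: "vfield_near p W"
  shows "g p (LC Z Z p) (W p) =
    Z p (\<lambda>q. g q (Z q) (W q)) - W p (\<lambda>q. g q (Z q) (Z q)) / 2 + g p (lie_bracket A W Z p) (Z p)"
proof -
  note p = vfield_near_pts[OF Z] and Zp = vfield_near_tangent[OF Z]
  have "g p (lie_bracket A W Z p) (Z p) = g p (LC W Z p) (Z p) - g p (LC Z W p) (Z p)"
    unfolding torsion_free_bracket[OF torsion_free_LC W Z, symmetric]
    by (rule g_diff_left[OF p Zp LC_tangent[OF W Z] LC_tangent[OF Z W]])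
  then show ?thesis
    using LC_metric[OF Z Z W] LC_norm_derivative[OF W Z] g_sym[OF p Zp LC_tangent[OF Z W]] by simp
qed

lemma cov_deriv_fundamental_form:
  assumes Z: "vfield_near p Z" and JZ: "vfield_near p (\<lambda>q. J q (Z q))" and X: "vfield_near p X"
    and skew: "\<And>x y. x \<in> tangent_space A p \<Longrightarrow> y \<in> tangent_space A p \<Longrightarrow> g p (J p x) y = - g p x (J p y)"
  shows "cov_deriv_form2 LC (fundamental_form J g) Z Z X p =
    g p (LC Z (\<lambda>q. J q (Z q)) p) (X p) + g p (LC Z Z p) (J p (X p))"
  unfolding cov_deriv_form2_def fundamental_form_def
  using LC_metric[OF Z JZ X] skew[OF LC_tangent[OF Z Z] vfield_near_tangent[OF X]] by simp

lemma codiff2_frame: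
  assumes w: "form2_near p w" and E: "frame_near p E" and X: "vfield_near p X"
  shows "codiff2 A g w p (X p) = - (\<Sum>i<DIM('e). cov_deriv_form2 LC w (E i) (E i) X p)"
  unfolding codiff2_def
proof (rule the_equality)
  show "\<forall>U F Y. p \<in> U \<and> orthonormal_frame_on A g U F \<and> vfield_on A U Y \<and> Y p = X p \<longrightarrow>
      - (\<Sum>i<DIM('e). cov_deriv_form2 LC w (E i) (E i) X p) = - (\<Sum>i<DIM('e). cov_deriv_form2 LC w (F i) (F i) Y p)"
  proof (intro allI impI, elim conjE)
    fix U F Y assume F: "p \<in> U" "orthonormal_frame_on A g U F" and Y: "vfield_on A U Y" "Y p = X p"
    note Y_near = vfield_on_imp_near[OF Y(1) F(1)]
    have "(\<Sum>i<DIM('e). cov_deriv_form2 LC w (F i) (F i) Y p) = (\<Sum>i<DIM('e). cov_deriv_form2 LC w (E i) (E i) Y p)"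
      by (rule trace_frame_independent[OF cov_deriv_bitensorial[OF connection_LC w Y_near] E
          frame_on_imp_near[OF F(2,1)]])
    also have "\<dots> = (\<Sum>i<DIM('e). cov_deriv_form2 LC w (E i) (E i) X p)"
    proof (rule sum.cong[OF refl])
      fix i assume "i \<in> {..<DIM('e)}"
      then have Ei: "vfield_near p (E i)" using frame_vfield[OF E] by simp
      show "cov_deriv_form2 LC w (E i) (E i) Y p = cov_deriv_form2 LC w (E i) (E i) X p"
        by (rule tensorial_eq_at[OF cov_deriv_tensorial_right[OF connection_LC w Ei Ei] Y_near X Y(2)])
    qed
    finally show "- (\<Sum>i<DIM('e). cov_deriv_form2 LC w (E i) (E i) X p) =
        - (\<Sum>i<DIM('e). cov_deriv_form2 LC w (F i) (F i) Y p)"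
      by simp
  qed
  fix c assume c: "\<forall>U F Y. p \<in> U \<and> orthonormal_frame_on A g U F \<and> vfield_on A U Y \<and> Y p = X p \<longrightarrow>
      c = - (\<Sum>i<DIM('e). cov_deriv_form2 LC w (F i) (F i) Y p)"
  have "eventually (\<lambda>q. frame_near q E \<and> vfield_near q X) (near p)"
    by (rule eventually_conj[OF frame_eventually[OF E] vfield_near_eventually[OF X]])
  then obtain W where "openin (mtop A) W" "p \<in> W" "\<forall>q\<in>W. frame_near q E \<and> vfield_near q X"
    using frame_pts[OF E] by (elim eventually_nearE[rotated])
  then have "p \<in> W \<and> orthonormal_frame_on A g W E \<and> vfield_on A W X \<and> X p = X p"
    using frame_vfield frame_inner by (simp add: orthonormal_frame_on_def vfield_on_iff)
  then show "c = - (\<Sum>i<DIM('e). cov_deriv_form2 LC w (E i) (E i) X p)" using c by blast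
qed

end

section \<open>Closedness of the trace of a flat connection\<close>

context riemannian
begin

context
  fixes D p E assumes D: "connection A D" and E: "frame_near p E"
begin

lemma connection_coefficient_smooth:
  assumes "vfield_near p Y" "i < DIM('e)" "j < DIM('e)"
  shows "smooth_near A p (\<lambda>q. g q (D Y (E i) q) (E j q))"
  by (rule g_smooth[OF connection_near[OF D assms(1) frame_vfield[OF E assms(2)]] frame_vfield[OF E assms(3)]])

lemma connection_coefficient_derivative:
  assumes X: "vfield_near p X" and Y: "vfield_near p Y" and i: "i < DIM('e)" and j: "j < DIM('e)"
  shows "X p (\<lambda>q. g q (D Y (E i) q) (E j q)) = g p (D X (D Y (E i)) p) (E j p)
    - (\<Sum>k<DIM('e). g p (D Y (E i) p) (E k p) * g p (D X (E k) p) (E j p))"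
proof -
  let ?n = "{..<DIM('e)}"
  define c where "c k q = g q (D Y (E i) q) (E k q)" for k q
  note vf = frame_vfield[OF E, OF lessThan_iff[THEN iffD1]]
  note DY = connection_near[OF D Y frame_vfield[OF E i]]
  note p = frame_pts[OF E] and Ej = frame_tangent[OF E j]
  have c: "smooth_near A p (c k)" if "k \<in> ?n" for k
    unfolding c_def[abs_def] using connection_coefficient_smooth[OF Y i] that by simp
  have "eventually (\<lambda>q. D Y (E i) q = tsum (\<lambda>k. tscale (c k q) (E k q)) ?n) (near p)"
    using frame_eventually[OF E] vfield_near_eventually_tangent[OF DY]
    unfolding c_def by eventually_elim (rule frame_expand)
  then have "D X (D Y (E i)) p = D X (\<lambda>q. tsum (\<lambda>k. tscale (c k q) (E k q)) ?n) p"
    by (rule connection_cong_right[OF D X DY])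
  also have "\<dots> = tsum (\<lambda>k. tadd (tscale (X p (c k)) (E k p)) (tscale (c k p) (D X (E k) p))) ?n"
    by (rule connection_combination_right[OF D X _ c vf]) simp_all
  finally have "g p (D X (D Y (E i)) p) (E j p) =
      g p (tsum (\<lambda>k. tadd (tscale (X p (c k)) (E k p)) (tscale (c k p) (D X (E k) p))) ?n) (E j p)"
    by simp
  also have "\<dots> = (\<Sum>k\<in>?n. X p (c k) * g p (E k p) (E j p) + c k p * g p (D X (E k) p) (E j p))"
  proof (subst covector_sum[OF covector_g_left[OF p Ej]])
    show "tadd (tscale (X p (c k)) (E k p)) (tscale (c k p) (D X (E k) p)) \<in> tangent_space A p" if "k \<in> ?n" for k
      by (intro tadd_tangent tscale_tangent vfield_near_tangent[OF vf[OF that]]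
          connection_tangent[OF D X vf[OF that]])
  qed (simp_all add: g_add_left[OF p] g_scale_left[OF p] Ej tscale_tangent frame_tangent[OF E]
      connection_tangent[OF D X vf])
  also have "\<dots> = X p (c j) + (\<Sum>k\<in>?n. c k p * g p (D X (E k) p) (E j p))"
    using j by (simp add: sum.distrib frame_inner[OF E] if_distrib[of "(*) _"] sum.delta cong: if_cong)
  finally show ?thesis by (simp add: c_def[abs_def])
qed

lemma connection_trace_derivative:
  assumes X: "vfield_near p X" and Y: "vfield_near p Y"
  shows "X p (\<lambda>q. \<Sum>i<DIM('e). g q (D Y (E i) q) (E i q)) = (\<Sum>i<DIM('e). g p (D X (D Y (E i)) p) (E i p))
    - (\<Sum>i<DIM('e). \<Sum>k<DIM('e). g p (D Y (E i) p) (E k p) * g p (D X (E k) p) (E i p))"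
proof -
  have "X p (\<lambda>q. \<Sum>i<DIM('e). g q (D Y (E i) q) (E i q)) = (\<Sum>i<DIM('e). X p (\<lambda>q. g q (D Y (E i) q) (E i q)))"
    by (rule tangent_sum[OF vfield_near_tangent[OF X] frame_pts[OF E]]) (simp add: connection_coefficient_smooth Y)
  then show ?thesis by (simp add: connection_coefficient_derivative X Y sum_subtractf)
qed

text \<open>The exterior derivative of the trace of the connection matrix is the trace of the curvature.\<close>

lemma flat_connection_trace_closed:
  assumes flat: "flat A D" and X: "vfield_near p X" and Y: "vfield_near p Y"
  shows "X p (\<lambda>q. \<Sum>i<DIM('e). g q (D Y (E i) q) (E i q)) - Y p (\<lambda>q. \<Sum>i<DIM('e). g q (D X (E i) q) (E i q)) =
    (\<Sum>i<DIM('e). g p (D (lie_bracket A X Y) (E i) p) (E i p))"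
proof -
  have "(\<Sum>i<DIM('e). \<Sum>k<DIM('e). g p (D Y (E i) p) (E k p) * g p (D X (E k) p) (E i p)) =
      (\<Sum>i<DIM('e). \<Sum>k<DIM('e). g p (D X (E i) p) (E k p) * g p (D Y (E k) p) (E i p))"
    by (subst sum.swap) (simp add: mult.commute)
  moreover have "g p (D X (D Y (E i)) p) (E i p) - g p (D Y (D X (E i)) p) (E i p) =
      g p (D (lie_bracket A X Y) (E i) p) (E i p)" if "i < DIM('e)" for i
  proof -
    note Ei = frame_vfield[OF E that]
    note DD = connection_tangent[OF D X connection_near[OF D Y Ei]]
      connection_tangent[OF D Y connection_near[OF D X Ei]]
    show ?thesis
      unfolding flat_commute[OF flat X Y Ei, symmetric]
      by (rule g_diff_left[OF frame_pts[OF E] vfield_near_tangent[OF Ei] DD, symmetric])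
  qed
  ultimately show ?thesis
    by (simp add: connection_trace_derivative X Y sum_subtractf[symmetric])
qed

end

end

section \<open>Koszul forms\<close>

locale riemannian_connection = riemannian A g + affine_connection A nab
  for A :: "('a, 'e::euclidean_space) chart set" and g nab
begin

abbreviation difference :: "'a vfield \<Rightarrow> 'a vfield \<Rightarrow> 'a vfield" where
  "difference \<equiv> diff_tensor A nab g"

abbreviation difference_adjoint :: "'a vfield \<Rightarrow> 'a vfield \<Rightarrow> 'a vfield" where
  "difference_adjoint \<equiv> adjoint_tensor A g difference"

abbreviation \<alpha> :: "'a \<Rightarrow> 'a tvec \<Rightarrow> real" where "\<alpha> \<equiv> koszul_alpha A nab g"

abbreviation \<xi> :: "'a \<Rightarrow> 'a tvec \<Rightarrow> real" where "\<xi> \<equiv> koszul_xi A nab g"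

lemma difference_inner:
  assumes "vfield_near p X" "vfield_near p Y" "z \<in> tangent_space A p"
  shows "g p (difference X Y p) z = g p (LC X Y p) z - g p (nab X Y p) z"
  using assms unfolding diff_tensor_def by (intro g_diff_left vfield_near_pts LC_tangent nab_tangent)

lemma tensor_at_difference: "tensor_at p difference"
  by (simp add: tensor_at_def bitensorial_at_def diff_tensor_def tdiff_tangent LC_tangent nab_tangent tdiff_apply
      tensorial_diff connection_tensorial[OF connection_LC] connection_tensorial[OF connection_nab]
      connection_diff_tensorial_right[OF connection_LC connection_nab])

context
  fixes p assumes p: "p \<in> pts A"
begin

lemma tensor_at_difference_adjoint: "tensor_at p difference_adjoint"
  by (rule tensor_at_adjoint[OF p tensor_at_difference])

lemma covector_alpha: "covector_at p (\<alpha> p)"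
  unfolding koszul_alpha_def
  by (rule covector_g_right[OF p metric_trace_tangent[OF p tensor_at_difference_adjoint]])

lemma covector_xi: "covector_at p (\<xi> p)"
  unfolding koszul_xi_def by (rule covector_g_right[OF p metric_trace_tangent[OF p tensor_at_difference]])

lemma koszul_forms_diff:
  assumes x: "x \<in> tangent_space A p"
  shows "\<alpha> p x - \<xi> p x = g p (metric_trace A g (\<lambda>X Y q. tdiff (difference_adjoint X Y q) (difference X Y q)) p) x"
  unfolding koszul_alpha_def koszul_xi_def
    metric_trace_diff[OF p tensor_at_difference_adjoint tensor_at_difference]
  by (rule g_diff_left[OF p x metric_trace_tangent[OF p tensor_at_difference_adjoint]
        metric_trace_tangent[OF p tensor_at_difference], symmetric])

end

lemma koszul_forms_eq_iff:
  "form_eq A \<alpha> \<xi> \<longleftrightarrow>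
    (\<forall>p\<in>pts A. metric_trace A g (\<lambda>X Y q. tdiff (difference_adjoint X Y q) (difference X Y q)) p = tzero)"
proof -
  have "(\<forall>x\<in>tangent_space A p. \<alpha> p x = \<xi> p x) \<longleftrightarrow>
      metric_trace A g (\<lambda>X Y q. tdiff (difference_adjoint X Y q) (difference X Y q)) p = tzero" (is "_ \<longleftrightarrow> ?t = _")
    if p: "p \<in> pts A" for p
  proof
    have t: "?t \<in> tangent_space A p"
      by (rule metric_trace_tangent[OF p
            tensor_at_diff[OF tensor_at_difference_adjoint[OF p] tensor_at_difference]])
    assume "\<forall>x\<in>tangent_space A p. \<alpha> p x = \<xi> p x"
    then have "g p ?t ?t = 0" using koszul_forms_diff[OF p t] t by simp
    then show "?t = tzero" using g_pos[OF p t] by force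
  next
    assume "?t = tzero"
    then show "\<forall>x\<in>tangent_space A p. \<alpha> p x = \<xi> p x"
      using koszul_forms_diff[OF p] g_zero_left[OF p] by simp
  qed
  then show ?thesis by (auto simp: form_eq_def)
qed

lemma xi_frame:
  assumes E: "frame_near p E" and x: "x \<in> tangent_space A p"
  shows "\<xi> p x = (\<Sum>i<DIM('e). g p (LC (E i) (E i) p) x - g p (nab (E i) (E i) p) x)"
proof -
  have "\<xi> p x = (\<Sum>i<DIM('e). g p (difference (E i) (E i) p) x)"
    unfolding koszul_xi_def metric_trace_frame[OF tensor_at_difference E]
    by (rule covector_sum[OF covector_g_left[OF frame_pts[OF E] x]])
      (simp_all add: tensor_tangent[OF tensor_at_difference] frame_vfield[OF E])
  then show ?thesis using x by (simp add: difference_inner frame_vfield[OF E])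
qed

end

locale affine_riemann = riemannian_connection A g nab
  for A :: "('a, 'e::euclidean_space) chart set" and g nab +
  assumes torsion_free_nab: "torsion_free A nab" and flat_nab: "flat A nab"
begin

lemma difference_sym:
  assumes X: "vfield_near p X" and Y: "vfield_near p Y" shows "difference X Y p = difference Y X p"
proof
  fix f
  have "LC X Y p f - LC Y X p f = nab X Y p f - nab Y X p f"
    using torsion_free_bracket[OF torsion_free_LC X Y] torsion_free_bracket[OF torsion_free_nab X Y]
    by (metis tdiff_apply)
  then show "difference X Y p f = difference Y X p f" by (simp add: diff_tensor_def tdiff_apply)
qed

text \<open>\<open>g (D\<^sub>X E\<^sub>i) E\<^sub>i\<close> vanishes because \<open>E\<^sub>i\<close> has constant length.\<close>

lemma alpha_frame:
  assumes E: "frame_near p E" and X: "vfield_near p X"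
  shows "\<alpha> p (X p) = - (\<Sum>i<DIM('e). g p (nab X (E i) p) (E i p))"
proof -
  note p = frame_pts[OF E] and vf = frame_vfield[OF E] and tE = frame_tangent[OF E]
  have summand: "g p (difference_adjoint (E i) (E i) p) (X p) = - g p (nab X (E i) p) (E i p)"
    if i: "i < DIM('e)" for i
  proof -
    have "eventually (\<lambda>q. g q (E i q) (E i q) = 1) (near p)"
      using frame_eventually[OF E] by eventually_elim (simp add: frame_inner i)
    from vfield_near_apply_eventually_const[OF X this] have LC: "g p (LC X (E i) p) (E i p) = 0"
      by (simp add: LC_norm_derivative[OF X vf[OF i]])
    have "g p (difference_adjoint (E i) (E i) p) (X p) = g p (E i p) (difference X (E i) p)"
      unfolding difference_sym[OF X vf[OF i]]
      by (rule adjoint_tensor_inner[OF p tensor_at_difference vf[OF i] vf[OF i] X])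
    also have "\<dots> = g p (difference X (E i) p) (E i p)"
      by (rule g_sym[OF p tE[OF i] tensor_tangent[OF tensor_at_difference X vf[OF i]]])
    finally show ?thesis by (simp add: difference_inner[OF X vf[OF i] tE[OF i]] LC)
  qed
  have "\<alpha> p (X p) = (\<Sum>i<DIM('e). g p (difference_adjoint (E i) (E i) p) (X p))"
    unfolding koszul_alpha_def metric_trace_frame[OF tensor_at_difference_adjoint[OF p] E]
    by (rule covector_sum[OF covector_g_left[OF p vfield_near_tangent[OF X]]])
      (simp_all add: tensor_tangent[OF tensor_at_difference_adjoint[OF p]] vf)
  then show ?thesis by (simp add: summand sum_negf)
qed

lemma alpha_frame_eventually:
  assumes E: "frame_near p E" and X: "vfield_near p X"
  shows "eventually (\<lambda>q. \<alpha> q (X q) = - (\<Sum>i<DIM('e). g q (nab X (E i) q) (E i q))) (near p)"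
  using frame_eventually[OF E] vfield_near_eventually[OF X] by eventually_elim (rule alpha_frame)

lemma form1_near_alpha: "form1_near p \<alpha>"
proof (rule form1_nearI[OF covector_alpha])
  fix X assume X: "vfield_near p X"
  obtain E where E: "frame_near p E" using ex_frame_near[OF vfield_near_pts[OF X]] .
  have "smooth_near A p (\<lambda>q. - (\<Sum>i<DIM('e). g q (nab X (E i) q) (E i q)))"
    by (rule smooth_near_uminus[OF smooth_near_sum[OF vfield_near_pts[OF X]
            connection_coefficient_smooth[OF connection_nab E X]]]) simp_all
  then show "smooth_near A p (\<lambda>q. \<alpha> q (X q))"
    by (rule smooth_near_cong) (use alpha_frame_eventually[OF E X] in \<open>eventually_elim; simp\<close>)
qed

lemma form1_near_xi: "form1_near p \<xi>"
proof (rule form1_nearI[OF covector_xi])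
  fix X assume X: "vfield_near p X"
  obtain E where E: "frame_near p E" using ex_frame_near[OF vfield_near_pts[OF X]] .
  note vf = frame_vfield[OF E]
  have "smooth_near A p (\<lambda>q. \<Sum>i<DIM('e). g q (LC (E i) (E i) q) (X q) - g q (nab (E i) (E i) q) (X q))"
    by (rule smooth_near_sum[OF vfield_near_pts[OF X]])
      (simp add: smooth_near_diff g_smooth connection_near[OF connection_LC] nab_near vf X)
  moreover have "eventually (\<lambda>q. (\<Sum>i<DIM('e). g q (LC (E i) (E i) q) (X q) - g q (nab (E i) (E i) q) (X q)) =
      \<xi> q (X q)) (near p)"
    using frame_eventually[OF E] vfield_near_eventually_tangent[OF X] by eventually_elim (rule xi_frame[symmetric])
  ultimately show "smooth_near A p (\<lambda>q. \<xi> q (X q))" by (rule smooth_near_cong)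
qed

lemma alpha_derivative:
  assumes E: "frame_near p E" and X: "vfield_near p X" and Y: "vfield_near p Y"
  shows "X p (\<lambda>q. \<alpha> q (Y q)) = - X p (\<lambda>q. \<Sum>i<DIM('e). g q (nab Y (E i) q) (E i q))"
proof -
  have "smooth_near A p (\<lambda>q. \<Sum>i<DIM('e). g q (nab Y (E i) q) (E i q))"
    by (rule smooth_near_sum[OF vfield_near_pts[OF X] connection_coefficient_smooth[OF connection_nab E Y]])
      simp_all
  from tangent_scale[OF vfield_near_tangent[OF X] this, of "-1"] show ?thesis
    using vfield_near_apply_cong[OF X alpha_frame_eventually[OF E Y]] by simp
qed

lemma closed_alpha: "closed_form A \<alpha>"
  unfolding closed_form_iff
proof (intro allI impI, elim conjE)
  fix p X Y assume X: "vfield_near p X" and Y: "vfield_near p Y"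
  obtain E where E: "frame_near p E" using ex_frame_near[OF vfield_near_pts[OF X]] .
  show "ext_deriv A \<alpha> X Y p = 0"
    unfolding ext_deriv_def alpha_derivative[OF E X Y] alpha_derivative[OF E Y X]
      alpha_frame[OF E vfield_near_bracket[OF X Y]]
    using flat_connection_trace_closed[OF connection_nab E flat_nab X Y] by simp
qed

lemma closed_form_diff_iff: "closed_form A (\<lambda>p x. \<alpha> p x - \<xi> p x) \<longleftrightarrow> closed_form A \<xi>"
proof -
  have "ext_deriv A (\<lambda>p x. \<alpha> p x - \<xi> p x) X Y p = - ext_deriv A \<xi> X Y p"
    if X: "vfield_near p X" and Y: "vfield_near p Y" for p X Y
  proof -
    have "ext_deriv A (\<lambda>p x. \<alpha> p x - \<xi> p x) X Y p = ext_deriv A \<alpha> X Y p - ext_deriv A \<xi> X Y p"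
      by (rule ext_deriv_diff[OF form1_near_alpha form1_near_xi X Y])
    then show ?thesis using closed_alpha X Y by (simp add: closed_form_iff)
  qed
  then show ?thesis by (auto simp: closed_form_iff)
qed

lemma form1_near_koszul_diff: "form1_near p (\<lambda>p x. \<alpha> p x - \<xi> p x)"
  by (rule form1_near_diff[OF form1_near_alpha form1_near_xi])

end

section \<open>The canonical Hermitian structure\<close>

context affine_connection
begin

abbreviation J :: "'a tpoint \<Rightarrow> 'a tpoint tvec \<Rightarrow> 'a tpoint tvec" where
  "J \<equiv> canonical_J A nab"

context
  fixes u assumes u: "u \<in> pts TB"
begin

context
  fixes w assumes w: "w \<in> tangent_space TB u"
begin

lemma canonical_J_parts: "J u w = tdiff (vlift u (hpart u w)) (hlift u (vpart u w))"
  unfolding canonical_J_def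
proof (rule the_equality)
  show "\<exists>x\<in>tangent_space A (fst u). \<exists>y\<in>tangent_space A (fst u). w = tadd (hlift u x) (vlift u y) \<and>
      tdiff (vlift u (hpart u w)) (hlift u (vpart u w)) = tdiff (vlift u x) (hlift u y)"
    using hpart_tangent[OF u w] horizontal_vertical_decomposition[OF u w] by blast
  fix w' assume "\<exists>x\<in>tangent_space A (fst u). \<exists>y\<in>tangent_space A (fst u).
      w = tadd (hlift u x) (vlift u y) \<and> w' = tdiff (vlift u x) (hlift u y)"
  then show "w' = tdiff (vlift u (hpart u w)) (hlift u (vpart u w))" using parts_of_lifts[OF u] by auto
qed

lemma J_tangent: "J u w \<in> tangent_space TB u"
  unfolding canonical_J_parts
  by (intro TM.tdiff_tangent vlift_tangent[OF u] hlift_tangent[OF u] hpart_tangent[OF u] vpart_tangent[OF u] w)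

lemma hpart_J: "hpart u (J u w) = tscale (- 1) (vpart u w)" and vpart_J: "vpart u (J u w) = hpart u w"
proof -
  note h = hpart_tangent[OF u w] and v = vpart_tangent[OF u w]
  show "hpart u (J u w) = tscale (- 1) (vpart u w)"
    unfolding canonical_J_parts hpart_diff[OF u] hpart_vlift[OF u h] hpart_hlift[OF u v]
    by (simp add: fun_eq_iff tvec_apply)
  show "vpart u (J u w) = hpart u w"
    unfolding canonical_J_parts vpart_diff[OF u vlift_tangent[OF u h] hlift_tangent[OF u v]]
      vpart_vlift[OF u h] vpart_hlift[OF u v]
    by (simp add: fun_eq_iff tvec_apply)
qed

end

lemma J_J:
  assumes w: "w \<in> tangent_space TB u" shows "J u (J u w) = tscale (- 1) w"
proof (rule parts_eqI[OF u])
  note Jw = J_tangent[OF w]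
  show "J u (J u w) \<in> tangent_space TB u" "tscale (- 1) w \<in> tangent_space TB u"
    by (rule J_tangent[OF Jw], rule TM.tscale_tangent[OF w])
  show "hpart u (J u (J u w)) = hpart u (tscale (- 1) w)"
    by (simp only: hpart_J[OF Jw] vpart_J[OF w] hpart_scale[OF u])
  show "vpart u (J u (J u w)) = vpart u (tscale (- 1) w)"
    by (simp only: vpart_J[OF Jw] hpart_J[OF w] vpart_scale[OF u w])
qed

lemma J_hlift:
  assumes x: "x \<in> tangent_space A (fst u)" shows "J u (hlift u x) = vlift u x"
  by (rule parts_eqI[OF u J_tangent[OF hlift_tangent[OF u x]] vlift_tangent[OF u x]])
    (simp_all add: hpart_J vpart_J hlift_tangent[OF u x] vpart_hlift[OF u x] hpart_vlift[OF u x] hpart_hlift[OF u x]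
      vpart_vlift[OF u x] fun_eq_iff tvec_apply)

lemma J_vlift:
  assumes x: "x \<in> tangent_space A (fst u)" shows "J u (vlift u x) = tscale (- 1) (hlift u x)"
  using J_J[OF hlift_tangent[OF u x]] by (simp only: J_hlift[OF x])

lemma vfield_near_J:
  assumes W: "TM.vfield_near u W" shows "TM.vfield_near u (\<lambda>w. J w (W w))"
proof -
  have "TM.vfield_near u (\<lambda>w. tdiff (vlift w (hpart w (W w))) (hlift w (vpart w (W w))))"
    by (intro TM.vfield_near_diff vfield_near_vlift[OF u] vfield_near_hlift[OF u] along_near_hpart[OF u W]
        along_near_vpart[OF u W])
  moreover have "eventually (\<lambda>w. tdiff (vlift w (hpart w (W w))) (hlift w (vpart w (W w))) = J w (W w)) (TM.near u)"
    using TM.eventually_near_pts TM.vfield_near_eventually_tangent[OF W]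
    by eventually_elim (rule affine_connection.canonical_J_parts[OF affine_connection_axioms, symmetric])
  ultimately show ?thesis by (rule TM.vfield_near_cong)
qed

end

end

context riemannian_connection
begin

abbreviation g1 :: "'a tpoint \<Rightarrow> 'a tpoint tvec \<Rightarrow> 'a tpoint tvec \<Rightarrow> real" where
  "g1 \<equiv> canonical_g A nab g"

abbreviation \<omega>1 :: "'a tpoint \<Rightarrow> 'a tpoint tvec \<Rightarrow> 'a tpoint tvec \<Rightarrow> real" where
  "\<omega>1 \<equiv> fundamental_form J g1"

lemma canonical_g_parts:
  assumes u: "u \<in> pts TB" and w: "w \<in> tangent_space TB u" and w': "w' \<in> tangent_space TB u"
  shows "g1 u w w' = g (fst u) (hpart u w) (hpart u w') + g (fst u) (vpart u w) (vpart u w')"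
  unfolding canonical_g_def
proof (rule the_equality)
  let ?T = "tangent_space A (fst u)"
  show "\<exists>x\<in>?T. \<exists>y\<in>?T. \<exists>x'\<in>?T. \<exists>y'\<in>?T. w = tadd (hlift u x) (vlift u y) \<and> w' = tadd (hlift u x') (vlift u y') \<and>
      g (fst u) (hpart u w) (hpart u w') + g (fst u) (vpart u w) (vpart u w') = g (fst u) x x' + g (fst u) y y'"
    using hpart_tangent[OF u w] horizontal_vertical_decomposition[OF u w] hpart_tangent[OF u w']
        horizontal_vertical_decomposition[OF u w'] by blast
  fix r assume "\<exists>x\<in>?T. \<exists>y\<in>?T. \<exists>x'\<in>?T. \<exists>y'\<in>?T.
      w = tadd (hlift u x) (vlift u y) \<and> w' = tadd (hlift u x') (vlift u y') \<and> r = g (fst u) x x' + g (fst u) y y'"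
  then show "r = g (fst u) (hpart u w) (hpart u w') + g (fst u) (vpart u w) (vpart u w')"
    using parts_of_lifts[OF u] by auto
qed

lemma canonical_g_smooth:
  assumes W: "TM.vfield_near u W" and W': "TM.vfield_near u W'"
  shows "smooth_near TB u (\<lambda>w. g1 w (W w) (W' w))"
proof -
  note u = TM.vfield_near_pts[OF W]
  have "smooth_near TB u (\<lambda>w. g (fst w) (hpart w (W w)) (hpart w (W' w))
      + g (fst w) (vpart w (W w)) (vpart w (W' w)))"
    using W W' by (intro TM.smooth_near_add along_form2_smooth[OF u form2_near_g covector_g_left]
        along_near_hpart[OF u] along_near_vpart[OF u])
  moreover have "eventually (\<lambda>w. g (fst w) (hpart w (W w)) (hpart w (W' w))
      + g (fst w) (vpart w (W w)) (vpart w (W' w)) =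
      g1 w (W w) (W' w)) (TM.near u)"
    using TM.eventually_near_pts TM.vfield_near_eventually_tangent[OF W] TM.vfield_near_eventually_tangent[OF W']
    by eventually_elim (rule canonical_g_parts[symmetric])
  ultimately show ?thesis by (rule TM.smooth_near_cong)
qed

lemma canonical_g_pos:
  assumes u: "u \<in> pts TB" and w: "w \<in> tangent_space TB u" and nonzero: "w \<noteq> tzero"
  shows "g1 u w w > 0"
proof -
  note p = fst_pts[OF u] and h = hpart_tangent[OF u w] and v = vpart_tangent[OF u w]
  have nonneg: "g (fst u) x x \<ge> 0" if "x \<in> tangent_space A (fst u)" for x
    using g_pos[OF p that] g_zero_left[OF p that] by (cases "x = tzero") auto
  have "hpart u w \<noteq> tzero \<or> vpart u w \<noteq> tzero"
  proof (rule ccontr)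
    assume "\<not> ?thesis"
    then have "w = tzero"
      using hpart_scale[OF u, of 0 w] vpart_scale[OF u w, of 0]
      by (intro parts_eqI[OF u w TM.tzero_tangent]) (simp_all add: tscale_0)
    with nonzero show False ..
  qed
  then show ?thesis
    unfolding canonical_g_parts[OF u w w]
    using g_pos[OF p h] g_pos[OF p v] nonneg[OF h] nonneg[OF v]
    by (elim disjE) (auto intro: add_pos_nonneg add_nonneg_pos)
qed

lemma riemannian_metric_canonical_g: "riemannian_metric TB g1"
  unfolding riemannian_metric_def
proof (intro conjI ballI allI impI; (elim conjE)?)
  fix u x y assume u: "u \<in> pts TB" and x: "x \<in> tangent_space TB u" and y: "y \<in> tangent_space TB u"
  note p = fst_pts[OF u] and parts = hpart_tangent[OF u] vpart_tangent[OF u]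
  show "g1 u x y = g1 u y x"
    by (simp add: canonical_g_parts[OF u] x y g_sym[OF p parts(1)[OF x] parts(1)[OF y]]
        g_sym[OF p parts(2)[OF x] parts(2)[OF y]])
  show "g1 u (tadd x y) z = g1 u x z + g1 u y z" if "z \<in> tangent_space TB u" for z
    using that x y by (simp add: canonical_g_parts[OF u] TM.tadd_tangent hpart_add[OF u] vpart_add[OF u]
        g_add_left[OF p] parts)
  show "g1 u (tscale c x) y = c * g1 u x y" for c
    using x y by (simp add: canonical_g_parts[OF u] TM.tscale_tangent hpart_scale[OF u] vpart_scale[OF u]
        g_scale_left[OF p] parts algebra_simps)
  show "x \<noteq> tzero \<Longrightarrow> g1 u x x > 0" by (rule canonical_g_pos[OF u x])
next
  fix U X Y assume "vfield_on TB U X" "vfield_on TB U Y"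
  then show "smooth_fun_on TB U (\<lambda>u. g1 u (X u) (Y u))"
    by (simp add: TM.smooth_fun_on_iff TM.vfield_on_iff canonical_g_smooth)
qed

sublocale TM: riemannian TB g1
  by unfold_locales (rule riemannian_metric_canonical_g)

context
  fixes u assumes u: "u \<in> pts TB"
begin

lemma canonical_g_hlift:
  assumes "x \<in> tangent_space A (fst u)" "w \<in> tangent_space TB u"
  shows "g1 u (hlift u x) w = g (fst u) x (hpart u w)"
  using assms by (simp add: canonical_g_parts[OF u] hlift_tangent[OF u] hpart_hlift[OF u] vpart_hlift[OF u]
      g_zero_left[OF fst_pts[OF u] vpart_tangent[OF u]])

lemma canonical_g_vlift:
  assumes "x \<in> tangent_space A (fst u)" "w \<in> tangent_space TB u"
  shows "g1 u (vlift u x) w = g (fst u) x (vpart u w)"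
  using assms by (simp add: canonical_g_parts[OF u] vlift_tangent[OF u] hpart_vlift[OF u] vpart_vlift[OF u]
      g_zero_left[OF fst_pts[OF u] hpart_tangent[OF u]])

lemma canonical_g_lifts:
  assumes x: "x \<in> tangent_space A (fst u)" and y: "y \<in> tangent_space A (fst u)"
  shows "g1 u (hlift u x) (hlift u y) = g (fst u) x y" and "g1 u (vlift u x) (vlift u y) = g (fst u) x y"
    and "g1 u (hlift u x) (vlift u y) = 0" and "g1 u (vlift u x) (hlift u y) = 0"
  using x y by (simp_all add: canonical_g_hlift canonical_g_vlift hlift_tangent[OF u] vlift_tangent[OF u]
      hpart_hlift[OF u] hpart_vlift[OF u] vpart_hlift[OF u] vpart_vlift[OF u] g_zero_right[OF fst_pts[OF u]])

lemma fundamental_form_parts: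
  assumes "x \<in> tangent_space TB u" "y \<in> tangent_space TB u"
  shows "\<omega>1 u x y = g (fst u) (hpart u x) (vpart u y) - g (fst u) (vpart u x) (hpart u y)"
  using assms by (simp add: fundamental_form_def canonical_g_parts[OF u] J_tangent[OF u] hpart_J[OF u] vpart_J[OF u]
      g_scale_left[OF fst_pts[OF u]] hpart_tangent[OF u] vpart_tangent[OF u])

lemma J_skew:
  assumes x: "x \<in> tangent_space TB u" and y: "y \<in> tangent_space TB u"
  shows "g1 u (J u x) y = - g1 u x (J u y)"
  using fundamental_form_parts[OF x y] x y
  by (simp add: fundamental_form_def canonical_g_parts[OF u x] J_tangent[OF u] hpart_J[OF u] vpart_J[OF u]
      g_scale_right[OF fst_pts[OF u]] hpart_tangent[OF u] vpart_tangent[OF u])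

end

lemma form2_near_fundamental_form: "TM.form2_near u \<omega>1"
proof (rule TM.form2_nearI)
  fix w z assume w: "w \<in> pts TB" and z: "z \<in> tangent_space TB w"
  note p = fst_pts[OF w] and simps = fundamental_form_parts[OF w] hpart_add[OF w] vpart_add[OF w] hpart_scale[OF w]
    vpart_scale[OF w] hpart_tangent[OF w] vpart_tangent[OF w] TM.tadd_tangent TM.tscale_tangent z
    g_add_left[OF p] g_add_right[OF p] g_scale_left[OF p] g_scale_right[OF p] algebra_simps
  show "TM.covector_at w (\<lambda>x. \<omega>1 w x z)" by (rule TM.covector_atI) (simp_all add: simps)
  show "TM.covector_at w (\<lambda>x. \<omega>1 w z x)" by (rule TM.covector_atI) (simp_all add: simps)
next
  fix X Y assume "TM.vfield_near u X" "TM.vfield_near u Y"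
  then show "smooth_near TB u (\<lambda>w. \<omega>1 w (X w) (Y w))"
    unfolding fundamental_form_def by (intro canonical_g_smooth vfield_near_J TM.vfield_near_pts)
qed

end

section \<open>Pulling back one-forms to the tangent bundle\<close>

context affine_connection
begin

lemma form1_near_pullback:
  assumes u: "u \<in> pts TB" and \<eta>: "form1_near (fst u) \<eta>"
  shows "TM.form1_near u (pullback_form A fst \<eta>)"
  unfolding TM.form1_near_def pullback_form_def
proof (intro conjI allI impI)
  show "eventually (\<lambda>w. TM.covector_at w (\<lambda>x. \<eta> (fst w) (hpart w x))) (TM.near u)"
    using TM.eventually_near_pts eventually_near_base[OF u \<eta>[unfolded form1_near_def, THEN conjunct1]]
  proof eventually_elim
    case (elim w)
    show ?case
      by (rule TM.covector_atI)
        (simp_all add: hpart_add[OF elim(1)] hpart_scale[OF elim(1)] hpart_tangent[OF elim(1)]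
          covector_add[OF elim(2)] covector_scale[OF elim(2)])
  qed
qed (rule along_form1_smooth[OF u \<eta> along_near_hpart[OF u]])

lemma ex_related_lift:
  assumes W: "TM.vfield_near u W"
  obtains V X where "TM.vfield_near u V" "V u = W u" "vfield_near (fst u) X" "TM.related_near A fst u V X"
proof -
  note u = TM.vfield_near_pts[OF W] and Wu = TM.vfield_near_tangent[OF W]
  let ?X = "extension (fst u) (hpart u (W u))" and ?Y = "extension (fst u) (vpart u (W u))"
  note X = extension[OF fst_pts[OF u] hpart_tangent[OF u Wu]]
    and Y = extension[OF fst_pts[OF u] vpart_tangent[OF u Wu]]
  have "eventually (\<lambda>w. hpart w (tadd (horizontal_field ?X w) (vertical_field ?Y w)) = ?X (fst w)) (TM.near u)"
    using TM.eventually_near_pts eventually_near_base[OF u vfield_near_eventually_tangent[OF X(1)]]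
      eventually_near_base[OF u vfield_near_eventually_tangent[OF Y(1)]]
    by eventually_elim (rule parts_of_lifts(1))
  then have "TM.related_near A fst u (\<lambda>w. tadd (horizontal_field ?X w) (vertical_field ?Y w)) ?X"
    by (simp only: TM.related_near_def)
  moreover have "tadd (horizontal_field ?X u) (vertical_field ?Y u) = W u"
    using hlift_vlift_parts[OF u Wu] by (simp add: X(2) Y(2))
  ultimately show ?thesis
    using that[OF TM.vfield_near_add[OF horizontal_field_near[OF u X(1)] vertical_field_near[OF u Y(1)]]] X(1)
    by simp
qed

lemma closed_form_pullback_iff:
  assumes \<eta>: "\<And>p. form1_near p \<eta>"
  shows "closed_form TB (pullback_form A fst \<eta>) \<longleftrightarrow> closed_form A \<eta>"
proof
  assume closed: "closed_form TB (pullback_form A fst \<eta>)"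
  show "closed_form A \<eta>"
    unfolding closed_form_iff
  proof (intro allI impI, elim conjE)
    fix p X Y assume "vfield_near p X" "vfield_near p Y"
    moreover define u :: "'a tpoint" where "u = (p, tzero)"
    ultimately have X: "vfield_near (fst u) X" and Y: "vfield_near (fst u) Y" by simp_all
    have u: "u \<in> pts TB" using vfield_near_pts[OF X] by (simp add: u_def pts_tangent_bundle_iff tzero_tangent)
    note lifts = horizontal_field_near[OF u X] horizontal_field_near[OF u Y]
    have "ext_deriv TB (pullback_form A fst \<eta>) (horizontal_field X) (horizontal_field Y) u =
        ext_deriv A \<eta> X Y (fst u)"
      by (rule TM.ext_deriv_pullback[OF atlas_axioms smooth_map_at_base[OF u] lifts X Y
            horizontal_field_related[OF u X] horizontal_field_related[OF u Y] \<eta>])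
    then show "ext_deriv A \<eta> X Y p = 0" using closed lifts by (simp add: TM.closed_form_iff u_def)
  qed
next
  assume closed: "closed_form A \<eta>"
  show "closed_form TB (pullback_form A fst \<eta>)"
    unfolding TM.closed_form_iff
  proof (intro allI impI, elim conjE)
    fix u W W' assume W: "TM.vfield_near u W" and W': "TM.vfield_near u W'"
    note u = TM.vfield_near_pts[OF W]
    obtain V X where V: "TM.vfield_near u V" "V u = W u"
      and X: "vfield_near (fst u) X" "TM.related_near A fst u V X"
      using ex_related_lift[OF W] .
    obtain V' X' where V': "TM.vfield_near u V'" "V' u = W' u"
      and X': "vfield_near (fst u) X'" "TM.related_near A fst u V' X'"
      using ex_related_lift[OF W'] .
    have "ext_deriv TB (pullback_form A fst \<eta>) W W' u = ext_deriv TB (pullback_form A fst \<eta>) V V' u"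
      by (rule TM.bitensorial_eq_at[OF TM.ext_deriv_bitensorial[OF form1_near_pullback[OF u \<eta>]]
            W V(1) V(2)[symmetric] W' V'(1) V'(2)[symmetric]])
    also have "\<dots> = ext_deriv A \<eta> X X' (fst u)"
      by (rule TM.ext_deriv_pullback[OF atlas_axioms smooth_map_at_base[OF u] V(1) V'(1) X(1) X'(1) X(2) X'(2) \<eta>])
    finally show "ext_deriv TB (pullback_form A fst \<eta>) W W' u = 0"
      using closed X(1) X'(1) by (simp add: closed_form_iff)
  qed
qed

lemma pullback_form_eq_zero_iff:
  "form_eq TB (pullback_form A fst \<eta>) (\<lambda>u x. 0) \<longleftrightarrow> form_eq A \<eta> (\<lambda>p x. 0)"
proof
  assume zero: "form_eq TB (pullback_form A fst \<eta>) (\<lambda>u x. 0)"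
  show "form_eq A \<eta> (\<lambda>p x. 0)"
    unfolding form_eq_def
  proof (intro ballI)
    fix p x assume p: "p \<in> pts A" and x: "x \<in> tangent_space A p"
    have u: "(p, tzero) \<in> pts TB" by (simp add: pts_tangent_bundle_iff tzero_tangent p)
    show "\<eta> p x = 0"
      using zero u hlift_tangent[OF u] hpart_hlift[OF u] x by (force simp: form_eq_def pullback_form_def)
  qed
qed (simp add: form_eq_def pullback_form_def hpart_tangent fst_pts)

end

section \<open>The Lee form\<close>

context riemannian_connection
begin

context
  fixes u assumes u: "u \<in> pts TB"
begin

lemma canonical_g_fields:
  assumes X: "vfield_near (fst u) X" and Y: "vfield_near (fst u) Y"
  shows "eventually (\<lambda>w. g1 w (horizontal_field X w) (horizontal_field Y w) =
      g (fst w) (X (fst w)) (Y (fst w))) (TM.near u)"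
    and "eventually (\<lambda>w. g1 w (vertical_field X w) (vertical_field Y w) =
        g (fst w) (X (fst w)) (Y (fst w))) (TM.near u)"
    and "eventually (\<lambda>w. g1 w (horizontal_field X w) (vertical_field Y w) = 0) (TM.near u)"
    and "eventually (\<lambda>w. g1 w (vertical_field X w) (horizontal_field Y w) = 0) (TM.near u)"
  using TM.eventually_near_pts eventually_near_base[OF u vfield_near_eventually_tangent[OF X]]
    eventually_near_base[OF u vfield_near_eventually_tangent[OF Y]]
  by (eventually_elim, simp add: canonical_g_lifts)+

lemma inner_parts:
  assumes w: "w \<in> tangent_space TB u" and z: "z \<in> tangent_space TB u"
  shows "g1 u z w = g1 u z (hlift u (hpart u w)) + g1 u z (vlift u (vpart u w))"
  using TM.g_add_right[OF u z hlift_tangent[OF u hpart_tangent[OF u w]] vlift_tangent[OF u vpart_tangent[OF u w]]]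
  by (simp only: hlift_vlift_parts[OF u w, symmetric])

lemma horizontal_derivative_inner:
  assumes "vfield_near (fst u) Y" "vfield_near (fst u) Z" "vfield_near (fst u) X"
  shows "horizontal_field X u (\<lambda>w. g (fst w) (Y (fst w)) (Z (fst w))) = X (fst u) (\<lambda>q. g q (Y q) (Z q))"
  by (rule hlift_base[OF u vfield_near_tangent[OF assms(3)] g_smooth[OF assms(1,2)]])

lemma vertical_derivative_inner: "vertical_field X u (\<lambda>w. g (fst w) (Y (fst w)) (Z (fst w))) = 0"
  by (rule vlift_base[OF u])

context
  fixes Y Z assumes Y: "vfield_near (fst u) Y" and Z: "vfield_near (fst u) Z"
begin

lemma horizontal_LC_horizontal:
  "g1 u (TM.LC (horizontal_field Z) (horizontal_field Z) u) (horizontal_field Y u) =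
      g (fst u) (LC Z Z (fst u)) (Y (fst u))"
proof -
  note HY = horizontal_field_near[OF u Y] and HZ = horizontal_field_near[OF u Z]
  note Zp = vfield_near_tangent[OF Z] and bracket = TM.bracket_tangent[OF HY HZ]
  have "g1 u (lie_bracket TB (horizontal_field Y) (horizontal_field Z) u) (horizontal_field Z u) =
      g (fst u) (lie_bracket A Y Z (fst u)) (Z (fst u))"
    unfolding TM.g_sym[OF u bracket hlift_tangent[OF u Zp]] canonical_g_hlift[OF u Zp bracket]
      hpart_horizontal_bracket[OF u Y Z]
    by (rule g_sym[OF fst_pts[OF u] Zp bracket_tangent[OF Y Z]])
  then show ?thesis
    unfolding TM.LC_diagonal_inner[OF HZ HY] LC_diagonal_inner[OF Z Y]
      TM.vfield_near_apply_cong[OF HZ canonical_g_fields(1)[OF Z Y]]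
      TM.vfield_near_apply_cong[OF HY canonical_g_fields(1)[OF Z Z]]
      horizontal_derivative_inner[OF Z Y Z] horizontal_derivative_inner[OF Z Z Y]
    by simp
qed

lemma horizontal_LC_vertical:
  "g1 u (TM.LC (horizontal_field Z) (horizontal_field Z) u) (vertical_field Y u) = 0"
proof -
  note VY = vertical_field_near[OF u Y] and HZ = horizontal_field_near[OF u Z] and nab = nab_tangent[OF Z Y]
  have "lie_bracket TB (vertical_field Y) (horizontal_field Z) u = tscale (- 1) (vlift u (nab Z Y (fst u)))"
    unfolding TM.bracket_antisym[of "vertical_field Y"] bracket_horizontal_vertical[OF u Z Y] ..
  then have "g1 u (lie_bracket TB (vertical_field Y) (horizontal_field Z) u) (horizontal_field Z u) = 0"
    using canonical_g_lifts(4)[OF u nab vfield_near_tangent[OF Z]]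
      TM.g_scale_left[OF u TM.vfield_near_tangent[OF HZ] vlift_tangent[OF u nab], of "- 1"] by simp
  then show ?thesis
    unfolding TM.LC_diagonal_inner[OF HZ VY]
      TM.vfield_near_apply_eventually_const[OF HZ canonical_g_fields(3)[OF Z Y]]
      TM.vfield_near_apply_cong[OF VY canonical_g_fields(1)[OF Z Z]] vertical_derivative_inner
    by simp
qed

lemma vertical_LC_horizontal:
  "g1 u (TM.LC (vertical_field Z) (vertical_field Z) u) (horizontal_field Y u) =
    g (fst u) (nab Y Z (fst u)) (Z (fst u)) - Y (fst u) (\<lambda>q. g q (Z q) (Z q)) / 2"
proof -
  note HY = horizontal_field_near[OF u Y] and VZ = vertical_field_near[OF u Z]
  show ?thesis
    unfolding TM.LC_diagonal_inner[OF VZ HY] bracket_horizontal_vertical[OF u Y Z]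
      canonical_g_lifts(2)[OF u nab_tangent[OF Y Z] vfield_near_tangent[OF Z]]
      TM.vfield_near_apply_eventually_const[OF VZ canonical_g_fields(4)[OF Z Y]]
      TM.vfield_near_apply_cong[OF HY canonical_g_fields(2)[OF Z Z]] horizontal_derivative_inner[OF Z Z Y]
    by simp
qed

lemma vertical_LC_vertical: "g1 u (TM.LC (vertical_field Z) (vertical_field Z) u) (vertical_field Y u) = 0"
proof -
  note VY = vertical_field_near[OF u Y] and VZ = vertical_field_near[OF u Z]
  show ?thesis
    unfolding TM.LC_diagonal_inner[OF VZ VY] bracket_vertical_vertical[OF u Y Z]
      TM.vfield_near_apply_cong[OF VZ canonical_g_fields(2)[OF Z Y]] vertical_derivative_inner
      TM.vfield_near_apply_cong[OF VY canonical_g_fields(2)[OF Z Z]] vertical_derivative_inner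
      TM.g_zero_left[OF u TM.vfield_near_tangent[OF VZ]]
    by simp
qed

end

context
  fixes Z assumes Z: "vfield_near (fst u) Z"
begin

lemma LC_lifts_inner:
  assumes w: "w \<in> tangent_space TB u" and Y: "vfield_near (fst u) Y" and Yp: "Y (fst u) = hpart u w"
  shows "g1 u (TM.LC (horizontal_field Z) (horizontal_field Z) u) w = g (fst u) (LC Z Z (fst u)) (Y (fst u))"
    and "g1 u (TM.LC (vertical_field Z) (vertical_field Z) u) w =
      g (fst u) (nab Y Z (fst u)) (Z (fst u)) - Y (fst u) (\<lambda>q. g q (Z q) (Z q)) / 2"
proof -
  note HZ = horizontal_field_near[OF u Z] and VZ = vertical_field_near[OF u Z]
  note V = extension[OF fst_pts[OF u] vpart_tangent[OF u w]]
  show "g1 u (TM.LC (horizontal_field Z) (horizontal_field Z) u) w = g (fst u) (LC Z Z (fst u)) (Y (fst u))"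
    using inner_parts[OF w TM.LC_tangent[OF HZ HZ]] horizontal_LC_horizontal[OF Y Z]
      horizontal_LC_vertical[OF V(1) Z]
    by (simp add: Yp V(2))
  show "g1 u (TM.LC (vertical_field Z) (vertical_field Z) u) w =
      g (fst u) (nab Y Z (fst u)) (Z (fst u)) - Y (fst u) (\<lambda>q. g q (Z q) (Z q)) / 2"
    using inner_parts[OF w TM.LC_tangent[OF VZ VZ]] vertical_LC_horizontal[OF Y Z] vertical_LC_vertical[OF V(1) Z]
    by (simp add: Yp V(2))
qed

text \<open>With \<open>J Z\<^sup>h = Z\<^sup>v\<close> and \<open>J Z\<^sup>v = - Z\<^sup>h\<close>, the terms \<open>D\<^bsub>Z\<^sup>h\<^esub> Z\<^sup>v - D\<^bsub>Z\<^sup>v\<^esub> Z\<^sup>h\<close> combine to a bracket.\<close>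

lemma cov_deriv_fundamental_form_lifts:
  assumes X: "TM.vfield_near u X"
  shows "cov_deriv_form2 TM.LC \<omega>1 (horizontal_field Z) (horizontal_field Z) X u
      + cov_deriv_form2 TM.LC \<omega>1 (vertical_field Z) (vertical_field Z) X u =
    g (fst u) (nab Z Z (fst u)) (vpart u (X u))
      + g1 u (TM.LC (horizontal_field Z) (horizontal_field Z) u) (J u (X u))
      + g1 u (TM.LC (vertical_field Z) (vertical_field Z) u) (J u (X u))"
proof -
  note HZ = horizontal_field_near[OF u Z] and VZ = vertical_field_near[OF u Z]
  note Xu = TM.vfield_near_tangent[OF X] and LC = TM.connection_LC
  note tangents = TM.eventually_near_pts eventually_near_base[OF u vfield_near_eventually_tangent[OF Z]]
  have cov_deriv: "cov_deriv_form2 TM.LC \<omega>1 W W X u = g1 u (TM.LC W (\<lambda>w. J w (W w)) u) (X u)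
      + g1 u (TM.LC W W u) (J u (X u))"
    if W: "TM.vfield_near u W" for W
    by (rule TM.cov_deriv_fundamental_form[OF W vfield_near_J[OF u W] X J_skew[OF u]])
  have "eventually (\<lambda>w. J w (horizontal_field Z w) = vertical_field Z w) (TM.near u)"
    using tangents by eventually_elim (rule J_hlift)
  from TM.connection_cong_right[OF LC HZ vfield_near_J[OF u HZ] this]
  have JH: "TM.LC (horizontal_field Z) (\<lambda>w. J w (horizontal_field Z w)) u =
      TM.LC (horizontal_field Z) (vertical_field Z) u" .
  have "eventually (\<lambda>w. J w (vertical_field Z w) = tscale (- 1) (horizontal_field Z w)) (TM.near u)"
    using tangents by eventually_elim (rule J_vlift)
  from TM.connection_cong_right[OF LC VZ vfield_near_J[OF u VZ] this]
  have JV: "TM.LC (vertical_field Z) (\<lambda>w. J w (vertical_field Z w)) u =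
      tscale (- 1) (TM.LC (vertical_field Z) (horizontal_field Z) u)"
    by (simp only: TM.connection_cscale_right[OF LC VZ HZ])
  have "g1 u (TM.LC (horizontal_field Z) (vertical_field Z) u) (X u)
      - g1 u (TM.LC (vertical_field Z) (horizontal_field Z) u) (X u) =
      g1 u (vlift u (nab Z Z (fst u))) (X u)"
    unfolding bracket_horizontal_vertical[OF u Z Z, symmetric]
      TM.torsion_free_bracket[OF TM.torsion_free_LC HZ VZ, symmetric]
    by (rule TM.g_diff_left[OF u Xu TM.LC_tangent[OF HZ VZ] TM.LC_tangent[OF VZ HZ], symmetric])
  then show ?thesis
    using cov_deriv[OF HZ] cov_deriv[OF VZ] TM.g_scale_left[OF u Xu TM.LC_tangent[OF VZ HZ], of "- 1"]
      canonical_g_vlift[OF u nab_tangent[OF Z Z] Xu]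
    by (simp add: JH JV)
qed

end

end

definition lift_frame :: "(nat \<Rightarrow> 'a vfield) \<Rightarrow> nat \<Rightarrow> 'a tpoint vfield" where
  "lift_frame E i = (if i < DIM('e) then horizontal_field (E i) else vertical_field (E (i - DIM('e))))"

lemma sum_lift_frame:
  "(\<Sum>i<DIM('e \<times> 'e). F (lift_frame E i)) = (\<Sum>i<DIM('e). F (horizontal_field (E i)) + F (vertical_field (E i)))"
  by (simp add: sum_lessThan_add lift_frame_def sum.distrib)

lemma lift_frame_near:
  assumes u: "u \<in> pts TB" and E: "frame_near (fst u) E" shows "TM.frame_near u (lift_frame E)"
  unfolding TM.orthonormal_near_def
proof (intro conjI allI impI)
  note vf = frame_vfield[OF E]
  show "TM.vfield_near u (lift_frame E i)" if "i < DIM('e \<times> 'e)" for i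
    using that by (simp add: lift_frame_def horizontal_field_near[OF u vf] vertical_field_near[OF u vf])
  have "eventually (\<lambda>w. frame_near (fst w) E) (TM.near u)"
    by (rule eventually_near_base[OF u frame_eventually[OF E]])
  with TM.eventually_near_pts
  show "eventually (\<lambda>w. TM.orthonormal_at w DIM('e \<times> 'e) (\<lambda>i. lift_frame E i w)) (TM.near u)"
  proof eventually_elim
    case (elim w)
    note lifts = canonical_g_lifts[OF elim(1)] hlift_tangent[OF elim(1)] vlift_tangent[OF elim(1)]
    show ?case
      using frame_inner[OF elim(2)] frame_tangent[OF elim(2)]
      by (auto simp: TM.orthonormal_at_def lift_frame_def lifts)
  qed
qed

end

context affine_riemann
begin

lemma lee_form_canonical:
  assumes u: "u \<in> pts TB" and w: "w \<in> tangent_space TB u"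
  shows "lee_form TB J g1 u w = \<alpha> (fst u) (hpart u w) - \<xi> (fst u) (hpart u w)"
proof -
  let ?p = "fst u" and ?X = "TM.extension u (J u w)" and ?Y = "extension (fst u) (hpart u w)"
  note Jw = J_tangent[OF u w] and x = hpart_tangent[OF u w]
  note X = TM.extension[OF u Jw] and Y = extension[OF fst_pts[OF u] x]
  obtain E where E: "frame_near ?p E" using ex_frame_near[OF fst_pts[OF u]] .
  have summand: "cov_deriv_form2 TM.LC \<omega>1 (horizontal_field (E i)) (horizontal_field (E i)) ?X u
      + cov_deriv_form2 TM.LC \<omega>1 (vertical_field (E i)) (vertical_field (E i)) ?X u =
    g ?p (nab (E i) (E i) ?p) (hpart u w) - g ?p (LC (E i) (E i) ?p) (hpart u w) - g ?p (nab ?Y (E i) ?p) (E i ?p)"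
    if i: "i < DIM('e)" for i
  proof -
    note Ei = frame_vfield[OF E i]
    have "eventually (\<lambda>q. g q (E i q) (E i q) = 1) (near ?p)"
      using frame_eventually[OF E] by eventually_elim (simp add: frame_inner i)
    from vfield_near_apply_eventually_const[OF Y(1) this] have unit: "?Y ?p (\<lambda>q. g q (E i q) (E i q)) = 0" .
    note LC_inner = LC_lifts_inner[OF u Ei w Y]
    have minus: "g1 u z (tscale (- 1) w) = - g1 u z w" if "z \<in> tangent_space TB u" for z
      using TM.g_scale_right[OF u that w, of "- 1"] by simp
    note fields = horizontal_field_near[OF u Ei] vertical_field_near[OF u Ei]
    show ?thesis
      unfolding cov_deriv_fundamental_form_lifts[OF u Ei X(1)] X(2) vpart_J[OF u w] J_J[OF u w]
        minus[OF TM.LC_tangent[OF fields(1) fields(1)]] minus[OF TM.LC_tangent[OF fields(2) fields(2)]]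
        LC_inner unit
      by (simp add: Y(2))
  qed
  have "lee_form TB J g1 u w = - codiff2 TB g1 \<omega>1 u (?X u)" by (simp add: lee_form_def X(2))
  also have "\<dots> = (\<Sum>i<DIM('e). g ?p (nab (E i) (E i) ?p) (hpart u w) - g ?p (LC (E i) (E i) ?p) (hpart u w)
      - g ?p (nab ?Y (E i) ?p) (E i ?p))"
    unfolding TM.codiff2_frame[OF form2_near_fundamental_form lift_frame_near[OF u E] X(1)]
      sum_lift_frame[of "\<lambda>W. cov_deriv_form2 TM.LC \<omega>1 W W ?X u"]
    by (simp add: summand)
  also have "\<dots> = \<alpha> ?p (?Y ?p) - \<xi> ?p (hpart u w)"
    by (simp add: alpha_frame[OF E Y(1)] xi_frame[OF E x] sum_subtractf)
  finally show ?thesis by (simp only: Y(2))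
qed

lemma lee_form_pullback: "form_eq TB (lee_form TB J g1) (pullback_form A fst (\<lambda>p x. \<alpha> p x - \<xi> p x))"
  by (simp add: form_eq_def pullback_form_def lee_form_canonical)

lemma balanced_iff: "balanced TB J g1 \<longleftrightarrow> form_eq A \<alpha> \<xi>"
proof -
  have "balanced TB J g1 \<longleftrightarrow> form_eq TB (pullback_form A fst (\<lambda>p x. \<alpha> p x - \<xi> p x)) (\<lambda>u x. 0)"
    using lee_form_pullback by (simp add: balanced_def form_eq_def)
  also have "\<dots> \<longleftrightarrow> form_eq A (\<lambda>p x. \<alpha> p x - \<xi> p x) (\<lambda>p x. 0)" by (rule pullback_form_eq_zero_iff)
  finally show ?thesis by (simp add: form_eq_def)
qed

lemma locally_conformally_balanced_iff: "locally_conformally_balanced TB J g1 \<longleftrightarrow> closed_form A \<xi>"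
proof -
  have "locally_conformally_balanced TB J g1 \<longleftrightarrow> closed_form TB (pullback_form A fst (\<lambda>p x. \<alpha> p x - \<xi> p x))"
    unfolding locally_conformally_balanced_def by (rule TM.closed_form_cong[OF lee_form_pullback])
  also have "\<dots> \<longleftrightarrow> closed_form A (\<lambda>p x. \<alpha> p x - \<xi> p x)"
    by (rule closed_form_pullback_iff[OF form1_near_koszul_diff])
  finally show ?thesis by (simp only: closed_form_diff_iff)
qed

end

theorem proposition3p4:
  fixes A :: "('a, 'e::euclidean_space) chart set"
    and nab :: "'a vfield \<Rightarrow> 'a vfield \<Rightarrow> 'a vfield"
    and g :: "'a \<Rightarrow> 'a tvec \<Rightarrow> 'a tvec \<Rightarrow> real"
  assumes "affine_riemann_manifold A nab g"
  shows
    "form_eq (tangent_bundle A)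
       (lee_form (tangent_bundle A) (canonical_J A nab) (canonical_g A nab g))
       (pullback_form A fst (\<lambda>p x. koszul_alpha A nab g p x - koszul_xi A nab g p x))
     \<and> (balanced (tangent_bundle A) (canonical_J A nab) (canonical_g A nab g)
          \<longleftrightarrow> form_eq A (koszul_alpha A nab g) (koszul_xi A nab g))
     \<and> (form_eq A (koszul_alpha A nab g) (koszul_xi A nab g)
          \<longleftrightarrow> (\<forall>p\<in>pts A.
                metric_trace A g
                  (\<lambda>X Y q. tdiff (adjoint_tensor A g (diff_tensor A nab g) X Y q)
                                 (diff_tensor A nab g X Y q)) p = tzero))
     \<and> (locally_conformally_balanced (tangent_bundle A) (canonical_J A nab) (canonical_g A nab g)
          \<longleftrightarrow> closed_form A (koszul_xi A nab g))"
proof -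
  interpret affine_riemann A g nab
    using assms by unfold_locales (simp_all add: affine_riemann_manifold_def manifold_def)
  show ?thesis
    by (intro conjI lee_form_pullback balanced_iff koszul_forms_eq_iff locally_conformally_balanced_iff)
qed

end
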